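(* Suppose $X$ is a doubling nondegenerate metric measure space, $p\in(0,1)$, $q\in[1,\infty)$ and $s\in\mathbb{R}$. Then the pairing $\langle f,g\rangle := \iint_{X^+} f\overline{g}\,d\mu\,\frac{dt}{t}$ identifies the dual of $T^{p,q}_s$ with $T^{\infty,q'}_{-s;\delta_{1,p}}$: for every $g \in T^{\infty,q'}_{-s;\delta_{1,p}}$ and $f\in T^{p,q}_s$ the integral converges absolutely and $|\langle f,g\rangle|\lesssim \|f\|_{T^{p,q}_s}\|g\|_{T^{\infty,q'}_{-s;\delta_{1,p}}}$; and every bounded linear functional $\varphi$ on $T^{p,q}_s$ is of the form $\varphi(f)=\langle f,g\rangle$ for some $g\in T^{\infty,q'}_{-s;\delta_{1,p}}$ with $\|g\|_{T^{\infty,q'}_{-s;\delta_{1,p}}}\lesssim\|\varphi\|$.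
   Context: $(X,d,\mu)$ metric space with Borel measure, nondegenerate ($0<V(x,r):=\mu(B(x,r))<\infty$) and doubling. $X^+ := X\times(0,\infty)$ with measure $d\mu\,dt/t$. $\Gamma(x):=\{(y,t):d(x,y)<t\}$, $T(B):=\{(y,t):B(y,t)\subset B\}$. $\mathcal{A}^q f(x) := (\iint_{\Gamma(x)}|f|^q\frac{d\mu(y)}{V(y,t)}\frac{dt}{t})^{1/q}$. $(V^sf)(y,t):=V(y,t)^sf(y,t)$. $\|f\|_{T^{p,q}_s} := \|\mathcal{A}^q(V^{-s}f)\|_{L^p(X)}$. For $r\in(0,\infty]$, $\sigma,\alpha\in\mathbb{R}$: $\|g\|_{T^{\infty,r}_{\sigma;\alpha}} := \sup_B \mu(B)^{-\alpha-1/r}\|V^{-\sigma}g\|_{L^r(T(B),d\mu\,dt/t)}$, supremum over all balls $B\subset X$, with $1/\infty:=0$. $\delta_{p,q} := 1/q-1/p$, so $\delta_{1,p} = 1/p-1$. $q'$ is the Hölder conjugate ($1'=\infty$). *)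

theory Defs
  imports "HOL-Probability.Probability"
begin

definition enn_powr :: "ennreal \<Rightarrow> real \<Rightarrow> ennreal" where
  "enn_powr x a = (if x = \<infinity> then \<infinity> else ennreal (enn2real x powr a))"

definition nondeg_doubling :: "('a::metric_space) measure \<Rightarrow> bool" where
  "nondeg_doubling M \<longleftrightarrow>
     sets M = sets borel \<and>
     (\<forall>x r. r > 0 \<longrightarrow> 0 < emeasure M (ball x r) \<and> emeasure M (ball x r) < \<infinity>) \<and>
     (\<exists>C. \<forall>x r. r > 0 \<longrightarrow> measure M (ball x (2*r)) \<le> C * measure M (ball x r))"

definition Vol :: "('a::metric_space) measure \<Rightarrow> 'a \<Rightarrow> real \<Rightarrow> real" where
  "Vol M y t = measure M (ball y t)"

definition dtt :: "real measure" where
  "dtt = density lborel (\<lambda>t. ennreal (indicator {0<..} t / t))"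

definition Xplus :: "'a measure \<Rightarrow> ('a \<times> real) measure" where
  "Xplus M = M \<Otimes>\<^sub>M dtt"

definition cone :: "'a::metric_space \<Rightarrow> ('a \<times> real) set" where
  "cone x = {(y,t). t > 0 \<and> dist x y < t}"

definition tent :: "'a::metric_space set \<Rightarrow> ('a \<times> real) set" where
  "tent B = {(y,t). t > 0 \<and> ball y t \<subseteq> B}"

definition Vmul :: "('a::metric_space) measure \<Rightarrow> real \<Rightarrow> ('a \<times> real \<Rightarrow> complex) \<Rightarrow> 'a \<times> real \<Rightarrow> complex" where
  "Vmul M s f = (\<lambda>(y,t). complex_of_real (Vol M y t powr s) * f (y,t))"

definition Aq :: "('a::metric_space) measure \<Rightarrow> real \<Rightarrow> ('a \<times> real \<Rightarrow> complex) \<Rightarrow> 'a \<Rightarrow> ennreal" where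
  "Aq M q f x = enn_powr
     (\<integral>\<^sup>+ z. indicator (cone x) z * ennreal (cmod (f z) powr q / Vol M (fst z) (snd z)) \<partial>Xplus M)
     (1/q)"

definition tent_norm :: "('a::metric_space) measure \<Rightarrow> real \<Rightarrow> real \<Rightarrow> real \<Rightarrow> ('a \<times> real \<Rightarrow> complex) \<Rightarrow> ennreal" where
  "tent_norm M p q s f = enn_powr (\<integral>\<^sup>+ x. enn_powr (Aq M q (Vmul M (-s) f) x) p \<partial>M) (1/p)"

definition tent_space :: "('a::metric_space) measure \<Rightarrow> real \<Rightarrow> real \<Rightarrow> real \<Rightarrow> ('a \<times> real \<Rightarrow> complex) set" where
  "tent_space M p q s = {f. f \<in> borel_measurable (Xplus M) \<and> tent_norm M p q s f < \<infinity>}"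

definition Lr_tent :: "('a::metric_space) measure \<Rightarrow> ennreal \<Rightarrow> 'a set \<Rightarrow> ('a \<times> real \<Rightarrow> complex) \<Rightarrow> ennreal" where
  "Lr_tent M r B h = (if r = \<infinity>
     then e2ennreal (esssup (Xplus M) (\<lambda>z. ereal (indicator (tent B) z * cmod (h z))))
     else enn_powr (\<integral>\<^sup>+ z. indicator (tent B) z * ennreal (cmod (h z) powr enn2real r) \<partial>Xplus M)
                   (1 / enn2real r))"

definition tent_inf_norm :: "('a::metric_space) measure \<Rightarrow> ennreal \<Rightarrow> real \<Rightarrow> real \<Rightarrow> ('a \<times> real \<Rightarrow> complex) \<Rightarrow> ennreal" where
  "tent_inf_norm M r \<sigma> \<alpha> g =
     (SUP (x,\<rho>) \<in> UNIV \<times> {0<..}.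
        ennreal (measure M (ball x \<rho>) powr (- \<alpha> - (if r = \<infinity> then 0 else 1 / enn2real r)))
        * Lr_tent M r (ball x \<rho>) (Vmul M (-\<sigma>) g))"

definition tent_inf_space :: "('a::metric_space) measure \<Rightarrow> ennreal \<Rightarrow> real \<Rightarrow> real \<Rightarrow> ('a \<times> real \<Rightarrow> complex) set" where
  "tent_inf_space M r \<sigma> \<alpha> = {g. g \<in> borel_measurable (Xplus M) \<and> tent_inf_norm M r \<sigma> \<alpha> g < \<infinity>}"

definition hconj :: "real \<Rightarrow> ennreal" where
  "hconj q = (if q = 1 then \<infinity> else ennreal (q / (q - 1)))"

definition delta :: "real \<Rightarrow> real \<Rightarrow> real" where
  "delta p q = 1/q - 1/p"

definition pairing :: "'a measure \<Rightarrow> ('a \<times> real \<Rightarrow> complex) \<Rightarrow> ('a \<times> real \<Rightarrow> complex) \<Rightarrow> complex" where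
  "pairing M f g = (\<integral> z. f z * cnj (g z) \<partial>Xplus M)"

definition linear_on :: "('b \<Rightarrow> complex) set \<Rightarrow> (('b \<Rightarrow> complex) \<Rightarrow> complex) \<Rightarrow> bool" where
  "linear_on T \<phi> \<longleftrightarrow> (\<forall>f\<in>T. \<forall>h\<in>T. \<phi> (\<lambda>z. f z + h z) = \<phi> f + \<phi> h) \<and>
                      (\<forall>f\<in>T. \<forall>c. \<phi> (\<lambda>z. c * f z) = c * \<phi> f)"

definition bounded_on :: "('b \<Rightarrow> complex) set \<Rightarrow> (('b \<Rightarrow> complex) \<Rightarrow> ennreal) \<Rightarrow> (('b \<Rightarrow> complex) \<Rightarrow> complex) \<Rightarrow> bool" where
  "bounded_on T N \<phi> \<longleftrightarrow> (\<exists>K\<ge>0. \<forall>f\<in>T. ennreal (cmod (\<phi> f)) \<le> ennreal K * N f)"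

definition fun_norm :: "('b \<Rightarrow> complex) set \<Rightarrow> (('b \<Rightarrow> complex) \<Rightarrow> ennreal) \<Rightarrow> (('b \<Rightarrow> complex) \<Rightarrow> complex) \<Rightarrow> real" where
  "fun_norm T N \<phi> = Inf {K. K \<ge> 0 \<and> (\<forall>f\<in>T. ennreal (cmod (\<phi> f)) \<le> ennreal K * N f)}"

end

theory Submission
  imports Defs
begin

text \<open>
  Write \<open>F = V\<^sup>-\<^sup>s |f|\<close>, \<open>G = V\<^sup>s |g|\<close>, \<open>\<alpha> = 1/p - 1\<close>, \<open>\<Lambda> = \<parallel>f\<parallel>\<close>.

  Boundedness of the pairing avoids atoms, coverings and maximal functions. By Fubini, \<open>\<integral> F G\<close> is
  comparable to the integral over \<open>x\<close> of \<open>F G / V\<close> over a half-aperture cone at \<open>x\<close>, restricted to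
  the heights \<open>t\<close> at which the area function of \<open>G\<close> truncated at \<open>t\<close> is \<open>\<lesssim> \<parallel>g\<parallel> V(x,t)\<^sup>\<alpha>\<close>; by Chebyshev's
  inequality and the Carleson condition on \<open>G\<close>, these \<open>x\<close> fill at least half of each ball.
  On the heights with \<open>V(x,t) \<sim> v\<close>, Hoelder's inequality bounds the contribution by
  \<open>\<parallel>g\<parallel> v\<^sup>\<alpha> min(\<A>F(x), v\<^sup>-\<^sup>1\<^sup>/\<^sup>p \<Lambda>)\<close>. Summing over dyadic \<open>v\<close> as in Hedberg's argument gives
  \<open>\<parallel>g\<parallel> \<A>F(x)\<^sup>p \<Lambda>\<^sup>1\<^sup>-\<^sup>p\<close>, whose integral over \<open>x\<close> is \<open>\<parallel>g\<parallel> \<Lambda>\<close>.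

  For the representation of a functional, fix a positive \<open>k\<close> in the tent space. Testing on \<open>k\<close>
  times indicators gives a complex measure, whose Radon-Nikodym density divided by \<open>k\<close> is the
  representing function; testing on \<open>L\<^sup>q\<close> functions supported in one tent bounds its norm.
\<close>

section \<open>Powers of extended reals, integral inequalities and signed Radon-Nikodym\<close>

text \<open>In the code \<open>L\<close> is the \<open>p\<close>-th power of the quasi-norm of
  \<open>f\<close>, so the two competing bounds read \<open>a powr (1/q)\<close> and
  \<open>(D * L / v) powr (1/p)\<close>. The slices are dyadic in the volume V(x,t) and not in the
  height t: without reverse doubling, infinitely many dyadic heights can carry comparable volumes
  (in a bounded space all large ones do), and a sum over heights would diverge. Goodness is a
  property of the pair (x,t), since an area function truncated at t controls everything below t;
  good heights close to the top of a slice therefore control all lower good heights in it. For q = 1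
  the Carleson condition is a pointwise bound and every height is good.

  For p < 1 the tent space is only quasi-normed. The representation relies instead on its being
  solid and on dominated convergence in the quasi-norm. At first it covers only functions dominated
  by a multiple of \<open>k\<close>; beyond these, absolute convergence of the pairing comes from
  the first half of the theorem, which is why the two halves are not independent.\<close>

lemma enn_powr_top [simp]: "enn_powr top a = top"
  by (simp add: enn_powr_def)

lemma enn_powr_ennreal: "x \<ge> 0 \<Longrightarrow> enn_powr (ennreal x) a = ennreal (x powr a)"
  by (simp add: enn_powr_def)

lemma enn_powr_0 [simp]: "enn_powr 0 a = 0"
  by (simp add: enn_powr_def)

lemma enn_powr_eq_top_iff [simp]: "enn_powr x a = top \<longleftrightarrow> x = top"
  by (simp add: enn_powr_def)

lemma enn_powr_less_top_iff [simp]: "enn_powr x a < top \<longleftrightarrow> x < top"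
  by (simp add: less_top[symmetric])

lemma enn_powr_mono: "0 \<le> a \<Longrightarrow> x \<le> y \<Longrightarrow> enn_powr x a \<le> enn_powr y a"
  by (cases x; cases y) (auto simp: enn_powr_def powr_mono2 top_unique)

lemma enn_powr_enn_powr: "enn_powr (enn_powr x a) b = enn_powr x (a * b)"
  by (cases x) (auto simp: enn_powr_ennreal powr_powr)

lemma enn_powr_one [simp]: "enn_powr x 1 = x"
  by (cases x) (auto simp: enn_powr_ennreal)

lemma enn_powr_measurable [measurable]: "(\<lambda>x. enn_powr x a) \<in> borel_measurable borel"
  unfolding enn_powr_def by measurable

lemma enn_powr_tendsto_0:
  assumes "0 < a" "(f \<longlongrightarrow> 0) F"
  shows "((\<lambda>n. enn_powr (f n) a) \<longlongrightarrow> 0) F"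
proof -
  have ev: "\<forall>\<^sub>F n in F. f n < 1"
    using assms(2) by (rule order_tendstoD) simp
  have "((\<lambda>n. enn2real (f n)) \<longlongrightarrow> enn2real 0) F"
    using tendsto_enn2real[of f 0] assms(2) by simp
  then have "((\<lambda>n. enn2real (f n) powr a) \<longlongrightarrow> 0 powr a) F"
    using assms(1) by (intro tendsto_powr2) auto
  then have "((\<lambda>n. ennreal (enn2real (f n) powr a)) \<longlongrightarrow> ennreal (0 powr a)) F"
    by (rule tendsto_ennrealI)
  then have "((\<lambda>n. ennreal (enn2real (f n) powr a)) \<longlongrightarrow> 0) F" by simp
  then show ?thesis
    by (rule Lim_transform_eventually)
      (use ev in \<open>auto elim!: eventually_mono simp: enn_powr_def\<close>)
qed

text \<open>Young's inequality for F/A and G/B, integrated against the weight. \<open>A\<close> and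
  \<open>B\<close> are upper bounds for the two norms and not the norms themselves, since only
  bounds are available later. A vanishing bound forbids the division, but then the integrand
  vanishes almost everywhere.\<close>

lemma nn_integral_Holder_le:
  fixes F G w :: "'b \<Rightarrow> real"
  assumes q: "1 < q" "1/q + 1/r = 1"
    and [measurable]: "F \<in> borel_measurable N" "G \<in> borel_measurable N" "w \<in> borel_measurable N"
    and nn: "\<And>z. 0 \<le> F z" "\<And>z. 0 \<le> G z" "\<And>z. 0 \<le> w z"
    and A: "0 \<le> A" "(\<integral>\<^sup>+z. ennreal (w z * F z powr q) \<partial>N) \<le> ennreal (A powr q)"
    and B: "0 \<le> B" "(\<integral>\<^sup>+z. ennreal (w z * G z powr r) \<partial>N) \<le> ennreal (B powr r)"
  shows "(\<integral>\<^sup>+z. ennreal (w z * (F z * G z)) \<partial>N) \<le> ennreal (A * B)"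
proof -
  have q0: "0 < 1/q" using q by simp
  have r1: "r > 1"
  proof -
    have "1/r = 1 - 1/q" using q by simp
    moreover have "1/q > 0" "1/q < 1" using q by auto
    ultimately have "1/r > 0" "1/r < 1" by auto
    then show ?thesis by (simp add: field_simps split: if_splits)
  qed
  have r0: "0 < 1/r" using r1 by simp
  have zero: "(\<integral>\<^sup>+z. ennreal (w z * (F z * G z)) \<partial>N) = 0"
    if "(\<integral>\<^sup>+z. ennreal (w z * h z powr e) \<partial>N) \<le> ennreal (0 powr e)"
       "h = F \<or> h = G" for h e
  proof -
    have [measurable]: "h \<in> borel_measurable N" using that by auto
    have "(\<integral>\<^sup>+z. ennreal (w z * h z powr e) \<partial>N) = 0" using that by simp
    then have "AE z in N. ennreal (w z * h z powr e) = 0"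
      by (subst (asm) nn_integral_0_iff_AE) auto
    then have "AE z in N. w z * h z powr e = 0"
      by eventually_elim (metis ennreal_eq_0_iff antisym mult_nonneg_nonneg nn(3) powr_ge_zero)
    then have "AE z in N. w z * (F z * G z) = 0"
      by eventually_elim (use that in auto)
    then show ?thesis by (subst nn_integral_0_iff_AE) (auto elim!: eventually_mono)
  qed
  consider "A = 0" | "B = 0" | "A > 0" "B > 0" using A B by linarith
  then show ?thesis
  proof cases
    case 1 then show ?thesis using zero[of F q] A by simp
  next
    case 2 then show ?thesis using zero[of G r] B by simp
  next
    case 3
    have *: "w z * (F z * G z) \<le> A * B * (1 / (q * A powr q) * (w z * F z powr q) + 1 / (r * B powr r) * (w z * G z powr r))" for z
    proof -
      have "(F z / A) * (G z / B) \<le> (F z / A) powr q / q + (G z / B) powr r / r"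
        using q r1 nn 3 by (intro Youngs_inequality) auto
      then have "A * B * w z * ((F z / A) * (G z / B)) \<le> A * B * w z * ((F z / A) powr q / q + (G z / B) powr r / r)"
        using nn 3 by (intro mult_left_mono) auto
      then show ?thesis using 3 nn by (simp add: powr_divide field_simps)
    qed
    have "(\<integral>\<^sup>+z. ennreal (w z * (F z * G z)) \<partial>N)
      \<le> (\<integral>\<^sup>+z. ennreal (A * B) * (ennreal (1 / (q * A powr q)) * ennreal (w z * F z powr q) + ennreal (1 / (r * B powr r)) * ennreal (w z * G z powr r)) \<partial>N)"
      using * q r1 3 nn by (intro nn_integral_mono) (simp add: ennreal_mult[symmetric] ennreal_plus[symmetric] ennreal_leI del: ennreal_plus)
    also have "\<dots> = ennreal (A * B) * (ennreal (1 / (q * A powr q)) * (\<integral>\<^sup>+z. ennreal (w z * F z powr q) \<partial>N)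
        + ennreal (1 / (r * B powr r)) * (\<integral>\<^sup>+z. ennreal (w z * G z powr r) \<partial>N))"
      by (simp add: nn_integral_cmult nn_integral_add)
    also have "\<dots> \<le> ennreal (A * B) * (ennreal (1 / (q * A powr q)) * ennreal (A powr q)
        + ennreal (1 / (r * B powr r)) * ennreal (B powr r))"
      by (intro mult_left_mono add_mono A B) auto
    also have "\<dots> = ennreal (A * B) * (ennreal (1 / q) + ennreal (1 / r))"
      using q r1 3 by (simp add: ennreal_mult[symmetric])
    also have "ennreal (1 / q) + ennreal (1 / r) = 1"
      unfolding ennreal_plus[of "1/q" "1/r", symmetric, OF less_imp_le less_imp_le, OF q0 r0] q(2) by simp
    finally show ?thesis by simp
  qed
qed

text \<open>A sequence approaching the supremum strictly from below would miss an attained maximum,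
  hence the two cases. The supremum is formed in \<open>ereal\<close> so that unbounded sets are
  covered.\<close>

lemma incseq_cofinal:
  fixes S :: "real set"
  assumes "S \<noteq> {}"
  obtains u :: "nat \<Rightarrow> real" where "incseq u" "\<And>n. u n \<in> S" "\<And>t. t \<in> S \<Longrightarrow> \<exists>n. t \<le> u n"
proof (cases "\<exists>m\<in>S. \<forall>t\<in>S. t \<le> m")
  case True
  then obtain m where "m \<in> S" "\<forall>t\<in>S. t \<le> m" by blast
  then show ?thesis by (intro that[of "\<lambda>_. m"]) (auto simp: incseq_def)
next
  case False
  have "ereal ` S \<noteq> {}" using assms by simp
  from Sup_countable_SUP[OF this] obtain f where f: "incseq f" "range f \<subseteq> ereal ` S" "Sup (ereal ` S) = (SUP i. f i)"
    by auto
  have "\<forall>n. \<exists>x\<in>S. f n = ereal x" using f(2) by (auto simp: image_subset_iff)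
  then obtain u where u: "\<And>n. u n \<in> S" "\<And>n. f n = ereal (u n)" by metis
  show ?thesis
  proof (rule that[of u])
    show "incseq u" using f(1) u(2) by (simp add: incseq_def)
    fix t assume "t \<in> S"
    then obtain t' where t': "t' \<in> S" "t < t'" using False by (meson not_le)
    have "ereal t < ereal t'" using t' by simp
    also have "ereal t' \<le> (SUP i. f i)" unfolding f(3)[symmetric] using t' by (intro Sup_upper) auto
    finally obtain n where "ereal t < f n" by (auto simp: less_SUP_iff)
    then show "\<exists>n. t \<le> u n" using u(2)[of n] by (intro exI[of _ n]) simp
  qed (fact u)
qed

text \<open>Monotone convergence along a cofinal sequence: the bound passes to the whole integral
  without loss although the supremum of \<open>S\<close> need not lie in \<open>S\<close>. The lemma
  is applied with the height, and with minus the height, as \<tau>.\<close>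

lemma nn_integral_truncation_le:
  fixes S :: "real set" and \<tau> :: "'b \<Rightarrow> real" and h :: "'b \<Rightarrow> ennreal"
  assumes [measurable]: "h \<in> borel_measurable N" "\<tau> \<in> borel_measurable N"
    and B: "\<And>t. t \<in> S \<Longrightarrow> (\<integral>\<^sup>+z. indicator {z. \<tau> z \<le> t} z * h z \<partial>N) \<le> B"
    and supp: "\<And>z. h z \<noteq> 0 \<Longrightarrow> \<tau> z \<in> S"
  shows "(\<integral>\<^sup>+z. h z \<partial>N) \<le> B"
proof (cases "S = {}")
  case True
  then have "h z = 0" for z using supp[of z] by auto
  then show ?thesis by simp
next
  case False
  obtain u where u: "incseq u" "\<And>n. u n \<in> S" "\<And>t. t \<in> S \<Longrightarrow> \<exists>n. t \<le> u n"
    using incseq_cofinal[OF False] by blast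
  have eq: "h z = (SUP n. indicator {z. \<tau> z \<le> u n} z * h z)" for z
  proof (cases "h z = 0")
    case False
    then obtain n where "\<tau> z \<le> u n" using u(3) supp by blast
    then have "h z \<le> (SUP n. indicator {z. \<tau> z \<le> u n} z * h z)"
      by (intro SUP_upper2[of n]) auto
    moreover have "(SUP n. indicator {z. \<tau> z \<le> u n} z * h z) \<le> h z"
      by (intro SUP_least) (auto simp: indicator_def)
    ultimately show ?thesis by simp
  qed simp
  have "(\<integral>\<^sup>+z. h z \<partial>N) = (\<integral>\<^sup>+z. (SUP n. indicator {z. \<tau> z \<le> u n} z * h z) \<partial>N)"
    using eq by simp
  also have "\<dots> = (SUP n. \<integral>\<^sup>+z. indicator {z. \<tau> z \<le> u n} z * h z \<partial>N)"
  proof (rule nn_integral_monotone_convergence_SUP)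
    show "incseq (\<lambda>n z. indicator {z. \<tau> z \<le> u n} z * h z)"
      using u(1) by (fastforce simp: incseq_def le_fun_def indicator_def intro: order_trans)
  qed measurable
  also have "\<dots> \<le> B" using B u(2) by (intro SUP_least) auto
  finally show ?thesis .
qed

section \<open>Radon-Nikodym for bounded signed set functions\<close>

text \<open>The upper variation of \<nu>, its supremum over measurable subsets, is a finite measure
  that is absolutely continuous with respect to \<open>N\<close>; \<open>h\<close> is its density.
  It appears twice in the proof: \<open>P\<close> with values in \<open>ennreal\<close> to build the
  measure, \<open>R\<close> with real values for sums with negative terms. They agree because the
  empty set makes both nonnegative.\<close>

lemma positive_part_density:
  fixes \<nu> :: "'b set \<Rightarrow> real"
  assumes "sigma_finite_measure N"
    and ca: "\<And>A. range A \<subseteq> sets N \<Longrightarrow> disjoint_family A \<Longrightarrow> (\<lambda>i. \<nu> (A i)) sums \<nu> (\<Union>i. A i)"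
    and ac: "\<And>E. E \<in> null_sets N \<Longrightarrow> \<nu> E = 0"
    and bd: "\<And>E. E \<in> sets N \<Longrightarrow> \<bar>\<nu> E\<bar> \<le> K"
  shows "\<exists>h :: 'b \<Rightarrow> real. integrable N h \<and>
    (\<forall>E\<in>sets N. (SUP F\<in>{F\<in>sets N. F \<subseteq> E}. \<nu> F) = (\<integral>z. indicator E z * h z \<partial>N))"
proof -
  interpret sigma_finite_measure N by fact
  have \<nu>0: "\<nu> {} = 0" using ac[of "{}"] by simp
  have add: "\<nu> (A \<union> B) = \<nu> A + \<nu> B" if "A \<in> sets N" "B \<in> sets N" "A \<inter> B = {}" for A B
  proof -
    have "(\<lambda>i. \<nu> (binaryset A B i)) sums \<nu> (\<Union>i. binaryset A B i)"
      using that by (intro ca) (auto simp: range_binaryset_eq disjoint_family_on_def binaryset_def)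
    moreover have "(\<lambda>i. \<nu> (binaryset A B i)) sums (\<nu> A + \<nu> B)"
      using sums_finite[of "{0,1}" "\<lambda>i. \<nu> (binaryset A B i)"] by (auto simp: binaryset_def \<nu>0)
    ultimately show ?thesis by (simp add: UN_binaryset_eq sums_unique2)
  qed
  define P where "P E = (SUP F\<in>{F\<in>sets N. F \<subseteq> E}. ennreal (\<nu> F))" for E
  define R where "R E = (SUP F\<in>{F\<in>sets N. F \<subseteq> E}. \<nu> F)" for E
  have PI: "ennreal (\<nu> F) \<le> P E" if "F \<in> sets N" "F \<subseteq> E" for E F
    unfolding P_def using that by (intro SUP_upper) auto
  have Pmono: "P E \<le> P E'" if "E \<subseteq> E'" for E E'
    unfolding P_def using that by (intro SUP_subset_mono) auto
  have PR: "P E = ennreal (R E)" "0 \<le> R E" for E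
  proof -
    have bdd: "bdd_above (\<nu> ` {F\<in>sets N. F \<subseteq> E})"
      using bd by (force intro!: bdd_aboveI[of _ K] dest: abs_le_D1)
    have "\<nu> {} \<le> R E" unfolding R_def by (rule cSUP_upper[OF _ bdd]) auto
    then show "0 \<le> R E" by (simp add: \<nu>0)
    have "P E \<le> ennreal (R E)" unfolding P_def R_def
      by (intro SUP_least ennreal_leI cSUP_upper[OF _ bdd]) auto
    moreover have "ennreal (R E) \<le> P E"
    proof (cases "P E")
      case (real x)
      have "R E \<le> x" unfolding R_def
      proof (rule cSUP_least)
        show "{F \<in> sets N. F \<subseteq> E} \<noteq> {}" by auto
        fix F assume "F \<in> {F \<in> sets N. F \<subseteq> E}"
        then have "ennreal (\<nu> F) \<le> ennreal x" using PI[of F E] real by simp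
        then show "\<nu> F \<le> x" using real by (simp add: ennreal_le_iff)
      qed
      then show ?thesis using real by (simp add: ennreal_leI)
    qed simp
    ultimately show "P E = ennreal (R E)" by simp
  qed
  have Padd: "P A + P B \<le> P (A \<union> B)" if AB: "A \<inter> B = {}" for A B
  proof -
    \<comment> \<open>\<open>ennreal\<close> sends negative numbers to 0, so a summand that is not
      positive drops out and the other is compared alone. Only two positive values call for
      additivity of \<nu>.\<close>
    have one: "ennreal (\<nu> F) + ennreal (\<nu> G) \<le> P (A \<union> B)"
      if F: "F \<in> sets N" "F \<subseteq> A" and G: "G \<in> sets N" "G \<subseteq> B" for F G
    proof -
      consider "\<nu> F \<le> 0" | "\<nu> G \<le> 0" | "\<nu> F > 0" "\<nu> G > 0" by linarith
      then show ?thesis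
      proof cases
        case 1 then show ?thesis using PI[of G "A \<union> B"] G by (auto simp: ennreal_neg)
      next
        case 2 then show ?thesis using PI[of F "A \<union> B"] F by (auto simp: ennreal_neg)
      next
        case 3
        have "F \<inter> G = {}" using AB F G by auto
        then have "ennreal (\<nu> F) + ennreal (\<nu> G) = ennreal (\<nu> (F \<union> G))"
          using add[of F G] F G 3 by simp
        also have "\<dots> \<le> P (A \<union> B)" using F G by (intro PI) auto
        finally show ?thesis .
      qed
    qed
    have ne: "{F \<in> sets N. F \<subseteq> E} \<noteq> {}" for E by auto
    have "ennreal (\<nu> F) + P B \<le> P (A \<union> B)" if F: "F \<in> sets N" "F \<subseteq> A" for F
      unfolding P_def[of B] using ne[of B] one[OF F]
      by (subst ennreal_SUP_add_right) (auto intro!: SUP_least)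
    then show ?thesis
      unfolding P_def[of A]
      by (subst ennreal_SUP_add_left[symmetric, OF ne]) (auto intro!: SUP_least)
  qed
  have Pca: "(\<Sum>i. P (A i)) = P (\<Union>i. A i)" if A: "range A \<subseteq> sets N" "disjoint_family A" for A
  proof (rule antisym)
    have "(\<Sum>i<n. P (A i)) \<le> P (\<Union>i<n. A i)" for n
    proof (induction n)
      case (Suc n)
      have "(\<Union>i<n. A i) \<inter> A n = {}"
        using A(2) by (auto simp: disjoint_family_on_def) (metis disjoint_iff less_irrefl)
      then have "P (\<Union>i<n. A i) + P (A n) \<le> P (\<Union>i<Suc n. A i)"
        using Padd[of "\<Union>i<n. A i" "A n"] by (simp add: lessThan_Suc Un_commute)
      then show ?case unfolding sum.lessThan_Suc by (rule order_trans[OF add_right_mono[OF Suc]])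
    qed simp
    then have "(\<Sum>i<n. P (A i)) \<le> P (\<Union>i. A i)" for n
      by (rule order_trans) (intro Pmono, auto)
    then show "(\<Sum>i. P (A i)) \<le> P (\<Union>i. A i)"
      by (intro suminf_le_const) auto
    \<comment> \<open>A competitor \<open>F\<close> is cut along the \<open>A i\<close>. Its partial
      sums may contain negative terms, so they are bounded in the reals by sums of
      \<open>R (A i)\<close> before returning to \<open>ennreal\<close>.\<close>
    show "P (\<Union>i. A i) \<le> (\<Sum>i. P (A i))"
      unfolding P_def[of "\<Union>i. A i"]
    proof (intro SUP_least)
      fix F assume F: "F \<in> {F \<in> sets N. F \<subseteq> (\<Union>i. A i)}"
      have "(\<lambda>i. \<nu> (F \<inter> A i)) sums \<nu> (\<Union>i. F \<inter> A i)"
        using A F by (intro ca) (auto simp: disjoint_family_on_def)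
      also have "(\<Union>i. F \<inter> A i) = F" using F by auto
      finally have "(\<lambda>n. ennreal (\<Sum>i<n. \<nu> (F \<inter> A i))) \<longlonglongrightarrow> ennreal (\<nu> F)"
        unfolding sums_def by (rule tendsto_ennrealI)
      then show "ennreal (\<nu> F) \<le> (\<Sum>i. P (A i))"
      proof (rule LIMSEQ_le_const2, intro exI allI impI)
        fix n
        have "ennreal (\<Sum>i<n. \<nu> (F \<inter> A i)) \<le> ennreal (\<Sum>i<n. R (A i))"
        proof (intro ennreal_leI sum_mono)
          fix i
          have "ennreal (\<nu> (F \<inter> A i)) \<le> ennreal (R (A i))"
            using PI[of "F \<inter> A i" "A i"] A F by (auto simp: PR(1))
          then show "\<nu> (F \<inter> A i) \<le> R (A i)" using PR(2)[of "A i"]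
            by (simp add: ennreal_le_iff)
        qed
        also have "\<dots> = (\<Sum>i<n. P (A i))" by (simp add: PR sum_ennreal)
        also have "\<dots> \<le> (\<Sum>i. P (A i))" by (intro sum_le_suminf) auto
        finally show "ennreal (\<Sum>i<n. \<nu> (F \<inter> A i)) \<le> (\<Sum>i. P (A i))" .
      qed
    qed
  qed
  define \<mu> where "\<mu> = measure_of (space N) (sets N) P"
  have P0: "P {} = 0" by (simp add: P_def \<nu>0)
  have sets\<mu> [measurable_cong, simp]: "sets \<mu> = sets N" by (simp add: \<mu>_def)
  have em: "emeasure \<mu> E = P E" if "E \<in> sets N" for E
    using that by (intro emeasure_measure_of[OF \<mu>_def])
      (auto simp: positive_def countably_additive_def P0 Pca sets.space_closed sets.sets_into_space)
  have "absolutely_continuous N \<mu>"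
    unfolding absolutely_continuous_def
  proof
    fix E assume E: "E \<in> null_sets N"
    have "P E \<le> 0" unfolding P_def
    proof (intro SUP_least)
      fix F assume "F \<in> {F \<in> sets N. F \<subseteq> E}"
      then have "F \<in> null_sets N" using E by (auto intro: null_sets_subset)
      then show "ennreal (\<nu> F) \<le> 0" using ac[of F] by simp
    qed
    then show "E \<in> null_sets \<mu>" using E em[of E] by (auto simp: null_sets_def)
  qed
  then obtain f where f[measurable]: "f \<in> borel_measurable N" and d: "density N f = \<mu>"
    using Radon_Nikodym[of \<mu>] by auto
  have fE: "(\<integral>\<^sup>+z. f z * indicator E z \<partial>N) = ennreal (R E)" if "E \<in> sets N" for E
    using em[OF that] emeasure_density[OF f that] by (simp add: d PR)
  have fin: "(\<integral>\<^sup>+z. f z \<partial>N) = ennreal (R (space N))"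
    unfolding fE[of "space N", symmetric, OF sets.top] by (rule nn_integral_cong) simp
  then have AE: "AE z in N. f z \<noteq> \<infinity>"
    by (intro nn_integral_PInf_AE) auto
  define h where "h z = enn2real (f z)" for z
  have AEh: "AE z in N. ennreal (h z) = f z"
    using AE by eventually_elim (auto simp: h_def less_top)
  have [measurable]: "h \<in> borel_measurable N" unfolding h_def by measurable
  have hE: "(\<integral>\<^sup>+z. ennreal (indicator E z * h z) \<partial>N) = ennreal (R E)" if [measurable]: "E \<in> sets N" for E
    unfolding fE[OF that, symmetric]
    by (rule nn_integral_cong_AE) (use AEh in \<open>eventually_elim, auto simp: indicator_def\<close>)
  have hnn: "0 \<le> h z" for z by (simp add: h_def)
  show ?thesis
  proof (intro exI[of _ h] conjI ballI)
    have "(\<integral>\<^sup>+z. ennreal (h z) \<partial>N) = (\<integral>\<^sup>+z. f z \<partial>N)"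
      by (rule nn_integral_cong_AE) (use AEh in auto)
    then show "integrable N h"
      unfolding integrable_iff_bounded using fin hnn by simp
    fix E assume [measurable]: "E \<in> sets N"
    show "(SUP F\<in>{F\<in>sets N. F \<subseteq> E}. \<nu> F) = (\<integral>z. indicator E z * h z \<partial>N)"
      using hE[of E] hnn PR(2)[of E]
      by (subst integral_eq_nn_integral) (auto simp: R_def[symmetric])
  qed
qed

text \<open>Jordan decomposition without a Hahn set. Complementation in \<open>E\<close> permutes
  the measurable subsets of \<open>E\<close>, so the supremum of \<nu> over them equals the value at
  \<open>E\<close> plus the supremum of -\<nu>. Both suprema are integrals of densities, and their
  difference is the value at \<open>E\<close>.\<close>

lemma signed_Radon_Nikodym:
  fixes \<nu> :: "'b set \<Rightarrow> real"
  assumes N: "sigma_finite_measure N"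
    and ca: "\<And>A. range A \<subseteq> sets N \<Longrightarrow> disjoint_family A \<Longrightarrow> (\<lambda>i. \<nu> (A i)) sums \<nu> (\<Union>i. A i)"
    and ac: "\<And>E. E \<in> null_sets N \<Longrightarrow> \<nu> E = 0"
    and bd: "\<And>E. E \<in> sets N \<Longrightarrow> \<bar>\<nu> E\<bar> \<le> K"
  obtains h :: "'b \<Rightarrow> real" where "integrable N h"
    "\<And>E. E \<in> sets N \<Longrightarrow> \<nu> E = (\<integral>z. indicator E z * h z \<partial>N)"
proof -
  obtain h1 where h1: "integrable N h1"
    "\<And>E. E \<in> sets N \<Longrightarrow> (SUP F\<in>{F\<in>sets N. F \<subseteq> E}. \<nu> F) = (\<integral>z. indicator E z * h1 z \<partial>N)"
    using positive_part_density[where \<nu> = \<nu> and K = K, OF N ca ac bd] by blast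
  have ca': "(\<lambda>i. - \<nu> (A i)) sums - \<nu> (\<Union>i. A i)" if "range A \<subseteq> sets N" "disjoint_family A" for A
    using ca[OF that] by (rule sums_minus)
  have ac': "- \<nu> E = 0" if "E \<in> null_sets N" for E using ac[OF that] by simp
  have bd': "\<bar>- \<nu> E\<bar> \<le> K" if "E \<in> sets N" for E using bd[OF that] by simp
  obtain h2 where h2: "integrable N h2"
    "\<And>E. E \<in> sets N \<Longrightarrow> (SUP F\<in>{F\<in>sets N. F \<subseteq> E}. - \<nu> F) = (\<integral>z. indicator E z * h2 z \<partial>N)"
    using positive_part_density[where \<nu> = "\<lambda>E. - \<nu> E" and K = K, OF N ca' ac' bd'] by blast
  show ?thesis
  proof (rule that[of "\<lambda>z. h1 z - h2 z"])
    show "integrable N (\<lambda>z. h1 z - h2 z)" using h1 h2 by simp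
    fix E assume E[measurable]: "E \<in> sets N"
    have int: "integrable N (\<lambda>z. indicator E z * h1 z)" "integrable N (\<lambda>z. indicator E z * h2 z)"
      using h1(1) h2(1) integrable_real_mult_indicator[OF E] by (auto simp: mult.commute)
    have \<nu>0: "\<nu> {} = 0" using ac[of "{}"] by simp
    have compl: "\<nu> F = \<nu> E - \<nu> (E - F)" if "F \<in> sets N" "F \<subseteq> E" for F
    proof -
      let ?A = "binaryset F (E - F)"
      have "(\<lambda>i. \<nu> (?A i)) sums \<nu> (\<Union>i. ?A i)"
        using that E by (intro ca) (auto simp: range_binaryset_eq disjoint_family_on_def binaryset_def)
      moreover have "(\<lambda>i. \<nu> (?A i)) sums (\<nu> F + \<nu> (E - F))"
        using sums_finite[of "{0,1}" "\<lambda>i. \<nu> (?A i)"] by (auto simp: binaryset_def \<nu>0)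
      ultimately have "\<nu> (F \<union> (E - F)) = \<nu> F + \<nu> (E - F)" by (simp add: UN_binaryset_eq sums_unique2)
      then show ?thesis using that by (simp add: Un_absorb1)
    qed
    let ?S = "{F\<in>sets N. F \<subseteq> E}"
    have "\<nu> F \<le> K" "- \<nu> F \<le> K" if "F \<in> sets N" for F using bd[OF that] by auto
    then have bdd: "bdd_above (\<nu> ` ?S)" "bdd_above ((\<lambda>F. - \<nu> F) ` ?S)"
      by (intro bdd_aboveI2[where M=K]; blast)+
    have ne: "?S \<noteq> {}" by auto
    define s1 where "s1 = (SUP F\<in>?S. \<nu> F)"
    define s2 where "s2 = (SUP F\<in>?S. - \<nu> F)"
    have a1: "\<nu> F \<le> \<nu> E + s2" "- \<nu> F \<le> s1 - \<nu> E" if F: "F \<in> ?S" for F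
    proof -
      have EF: "E - F \<in> ?S" using F sets.Diff[OF E, of F] by simp
      have c: "\<nu> F = \<nu> E - \<nu> (E - F)" using compl[of F] F by blast
      have "- \<nu> (E - F) \<le> s2" unfolding s2_def by (rule cSUP_upper[where f = "\<lambda>F. - \<nu> F", OF EF bdd(2)])
      then show "\<nu> F \<le> \<nu> E + s2" using c by linarith
      have "\<nu> (E - F) \<le> s1" unfolding s1_def by (rule cSUP_upper[OF EF bdd(1)])
      then show "- \<nu> F \<le> s1 - \<nu> E" using c by linarith
    qed
    have l1: "s1 \<le> \<nu> E + s2" unfolding s1_def by (rule cSUP_least[OF ne a1(1)])
    have l2: "s2 \<le> s1 - \<nu> E" unfolding s2_def by (rule cSUP_least[OF ne a1(2)])
    show "\<nu> E = (\<integral>z. indicator E z * (h1 z - h2 z) \<partial>N)"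
      unfolding right_diff_distrib Bochner_Integration.integral_diff[OF int] h1(2)[OF E, symmetric] h2(2)[OF E, symmetric]
        s1_def[symmetric] s2_def[symmetric] using l1 l2 by linarith
  qed
qed

section \<open>Area integrals on doubling spaces\<close>

lemma enn_powr_ennreal_mult:
  assumes "0 \<le> c"
  shows "enn_powr (ennreal c * y) a = ennreal (c powr a) * enn_powr y a"
proof (cases "c = 0")
  case False
  then show ?thesis using assms
    by (cases y) (auto simp: ennreal_mult[symmetric] enn_powr_ennreal powr_mult ennreal_mult_top)
qed simp

text \<open>With \<open>u\<close> the \<open>q\<close>-th power of |F| this is the
  \<open>q\<close>-th power of the area function, and \<open>tent_int\<close> with exponent p/q is
  the \<open>p\<close>-th power of the quasi-norm. Working with \<open>u\<close> removes
  \<open>q\<close> and makes the inner integral linear, so that Tonelli's theorem applies to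
  it.\<close>

definition cone_int :: "('a::metric_space) measure \<Rightarrow> ('a \<times> real \<Rightarrow> real) \<Rightarrow> 'a \<Rightarrow> ennreal" where
  "cone_int M u x = (\<integral>\<^sup>+ z. indicator (cone x) z * ennreal (u z / Vol M (fst z) (snd z)) \<partial>Xplus M)"

definition tent_int :: "('a::metric_space) measure \<Rightarrow> real \<Rightarrow> ('a \<times> real \<Rightarrow> real) \<Rightarrow> ennreal" where
  "tent_int M \<theta> u = (\<integral>\<^sup>+ x. enn_powr (cone_int M u x) \<theta> \<partial>M)"

lemma Aq_eq_cone_int: "Aq M q F x = enn_powr (cone_int M (\<lambda>z. cmod (F z) powr q) x) (1/q)"
  by (simp add: Aq_def cone_int_def)

lemma tent_norm_eq_tent_int:
  "tent_norm M p q s f = enn_powr (tent_int M (p/q) (\<lambda>z. cmod (Vmul M (-s) f z) powr q)) (1/p)"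
  by (simp add: tent_norm_def tent_int_def Aq_eq_cone_int enn_powr_enn_powr)

text \<open>Second countability identifies the Borel sets of the product with the product
  sigma-algebra, through which tents, built from open sets, become measurable for the product
  measure.\<close>

locale doubling_space =
  fixes M :: "('a::{metric_space, second_countable_topology}) measure" and D :: real
  assumes sets_M [measurable_cong]: "sets M = sets borel"
    and ball_pos: "\<And>x r. 0 < r \<Longrightarrow> 0 < emeasure M (ball x r)"
    and ball_finite: "\<And>x r. 0 < r \<Longrightarrow> emeasure M (ball x r) < \<infinity>"
    and D_ge_1: "1 \<le> D"
    and doubling: "\<And>x r. 0 < r \<Longrightarrow> measure M (ball x (2 * r)) \<le> D * measure M (ball x r)"
begin

lemma space_M [simp]: "space M = UNIV"
  using sets_eq_imp_space_eq[OF sets_M] by simp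

lemma emeasure_ball: "emeasure M (ball x r) = ennreal (Vol M x r)"
proof (cases "0 < r")
  case True
  then show ?thesis using ball_finite[of r x] by (simp add: Vol_def emeasure_eq_ennreal_measure)
qed (simp add: Vol_def ball_empty)

lemma Vol_pos: "0 < r \<Longrightarrow> 0 < Vol M x r"
  using ball_pos[of r x] unfolding emeasure_ball by simp

lemma Vol_nonneg [simp]: "0 \<le> Vol M x r"
  by (simp add: Vol_def)

lemma measure_subset_ball: 
  assumes "A \<in> sets M" "A \<subseteq> ball y t" shows "measure M A \<le> Vol M y t"
proof -
  have "emeasure M (ball y t) < \<infinity>" by (simp add: emeasure_ball)
  then show ?thesis
    unfolding Vol_def using assms by (intro measure_mono_fmeasurable) (auto simp: fmeasurable_def sets_M)
qed

lemma Vol_mono: "ball x r \<subseteq> ball y t \<Longrightarrow> Vol M x r \<le> Vol M y t"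
  using measure_subset_ball[of "ball x r" y t] by (simp add: Vol_def sets_M)

lemma Vol_double: "0 < r \<Longrightarrow> Vol M x (2 * r) \<le> D * Vol M x r"
  using doubling by (simp add: Vol_def)

sublocale sigma_finite_measure M
proof
  show "\<exists>A. countable A \<and> A \<subseteq> sets M \<and> \<Union>A = space M \<and> (\<forall>a\<in>A. emeasure M a \<noteq> \<infinity>)"
  proof (intro exI[of _ "range (\<lambda>n::nat. ball undefined (real n))"] conjI)
    have "\<exists>n::nat. dist undefined x < real n" for x :: 'a
      by (rule reals_Archimedean2)
    then show "\<Union> (range (\<lambda>n::nat. ball undefined (real n))) = space M" by auto
  qed (auto simp: sets_M emeasure_ball)
qed

end

section \<open>The upper half space as a measure space\<close>

lemma sets_dtt [measurable_cong]: "sets dtt = sets borel"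
  by (simp add: dtt_def)

lemma sigma_finite_dtt: "sigma_finite_measure dtt"
  unfolding dtt_def
  by (subst sigma_finite_measure.sigma_finite_iff_density_finite) (auto intro: sigma_finite_lborel)

lemma AE_dtt_pos: "AE t in dtt. 0 < t"
  unfolding dtt_def by (subst AE_density) (auto simp: indicator_def)

context doubling_space
begin

abbreviation N :: "('a \<times> real) measure" where "N \<equiv> Xplus M"

abbreviation V :: "'a \<times> real \<Rightarrow> real" where "V z \<equiv> Vol M (fst z) (snd z)"

lemma sets_N: "sets N = sets (borel \<Otimes>\<^sub>M borel)"
  unfolding Xplus_def by (rule sets_pair_measure_cong) (simp_all add: sets_M sets_dtt)

lemma sets_N_borel: "sets N = sets borel"
  using sets_N by (metis borel_prod)

declare sets_N [measurable_cong]

lemma space_N [simp]: "space N = UNIV"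
  using sets_eq_imp_space_eq[OF sets_N_borel] by simp

lemma sigma_finite_N: "sigma_finite_measure N"
proof -
  interpret dtt: sigma_finite_measure dtt by (rule sigma_finite_dtt)
  interpret pair_sigma_finite M dtt ..
  show ?thesis unfolding Xplus_def by (rule sigma_finite_measure_axioms)
qed

lemma AE_N_pos: "AE z in N. 0 < snd z"
proof -
  interpret dtt: sigma_finite_measure dtt by (rule sigma_finite_dtt)
  interpret pair_sigma_finite M dtt ..
  show ?thesis unfolding Xplus_def
    by (rule AE_pair_measure) (use AE_dtt_pos in auto)
qed

lemma pair_sigma_finite_M_N: "pair_sigma_finite M N"
  using sigma_finite_N sigma_finite_measure_axioms by (simp add: pair_sigma_finite_def)

text \<open>The volume is the integral of a section of the open condition
  \<open>dist y x < t\<close>, so joint measurability in centre and radius is part of Tonelli's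
  theorem.\<close>

lemma borel_measurable_Vol [measurable (raw)]:
  assumes [measurable]: "f \<in> K \<rightarrow>\<^sub>M borel" "g \<in> K \<rightarrow>\<^sub>M borel"
  shows "(\<lambda>w. Vol M (f w) (g w)) \<in> borel_measurable K"
proof -
  have "Vol M (f w) (g w) = enn2real (\<integral>\<^sup>+x. indicator {x. dist (f w) x < g w} x \<partial>M)" for w
    by (simp add: Vol_def measure_def ball_def[symmetric] sets_M)
  moreover have "(\<lambda>w. enn2real (\<integral>\<^sup>+x. indicator {x. dist (f w) x < g w} x \<partial>M)) \<in> borel_measurable K"
    unfolding indicator_def by measurable
  ultimately show ?thesis by simp
qed

lemma mem_cone: "z \<in> cone x \<longleftrightarrow> 0 < snd z \<and> dist x (fst z) < snd z"
  by (auto simp: cone_def)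

lemma indicator_cone: "indicator (cone x) z = (if 0 < snd z \<and> dist x (fst z) < snd z then 1 else (0::ennreal))"
  by (simp add: indicator_def mem_cone)

section \<open>Basic properties of area integrals\<close>

lemma cone_int_measurable [measurable]:
  assumes [measurable]: "u \<in> borel_measurable N"
  shows "cone_int M u \<in> borel_measurable M"
proof -
  interpret N: sigma_finite_measure N by (rule sigma_finite_N)
  show ?thesis unfolding cone_int_def indicator_cone by measurable
qed

lemma cone_int_mono:
  "(\<And>z. 0 < snd z \<Longrightarrow> dist x (fst z) < snd z \<Longrightarrow> u z \<le> v z) \<Longrightarrow> cone_int M u x \<le> cone_int M v x"
  unfolding cone_int_def indicator_cone
  by (intro nn_integral_mono) (auto intro!: ennreal_leI divide_right_mono)

lemma cone_int_cong:
  "(\<And>z. 0 < snd z \<Longrightarrow> dist x (fst z) < snd z \<Longrightarrow> u z = v z) \<Longrightarrow> cone_int M u x = cone_int M v x"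
  by (intro antisym cone_int_mono) auto

lemma tent_int_mono:
  "0 \<le> \<theta> \<Longrightarrow> (\<And>z. 0 < snd z \<Longrightarrow> u z \<le> v z) \<Longrightarrow> tent_int M \<theta> u \<le> tent_int M \<theta> v"
  unfolding tent_int_def by (intro nn_integral_mono enn_powr_mono cone_int_mono) auto

lemma tent_int_cong:
  "(\<And>z. 0 < snd z \<Longrightarrow> u z = v z) \<Longrightarrow> tent_int M \<theta> u = tent_int M \<theta> v"
  unfolding tent_int_def by (intro nn_integral_cong arg_cong2[where f=enn_powr] cone_int_cong) auto

lemma cone_int_cmult:
  assumes [measurable]: "u \<in> borel_measurable N" and "0 \<le> c"
  shows "cone_int M (\<lambda>z. c * u z) x = ennreal c * cone_int M u x"
  unfolding cone_int_def indicator_cone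
  by (subst nn_integral_cmult[symmetric])
    (auto simp: ennreal_mult'[OF assms(2), symmetric] intro!: nn_integral_cong)

lemma tent_int_cmult:
  assumes [measurable]: "u \<in> borel_measurable N" and "0 \<le> c"
  shows "tent_int M \<theta> (\<lambda>z. c * u z) = ennreal (c powr \<theta>) * tent_int M \<theta> u"
  unfolding tent_int_def
  by (subst nn_integral_cmult[symmetric]) (simp_all add: cone_int_cmult enn_powr_ennreal_mult assms)

text \<open>Tonelli's theorem combined with the symmetry that \<open>z\<close> lies in the cone at
  \<open>x\<close> exactly when \<open>x\<close> lies in the ball of \<open>z\<close>. The weight
  \<open>W\<close> serves the construction of a positive tent function; W = 1 gives the plain
  averaging identity.\<close>

lemma nn_integral_cone_int_weighted:
  assumes [measurable]: "u \<in> borel_measurable N" "W \<in> borel_measurable M"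
  shows "(\<integral>\<^sup>+x. cone_int M u x * W x \<partial>M)
    = (\<integral>\<^sup>+z. ennreal (u z / V z) * (\<integral>\<^sup>+x. indicator (ball (fst z) (snd z)) x * W x \<partial>M) \<partial>N)"
proof -
  interpret N: sigma_finite_measure N by (rule sigma_finite_N)
  interpret P: pair_sigma_finite M N by (rule pair_sigma_finite_M_N)
  have "(\<integral>\<^sup>+x. cone_int M u x * W x \<partial>M)
      = (\<integral>\<^sup>+x. (\<integral>\<^sup>+z. indicator (cone x) z * ennreal (u z / V z) * W x \<partial>N) \<partial>M)"
    unfolding cone_int_def indicator_cone by (subst nn_integral_multc) auto
  also have "\<dots> = (\<integral>\<^sup>+z. (\<integral>\<^sup>+x. indicator (cone x) z * ennreal (u z / V z) * W x \<partial>M) \<partial>N)"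
    unfolding indicator_cone by (rule P.Fubini'[symmetric]) measurable
  also have "\<dots> = (\<integral>\<^sup>+z. ennreal (u z / V z) * (\<integral>\<^sup>+x. indicator (ball (fst z) (snd z)) x * W x \<partial>M) \<partial>N)"
  proof (rule nn_integral_cong_AE)
    show "AE z in N. (\<integral>\<^sup>+x. indicator (cone x) z * ennreal (u z / V z) * W x \<partial>M)
      = ennreal (u z / V z) * (\<integral>\<^sup>+x. indicator (ball (fst z) (snd z)) x * W x \<partial>M)"
      using AE_N_pos
    proof eventually_elim
      case (elim z)
      have "ball (fst z) (snd z) \<in> sets M" by (simp add: sets_M)
      then have [measurable]: "indicator (ball (fst z) (snd z)) \<in> borel_measurable M" by measurable
      show ?case
        using elim by (subst nn_integral_cmult[symmetric])
          (auto intro!: nn_integral_cong simp: mem_cone dist_commute indicator_def)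
    qed
  qed
  finally show ?thesis .
qed

lemma nn_integral_cone_int:
  assumes [measurable]: "u \<in> borel_measurable N"
  shows "(\<integral>\<^sup>+x. cone_int M u x \<partial>M) = (\<integral>\<^sup>+z. ennreal (u z) \<partial>N)"
proof -
  have "(\<integral>\<^sup>+x. cone_int M u x \<partial>M)
      = (\<integral>\<^sup>+z. ennreal (u z / V z) * (\<integral>\<^sup>+x. indicator (ball (fst z) (snd z)) x * 1 \<partial>M) \<partial>N)"
    using nn_integral_cone_int_weighted[of u "\<lambda>_. 1"] by simp
  also have "\<dots> = (\<integral>\<^sup>+z. ennreal (u z) \<partial>N)"
  proof (rule nn_integral_cong_AE)
    show "AE z in N. ennreal (u z / V z) * (\<integral>\<^sup>+x. indicator (ball (fst z) (snd z)) x * 1 \<partial>M) = ennreal (u z)"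
      using AE_N_pos
    proof eventually_elim
      case (elim z)
      have "(\<integral>\<^sup>+x. indicator (ball (fst z) (snd z)) x * 1 \<partial>M) = ennreal (V z)"
        by (simp add: sets_M emeasure_ball)
      then show ?case using Vol_pos[OF elim, of "fst z"]
        by (simp add: ennreal_mult''[symmetric])
    qed
  qed
  finally show ?thesis .
qed

text \<open>For positive height, lying outside the tent means that the ball of \<open>z\<close>
  contains some point outside \<open>B\<close>. This is an open condition on \<open>z\<close> for
  every set \<open>B\<close>, measurable or not.\<close>

lemma tent_measurable [measurable]: "tent B \<in> sets N"
proof -
  have "open (\<Union>w\<in>-B. {z::'a \<times> real. dist (fst z) w < snd z})"
    by (intro open_UN ballI open_Collect_less continuous_intros)
  then have "- (\<Union>w\<in>-B. {z::'a \<times> real. dist (fst z) w < snd z}) \<in> sets N"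
    unfolding sets_N_borel by (intro borel_comp borel_open)
  moreover have "{z::'a \<times> real. 0 < snd z} \<in> sets N"
    unfolding sets_N_borel by (intro borel_open open_Collect_less continuous_intros)
  moreover have "tent B = {z. 0 < snd z} \<inter> - (\<Union>w\<in>-B. {z::'a \<times> real. dist (fst z) w < snd z})"
    by (fastforce simp: tent_def)
  ultimately show ?thesis by auto
qed

text \<open>If \<open>u\<close> lives in the tent over a ball, its area integral vanishes off that
  ball, because the ball of each point of the tent stays inside. Hoelder's inequality against the
  indicator of the ball, with exponents 1/\<theta> and 1/(1-\<theta>), then compares with the total
  mass. This is the size estimate behind tent space atoms.\<close>

lemma tent_int_localized:
  assumes [measurable]: "u \<in> borel_measurable N"
    and \<theta>: "0 < \<theta>" "\<theta> < 1" and u: "\<And>z. z \<notin> tent (ball x\<^sub>0 \<rho>) \<Longrightarrow> u z = 0"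
    and J: "(\<integral>\<^sup>+z. ennreal (u z) \<partial>N) = ennreal J" "0 \<le> J"
  shows "tent_int M \<theta> u \<le> ennreal (Vol M x\<^sub>0 \<rho> powr (1 - \<theta>) * J powr \<theta>)"
proof -
  let ?B = "ball x\<^sub>0 \<rho>"
  have [measurable]: "?B \<in> sets M" by (simp add: sets_M)
  have out: "cone_int M u x = 0" if "x \<notin> ?B" for x
  proof -
    have "u z = 0" if "0 < snd z" "dist x (fst z) < snd z" for z
    proof (rule u)
      show "z \<notin> tent ?B"
        using \<open>x \<notin> ?B\<close> that by (auto simp: tent_def dist_commute subset_iff)
    qed
    then have "cone_int M u x = cone_int M (\<lambda>_. 0) x" by (intro cone_int_cong) auto
    then show ?thesis by (simp add: cone_int_def)
  qed
  define c where "c x = enn2real (cone_int M u x)" for x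
  have [measurable]: "c \<in> borel_measurable M" unfolding c_def by measurable
  have tot: "(\<integral>\<^sup>+x. cone_int M u x \<partial>M) = ennreal J" by (simp add: nn_integral_cone_int J)
  then have "AE x in M. cone_int M u x \<noteq> \<infinity>" by (intro nn_integral_PInf_AE) auto
  then have c: "AE x in M. cone_int M u x = ennreal (c x)"
    by eventually_elim (auto simp: c_def less_top)
  have "tent_int M \<theta> u = (\<integral>\<^sup>+x. ennreal (1 * (c x powr \<theta> * indicator ?B x)) \<partial>M)"
    unfolding tent_int_def
  proof (rule nn_integral_cong_AE)
    show "AE x in M. enn_powr (cone_int M u x) \<theta> = ennreal (1 * (c x powr \<theta> * indicator ?B x))"
      using c
    proof eventually_elim
      case (elim x)
      have "enn_powr (cone_int M u x) \<theta> = ennreal (c x powr \<theta>)"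
        by (subst elim) (simp add: enn_powr_ennreal c_def)
      then show ?case using out[of x] by (cases "x \<in> ?B") auto
    qed
  qed
  also have "\<dots> \<le> ennreal (J powr \<theta> * Vol M x\<^sub>0 \<rho> powr (1 - \<theta>))"
  proof (rule nn_integral_Holder_le[where q="1/\<theta>" and r="1/(1-\<theta>)"])
    have "(\<integral>\<^sup>+x. ennreal (1 * (c x powr \<theta>) powr (1/\<theta>)) \<partial>M) = (\<integral>\<^sup>+x. cone_int M u x \<partial>M)"
      by (rule nn_integral_cong_AE) (use c \<theta> in \<open>auto elim!: eventually_mono simp: powr_powr c_def\<close>)
    then show "(\<integral>\<^sup>+x. ennreal (1 * (c x powr \<theta>) powr (1/\<theta>)) \<partial>M) \<le> ennreal ((J powr \<theta>) powr (1/\<theta>))"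
      using tot \<theta> J by (simp add: powr_powr)
    have "(\<integral>\<^sup>+x. ennreal (1 * indicator ?B x powr (1/(1-\<theta>))) \<partial>M) = (\<integral>\<^sup>+x. indicator ?B x \<partial>M)"
      by (intro nn_integral_cong) (auto simp: indicator_def)
    then show "(\<integral>\<^sup>+x. ennreal (1 * indicator ?B x powr (1/(1-\<theta>))) \<partial>M) \<le> ennreal ((Vol M x\<^sub>0 \<rho> powr (1-\<theta>)) powr (1/(1-\<theta>)))"
      using \<theta> by (simp add: powr_powr emeasure_ball)
  qed (use \<theta> in auto)
  finally show ?thesis by (simp add: mult.commute)
qed

text \<open>Two nested dominated convergences: in the cone at almost every \<open>x\<close>, where
  the majorant has a finite area integral, and then in \<open>x\<close>. The triangle inequality,
  which fails for p < 1, does not enter.\<close>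

lemma tent_int_tendsto_0:
  fixes u :: "nat \<Rightarrow> 'a \<times> real \<Rightarrow> real"
  assumes [measurable]: "\<And>n. u n \<in> borel_measurable N" "w \<in> borel_measurable N"
    and \<theta>: "0 < \<theta>"
    and le: "\<And>n z. u n z \<le> w z"
    and fin: "tent_int M \<theta> w < \<infinity>"
    and lim: "\<And>z. (\<lambda>n. u n z) \<longlonglongrightarrow> 0"
  shows "(\<lambda>n. tent_int M \<theta> (u n)) \<longlonglongrightarrow> 0"
proof -
  have "AE x in M. enn_powr (cone_int M w x) \<theta> \<noteq> \<infinity>"
    using fin by (intro nn_integral_PInf_AE) (auto simp: tent_int_def)
  then have lim0: "AE x in M. (\<lambda>n. enn_powr (cone_int M (u n) x) \<theta>) \<longlonglongrightarrow> 0"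
  proof eventually_elim
    case (elim x)
    have "(\<lambda>n. cone_int M (u n) x) \<longlonglongrightarrow> (\<integral>\<^sup>+z. 0 \<partial>N)"
      unfolding cone_int_def
    proof (rule nn_integral_dominated_convergence[where w="\<lambda>z. indicator (cone x) z * ennreal (w z / V z)"])
      show "(\<integral>\<^sup>+z. indicator (cone x) z * ennreal (w z / V z) \<partial>N) < \<infinity>"
        using elim by (simp add: cone_int_def less_top)
      show "AE z in N. (\<lambda>n. indicator (cone x) z * ennreal (u n z / V z)) \<longlonglongrightarrow> 0"
      proof (intro AE_I2)
        fix z
        have "(\<lambda>n. ennreal (u n z / V z)) \<longlonglongrightarrow> ennreal 0"
          by (intro tendsto_ennrealI tendsto_divide_zero lim)
        then show "(\<lambda>n. indicator (cone x) z * ennreal (u n z / V z)) \<longlonglongrightarrow> 0"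
          by (cases "z \<in> cone x") auto
      qed
    qed (auto simp: indicator_cone intro!: ennreal_leI divide_right_mono le)
    then show ?case using \<theta> by (intro enn_powr_tendsto_0) auto
  qed
  have "(\<lambda>n. tent_int M \<theta> (u n)) \<longlonglongrightarrow> (\<integral>\<^sup>+x. 0 \<partial>M)"
    unfolding tent_int_def
  proof (rule nn_integral_dominated_convergence[where w="\<lambda>x. enn_powr (cone_int M w x) \<theta>"])
    show "AE x in M. enn_powr (cone_int M (u n) x) \<theta> \<le> enn_powr (cone_int M w x) \<theta>" for n
      using \<theta> by (intro AE_I2 enn_powr_mono cone_int_mono le) auto
  qed (use fin lim0 in \<open>auto simp: tent_int_def\<close>)
  then show ?thesis by simp
qed

section \<open>A strictly positive function in the tent space\<close>

text \<open>The denominator of \<gamma> cancels the volume of the ball of radius n + 1, which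
  contains the points at distance between n and n + 1. What remains is the geometric series of 2 to
  the power -n.\<close>

lemma nn_integral_ring_weight_finite:
  fixes x\<^sub>0 :: 'a
  defines "\<gamma> \<equiv> \<lambda>r::real. 2 powr (- r) / (1 + Vol M x\<^sub>0 (r + 1))"
  shows "(\<integral>\<^sup>+x. ennreal (\<gamma> (dist x\<^sub>0 x)) \<partial>M) < \<infinity>"
proof -
  have anti: "\<gamma> s \<le> \<gamma> r" if "r \<le> s" for r s
  proof -
    have "Vol M x\<^sub>0 (r + 1) \<le> Vol M x\<^sub>0 (s + 1)" using that by (intro Vol_mono) auto
    then show ?thesis unfolding \<gamma>_def using that
      by (intro frac_le) (auto simp: add_pos_nonneg)
  qed
  let ?R = "\<lambda>n::nat. ball x\<^sub>0 (real n + 1)"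
  have [measurable]: "?R n \<in> sets M" for n by (simp add: sets_M)
  have "(\<integral>\<^sup>+x. ennreal (\<gamma> (dist x\<^sub>0 x)) \<partial>M) \<le> (\<integral>\<^sup>+x. (\<Sum>n. ennreal (\<gamma> (real n)) * indicator (?R n) x) \<partial>M)"
  proof (rule nn_integral_mono)
    fix x
    define n where "n = nat \<lfloor>dist x\<^sub>0 x\<rfloor>"
    have n: "real n \<le> dist x\<^sub>0 x" "dist x\<^sub>0 x < real n + 1"
      unfolding n_def by (auto simp: of_nat_nat)
    have "ennreal (\<gamma> (dist x\<^sub>0 x)) \<le> ennreal (\<gamma> (real n)) * indicator (?R n) x"
      using n anti by (auto intro: ennreal_leI)
    also have "\<dots> \<le> (\<Sum>n. ennreal (\<gamma> (real n)) * indicator (?R n) x)"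
    proof -
      have "f n \<le> suminf f" for f :: "nat \<Rightarrow> ennreal"
        using sum_le_suminf[of f "{n}"] by simp
      then show ?thesis .
    qed
    finally show "ennreal (\<gamma> (dist x\<^sub>0 x)) \<le> \<dots>" .
  qed
  also have "\<dots> = (\<Sum>n. ennreal (\<gamma> (real n)) * ennreal (Vol M x\<^sub>0 (real n + 1)))"
    by (subst nn_integral_suminf) (auto simp: nn_integral_cmult emeasure_ball)
  also have "\<dots> \<le> (\<Sum>n. ennreal ((1/2) ^ n))"
  proof (rule suminf_le)
    fix n :: nat
    let ?v = "Vol M x\<^sub>0 (real n + 1)"
    have "\<gamma> (real n) * ?v = (1/2)^n * (?v / (1 + ?v))"
      by (simp add: \<gamma>_def powr_minus powr_realpow power_divide field_simps)
    also have "\<dots> \<le> (1/2)^n * 1"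
      by (intro mult_left_mono) (auto simp: divide_le_eq_1_pos add_pos_nonneg)
    finally show "ennreal (\<gamma> (real n)) * ennreal ?v \<le> ennreal ((1/2) ^ n)"
      by (simp add: ennreal_mult''[symmetric] ennreal_leI)
  qed auto
  also have "\<dots> = ennreal (\<Sum>n. (1/2)^n)"
    by (intro suminf_ennreal2) (auto simp: summable_geometric)
  also have "\<dots> < \<infinity>" by simp
  finally show ?thesis .
qed

text \<open>A power \<theta> < 1 of the area integral cannot be exchanged with integration in
  \<open>x\<close> directly. It is replaced by a linear expression with weight \<open>W\<close>,
  plus an integrable error \<gamma>; by Tonelli's theorem it then suffices that \<open>w\<close>
  decays fast enough against \<open>W\<close>.\<close>

lemma positive_tent_function:
  assumes \<theta>: "0 < \<theta>" "\<theta> < 1"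
  obtains w :: "'a \<times> real \<Rightarrow> real"
  where "w \<in> borel_measurable N" "\<And>z. 0 < w z" "tent_int M \<theta> w < \<infinity>"
proof -
  interpret N: sigma_finite_measure N by (rule sigma_finite_N)
  fix x\<^sub>0 :: 'a
  define \<gamma> where "\<gamma> r = 2 powr (- r) / (1 + Vol M x\<^sub>0 (r + 1))" for r :: real
  have \<gamma>_pos: "0 < \<gamma> r" for r by (simp add: \<gamma>_def add_pos_nonneg)
  have \<gamma>_anti: "\<gamma> s \<le> \<gamma> r" if "r \<le> s" for r s
  proof -
    have "Vol M x\<^sub>0 (r + 1) \<le> Vol M x\<^sub>0 (s + 1)" using that by (intro Vol_mono) auto
    then show ?thesis unfolding \<gamma>_def using that
      by (intro frac_le) (auto simp: add_pos_nonneg)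
  qed
  have [measurable]: "\<gamma> \<in> borel_measurable borel" unfolding \<gamma>_def by measurable
  \<comment> \<open>The exponent satisfies -e * \<theta> = \<theta> - 1. Hence, if
    \<open>b powr \<theta>\<close> exceeds \<open>\<gamma> r\<close>, then
    \<open>b powr (\<theta> - 1)\<close> is at most \<open>W r\<close>.\<close>
  define e where "e = (1 - \<theta>) / \<theta>"
  have e: "0 < e" using \<theta> by (simp add: e_def)
  define W where "W r = \<gamma> r powr (- e)" for r
  have [measurable]: "W \<in> borel_measurable borel" unfolding W_def by measurable
  have W_mono: "W r \<le> W s" if "r \<le> s" for r s
    unfolding W_def using \<gamma>_anti[OF that] \<gamma>_pos e by (intro powr_mono2') auto
  have W_pos: "0 < W r" for r by (simp add: W_def \<gamma>_pos less_imp_neq[symmetric])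
  obtain h where h: "h \<in> borel_measurable N" "integral\<^sup>N N h \<noteq> \<infinity>" "\<And>z. 0 < h z" "\<And>z. h z < \<infinity>"
    using N.Ex_finite_integrable_function by auto
  note h(1)[measurable]
  \<comment> \<open>\<open>W\<close> increases with the distance, so its values on the ball of
    \<open>z\<close> stay below its value at \<open>dist x\<^sub>0 (fst z) + snd z\<close>. Dividing
    by this value leaves at most \<open>h\<close> after averaging over the ball.\<close>
  define w where "w z = enn2real (h z) / W (dist x\<^sub>0 (fst z) + snd z)" for z
  have [measurable]: "w \<in> borel_measurable N" unfolding w_def by measurable
  have w_pos: "0 < w z" for z
    using h(3,4)[of z] W_pos by (simp add: w_def enn2real_positive_iff)
  \<comment> \<open>Linearises the power, so that Fubini's theorem applies to the weighted area integral.\<close>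
  have young: "enn_powr a \<theta> \<le> a * ennreal (W r) + ennreal (\<gamma> r)" for a r
  proof (cases a)
    case (real b)
    have "b powr \<theta> \<le> b * W r + \<gamma> r"
    proof (cases "b powr \<theta> \<le> \<gamma> r")
      case True
      then show ?thesis using W_pos[of r] real by (simp add: add_increasing)
    next
      case False
      then have b: "0 < b" using real \<gamma>_pos[of r] by (cases "b = 0") auto
      have "(b powr \<theta>) powr (- e) \<le> W r"
        unfolding W_def using False \<gamma>_pos[of r] e by (intro powr_mono2') auto
      then have "b * b powr (\<theta> - 1) \<le> b * W r"
        using b \<theta> by (simp add: powr_powr e_def)
      moreover have "b * b powr (\<theta> - 1) = b powr \<theta>"
        using b by (simp add: powr_mult_base)
      ultimately show ?thesis using \<gamma>_pos[of r] by simp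
    qed
    then show ?thesis using real W_pos[of r] \<gamma>_pos[of r]
      by (simp add: enn_powr_ennreal ennreal_mult[symmetric] ennreal_plus[symmetric] ennreal_leI less_imp_le del: ennreal_plus)
  next
    case top
    then show ?thesis using W_pos[of r] by (simp add: ennreal_top_mult)
  qed
  have "tent_int M \<theta> w \<le> (\<integral>\<^sup>+x. cone_int M w x * ennreal (W (dist x\<^sub>0 x)) + ennreal (\<gamma> (dist x\<^sub>0 x)) \<partial>M)"
    unfolding tent_int_def by (intro nn_integral_mono young)
  also have "\<dots> = (\<integral>\<^sup>+x. cone_int M w x * ennreal (W (dist x\<^sub>0 x)) \<partial>M) + (\<integral>\<^sup>+x. ennreal (\<gamma> (dist x\<^sub>0 x)) \<partial>M)"
    by (rule nn_integral_add) measurable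
  also have "\<dots> < \<infinity>"
  proof -
    have "(\<integral>\<^sup>+x. cone_int M w x * ennreal (W (dist x\<^sub>0 x)) \<partial>M)
      = (\<integral>\<^sup>+z. ennreal (w z / V z) * (\<integral>\<^sup>+x. indicator (ball (fst z) (snd z)) x * ennreal (W (dist x\<^sub>0 x)) \<partial>M) \<partial>N)"
      by (rule nn_integral_cone_int_weighted) measurable
    also have "\<dots> \<le> (\<integral>\<^sup>+z. h z \<partial>N)"
    proof (rule nn_integral_mono_AE)
      show "AE z in N. ennreal (w z / V z) * (\<integral>\<^sup>+x. indicator (ball (fst z) (snd z)) x * ennreal (W (dist x\<^sub>0 x)) \<partial>M) \<le> h z"
        using AE_N_pos
      proof eventually_elim
        case (elim z)
        let ?W = "W (dist x\<^sub>0 (fst z) + snd z)"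
        have [measurable]: "ball (fst z) (snd z) \<in> sets M" by (simp add: sets_M)
        have "(\<integral>\<^sup>+x. indicator (ball (fst z) (snd z)) x * ennreal (W (dist x\<^sub>0 x)) \<partial>M)
          \<le> (\<integral>\<^sup>+x. ennreal ?W * indicator (ball (fst z) (snd z)) x \<partial>M)"
        proof (rule nn_integral_mono)
          fix x
          show "indicator (ball (fst z) (snd z)) x * ennreal (W (dist x\<^sub>0 x)) \<le> ennreal ?W * indicator (ball (fst z) (snd z)) x"
            using dist_triangle[of x\<^sub>0 x "fst z"]
            by (auto simp: indicator_def intro!: ennreal_leI W_mono)
        qed
        also have "\<dots> = ennreal (?W * V z)"
          using W_pos by (simp add: nn_integral_cmult emeasure_ball ennreal_mult' less_imp_le)
        finally have "ennreal (w z / V z) * (\<integral>\<^sup>+x. indicator (ball (fst z) (snd z)) x * ennreal (W (dist x\<^sub>0 x)) \<partial>M)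
          \<le> ennreal (w z / V z) * ennreal (?W * V z)"
          by (intro mult_left_mono) auto
        also have "\<dots> = ennreal (w z / V z * (?W * V z))"
          using w_pos[of z] by (intro ennreal_mult'[symmetric]) (simp add: less_imp_le)
        also have "w z / V z * (?W * V z) = enn2real (h z)"
          using Vol_pos[OF elim, of "fst z"] W_pos[of "dist x\<^sub>0 (fst z) + snd z"] by (simp add: w_def)
        also have "ennreal (enn2real (h z)) = h z" using h(4)[of z] by simp
        finally show ?case .
      qed
    qed
    finally show ?thesis
      using h(2) nn_integral_ring_weight_finite[of x\<^sub>0, folded \<gamma>_def]
      by (auto simp: less_top[symmetric] top_unique)
  qed
  finally show ?thesis by (intro that[of w]) (auto simp: w_pos)
qed

end

section \<open>Boundedness of the pairing\<close>

definition half_cone :: "'a::metric_space \<Rightarrow> ('a \<times> real) set" where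
  "half_cone x = {z. 0 < snd z \<and> dist x (fst z) < snd z / 2}"

text \<open>The half-open intervals tile the positive axis outward from \<open>v\<close>; the shift
  j + 1 makes the topmost lower interval end at \<open>v\<close>. The two families stay separate
  because their contributions are bounded in different ways.\<close>

lemma dyadic_cover:
  fixes y v :: real
  assumes "0 < y" "0 < v"
  shows "(\<exists>j. v / 2 ^ (j + 1) < y \<and> y \<le> 2 * (v / 2 ^ (j + 1))) \<or> (\<exists>j. v * 2 ^ j < y \<and> y \<le> 2 * (v * 2 ^ j))"
proof (cases "y \<le> v")
  case True
  obtain n where "(1/2) ^ n < y / v"
    using real_arch_pow_inv[of "y / v" "1/2"] assms by auto
  then have ex: "\<exists>n. v / 2 ^ n < y" using assms by (auto simp: field_simps power_divide intro!: exI[of _ n])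
  define n where "n = (LEAST n. v / 2 ^ n < y)"
  have n: "v / 2 ^ n < y" unfolding n_def by (rule LeastI_ex[OF ex])
  then obtain j where j: "n = Suc j" using True by (cases n) auto
  then have "\<not> v / 2 ^ j < y" using not_less_Least[of j "\<lambda>n. v / 2 ^ n < y"] by (simp add: n_def)
  then show ?thesis using n j by (intro disjI1 exI[of _ j]) (auto simp: field_simps)
next
  case False
  obtain n where "y / v < 2 ^ n" using real_arch_pow[of 2 "y / v"] by auto
  then have ex: "\<exists>n. y \<le> v * 2 ^ n" using assms by (auto simp: field_simps intro!: exI[of _ n] less_imp_le)
  define n where "n = (LEAST n. y \<le> v * 2 ^ n)"
  have n: "y \<le> v * 2 ^ n" unfolding n_def by (rule LeastI_ex[OF ex])
  then obtain j where j: "n = Suc j" using False by (cases n) auto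
  then have "\<not> y \<le> v * 2 ^ j" using not_less_Least[of j "\<lambda>n. y \<le> v * 2 ^ n"] by (simp add: n_def)
  then show ?thesis using n j by (intro disjI2 exI[of _ j]) (auto simp: field_simps)
qed

lemma le_suminf_ennreal: "f n \<le> (\<Sum>n. f n)" for f :: "nat \<Rightarrow> ennreal"
  using sum_le_suminf[of f "{n}"] by simp

context doubling_space
begin

lemma mem_half_cone: "z \<in> half_cone x \<longleftrightarrow> 0 < snd z \<and> dist x (fst z) < snd z / 2"
  by (simp add: half_cone_def)

lemma indicator_half_cone:
  "indicator (half_cone x) z = (if 0 < snd z \<and> dist x (fst z) < snd z / 2 then 1 else (0::ennreal))"
  by (simp add: indicator_def half_cone_def)

lemma Vol_half: "0 < t \<Longrightarrow> Vol M x t \<le> D * Vol M x (t / 2)"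
  using Vol_double[of "t/2" x] by simp

lemma Vol_pos_imp: "0 < Vol M x t \<Longrightarrow> 0 < t"
  by (rule ccontr) (simp add: Vol_def ball_empty)

text \<open>The part of the half cone at \<open>x\<close> above height \<open>t\<close> lies in the full cone at every point of
  \<open>ball x (t / 2)\<close>, so it is controlled by the average of the area function over that ball; no
  change of aperture is needed.\<close>

lemma half_cone_upper_bound:
  assumes [measurable]: "u \<in> borel_measurable N"
    and \<theta>: "0 < \<theta>" and L: "tent_int M \<theta> u \<le> ennreal L" "0 \<le> L" and v: "0 < v"
  shows "(\<integral>\<^sup>+z. indicator (half_cone x) z * (indicator {z. v < Vol M x (snd z)} z * ennreal (u z / V z)) \<partial>N)
    \<le> ennreal ((D * L / v) powr (1 / \<theta>))"
\<comment> \<open>The heights of volume above \<open>v\<close> need not have a least element, so the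
  region is exhausted from above. The minus sign turns this into an exhaustion by sublevel
  sets.\<close>
proof (rule nn_integral_truncation_le[where \<tau>="\<lambda>z. - snd z" and S="{s. 0 < - s \<and> v < Vol M x (- s)}"])
  show "(\<lambda>z. indicator (half_cone x) z * (indicator {z. v < Vol M x (snd z)} z * ennreal (u z / V z))) \<in> borel_measurable N"
    unfolding indicator_half_cone unfolding indicator_def by measurable
  show "(\<lambda>z. - snd z) \<in> borel_measurable N" by measurable
  show "- snd z \<in> {s. 0 < - s \<and> v < Vol M x (- s)}"
    if "indicator (half_cone x) z * (indicator {z. v < Vol M x (snd z)} z * ennreal (u z / V z)) \<noteq> 0" for z
    using that by (auto simp: mem_half_cone indicator_def split: if_splits)
  fix s assume "s \<in> {s. 0 < - s \<and> v < Vol M x (- s)}"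
  then obtain t where t: "s = - t" "0 < t" "v < Vol M x t" by (metis (mono_tags) mem_Collect_eq minus_minus)
  define b where "b = (\<integral>\<^sup>+z. indicator {z. - snd z \<le> s} z * (indicator (half_cone x) z * (indicator {z. v < Vol M x (snd z)} z * ennreal (u z / V z))) \<partial>N)"
  have b_le: "b \<le> cone_int M u x'" if "x' \<in> ball x (t / 2)" for x'
    unfolding b_def cone_int_def
  proof (rule nn_integral_mono)
    fix z
    have "dist x' (fst z) < snd z" if "t \<le> snd z" "dist x (fst z) < snd z / 2"
      using that \<open>x' \<in> ball x (t / 2)\<close> dist_triangle[of x' "fst z" x] by (simp add: dist_commute)
    then show "indicator {z. - snd z \<le> s} z * (indicator (half_cone x) z * (indicator {z. v < Vol M x (snd z)} z * ennreal (u z / V z)))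
      \<le> indicator (cone x') z * ennreal (u z / V z)"
      using t by (auto simp: mem_half_cone mem_cone indicator_def)
  qed
  have [measurable]: "ball x (t / 2) \<in> sets M" by (simp add: sets_M)
  \<comment> \<open>The bound is averaged over the ball of radius t/2, while the slice controls the
    volume at radius t; this is the source of the factor \<open>D\<close>.\<close>
  have "ennreal (v / D) \<le> ennreal (Vol M x (t / 2))"
    using Vol_half[OF t(2), of x] t(3) D_ge_1 by (intro ennreal_leI) (simp add: field_simps)
  then have "ennreal (v / D) * enn_powr b \<theta> \<le> ennreal (Vol M x (t / 2)) * enn_powr b \<theta>"
    by (rule mult_right_mono) simp
  also have "\<dots> = (\<integral>\<^sup>+x'. enn_powr b \<theta> * indicator (ball x (t / 2)) x' \<partial>M)"
    by (simp add: nn_integral_cmult emeasure_ball mult.commute)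
  also have "\<dots> \<le> tent_int M \<theta> u"
    unfolding tent_int_def using b_le \<theta>
    by (intro nn_integral_mono) (auto simp: indicator_def intro!: enn_powr_mono)
  also have "\<dots> \<le> ennreal L" by fact
  finally have "ennreal (D / v) * (ennreal (v / D) * enn_powr b \<theta>) \<le> ennreal (D / v) * ennreal L"
    by (rule mult_left_mono) simp
  then have "enn_powr b \<theta> \<le> ennreal (D * L / v)"
    using v D_ge_1 L by (simp add: mult.assoc[symmetric] ennreal_mult'[symmetric])
  then have "enn_powr (enn_powr b \<theta>) (1 / \<theta>) \<le> enn_powr (ennreal (D * L / v)) (1 / \<theta>)"
    using \<theta> by (intro enn_powr_mono) auto
  then show "b \<le> ennreal ((D * L / v) powr (1 / \<theta>))"
    using \<theta> v D_ge_1 L by (simp add: enn_powr_enn_powr enn_powr_ennreal)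
qed

text \<open>The first term sums the series over the volumes below the balance point, with ratio 2 to
  the power -(1/p - 1). The second sums the series of ratio 1/2 above it, where the averaging bound
  brings the power of \<open>D\<close>.\<close>

definition pairing_const :: "real \<Rightarrow> real" where
  "pairing_const p = 2 powr (- (1/p - 1)) / (1 - 2 powr (- (1/p - 1))) + 2 * D powr (1 / p)"

lemma pairing_const_pos: "0 < p \<Longrightarrow> p < 1 \<Longrightarrow> 0 < pairing_const p"
  unfolding pairing_const_def using D_ge_1
  by (intro add_pos_pos divide_pos_pos) (auto simp: powr_less_one field_simps)

text \<open>These assumptions isolate what the summation over slices needs to know about
  \<open>G\<close>: the Hoelder bound \<open>piece\<close> on each slice, restricted to a set
  \<open>Gd\<close> of good pairs (x,t). The cases q > 1 and q = 1 supply this bound by different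
  means.\<close>

context
  fixes F G :: "'a \<times> real \<Rightarrow> real" and p q L B :: real and Gd :: "('a \<times> real) set"
  assumes F [measurable]: "F \<in> borel_measurable N" and G [measurable]: "G \<in> borel_measurable N"
    and F_nn: "\<And>z. 0 \<le> F z" and G_nn: "\<And>z. 0 \<le> G z"
    and p: "0 < p" "p < 1" and q: "1 \<le> q" and B: "0 \<le> B"
    and L: "tent_int M (p/q) (\<lambda>z. F z powr q) = ennreal L" "0 \<le> L"
    and Gd [measurable]: "Gd \<in> sets (M \<Otimes>\<^sub>M borel)"
    and piece: "\<And>x v A. 0 < v \<Longrightarrow> 0 \<le> A \<Longrightarrow>
       (\<integral>\<^sup>+z. indicator (half_cone x) z * (indicator {z. v < Vol M x (snd z) \<and> Vol M x (snd z) \<le> 2 * v} z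
            * ennreal (F z powr q / V z)) \<partial>N) \<le> ennreal (A powr q) \<Longrightarrow>
       (\<integral>\<^sup>+z. indicator (half_cone x) z * (indicator {z. v < Vol M x (snd z) \<and> Vol M x (snd z) \<le> 2 * v} z
            * (indicator Gd (x, snd z) * ennreal (F z * G z / V z))) \<partial>N) \<le> ennreal (B * v powr (1/p - 1) * A)"
begin

text \<open>Below the balance volume the area function at \<open>x\<close> itself is used, so a
  slice of volume v' contributes a multiple of v' to the power 1/p - 1, increasing in v'. Above it
  the averaged bound adds the power -1/p, and the total exponent -1 makes the contributions
  decrease. Both series are thus geometric and comparable to their value at the balance
  point.\<close>

lemma half_cone_pairing_pointwise:
  assumes a: "cone_int M (\<lambda>z. F z powr q) x = ennreal a" "0 < a" and Lpos: "0 < L"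
  shows "(\<integral>\<^sup>+z. indicator (half_cone x) z * (indicator Gd (x, snd z) * ennreal (F z * G z / V z)) \<partial>N)
    \<le> ennreal (pairing_const p * B * L powr (1/p - 1) * a powr (p/q))"
proof -
  define \<alpha> where "\<alpha> = 1/p - 1"
  have \<alpha>: "0 < \<alpha>" using p by (simp add: \<alpha>_def)
  define A where "A = a powr (1/q)"
  have A: "0 < A" "A powr q = a" "A powr p = a powr (p/q)" using a q by (auto simp: A_def powr_powr)
  \<comment> \<open>The volume at which the two bounds \<open>A\<close> and \<open>(D * L / v) powr (1/p)\<close> balance.\<close>
  define v where "v = L / A powr p"
  have v: "0 < v" using Lpos A(1) by (simp add: v_def)
  define P where "P v = {z::'a \<times> real. v < Vol M x (snd z) \<and> Vol M x (snd z) \<le> 2 * v}" for v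
  have [measurable]: "P v \<in> sets N" for v
  proof -
    have "{z\<in>space N. v < Vol M x (snd z) \<and> Vol M x (snd z) \<le> 2 * v} \<in> sets N" by measurable
    then show ?thesis by (simp add: P_def)
  qed
  define h where "h z = indicator (half_cone x) z * (indicator Gd (x, snd z) * ennreal (F z * G z / V z))" for z
  have [measurable]: "h \<in> borel_measurable N"
    unfolding h_def indicator_half_cone by measurable
  have piece': "(\<integral>\<^sup>+z. indicator (P v') z * h z \<partial>N) \<le> ennreal (B * v' powr \<alpha> * A')"
    if "0 < v'" "0 \<le> A'" "(\<integral>\<^sup>+z. indicator (half_cone x) z * (indicator (P v') z * ennreal (F z powr q / V z)) \<partial>N) \<le> ennreal (A' powr q)" for v' A'
    using piece[OF that[unfolded P_def]] by (simp add: h_def \<alpha>_def P_def mult.left_commute)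
  have lo: "(\<integral>\<^sup>+z. indicator (P (v / 2 ^ (j+1))) z * h z \<partial>N)
      \<le> ennreal (B * L powr \<alpha> * A powr p * ((2 powr - \<alpha>) * (2 powr - \<alpha>) ^ j))" for j
  proof -
    have "(\<integral>\<^sup>+z. indicator (half_cone x) z * (indicator (P (v / 2 ^ (j+1))) z * ennreal (F z powr q / V z)) \<partial>N)
      \<le> cone_int M (\<lambda>z. F z powr q) x"
      unfolding cone_int_def
      by (intro nn_integral_mono) (auto simp: mem_half_cone mem_cone indicator_def)
    then have "(\<integral>\<^sup>+z. indicator (P (v / 2 ^ (j+1))) z * h z \<partial>N) \<le> ennreal (B * (v / 2 ^ (j+1)) powr \<alpha> * A)"
      using v A a by (intro piece') auto
    also have "B * (v / 2 ^ (j+1)) powr \<alpha> * A = B * L powr \<alpha> * A powr p * ((2 powr - \<alpha>) * (2 powr - \<alpha>) ^ j)"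
    proof -
      have "(v / 2 ^ (j+1)) powr \<alpha> = v powr \<alpha> * ((2 powr - \<alpha>) * (2 powr - \<alpha>) ^ j)"
        using v by (simp add: powr_divide powr_minus divide_simps powr_mult powr_realpow[symmetric] powr_powr mult.commute)
      \<comment> \<open>With v = L / A^p the exponent of \<open>A\<close> becomes 1 - p\<alpha>, and
        p\<alpha> = 1 - p.\<close>
      moreover have "v powr \<alpha> * A = L powr \<alpha> * A powr p"
      proof -
        have "v powr \<alpha> * A = L powr \<alpha> * (A powr (- (p * \<alpha>)) * A powr 1)"
          using Lpos A(1) by (simp add: v_def powr_divide powr_powr powr_minus divide_simps)
        also have "A powr (- (p * \<alpha>)) * A powr 1 = A powr p"
          unfolding powr_add[symmetric] using p by (simp add: \<alpha>_def field_simps)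
        finally show ?thesis .
      qed
      ultimately show ?thesis by (simp add: mult_ac)
    qed
    finally show ?thesis .
  qed
  have up: "(\<integral>\<^sup>+z. indicator (P (v * 2 ^ j)) z * h z \<partial>N)
      \<le> ennreal (B * D powr (1/p) * L powr \<alpha> * A powr p * (1/2) ^ j)" for j
  proof -
    let ?v = "v * 2 ^ j"
    have v': "0 < ?v" using v by simp
    have "(\<integral>\<^sup>+z. indicator (half_cone x) z * (indicator (P ?v) z * ennreal (F z powr q / V z)) \<partial>N)
      \<le> (\<integral>\<^sup>+z. indicator (half_cone x) z * (indicator {z. ?v < Vol M x (snd z)} z * ennreal (F z powr q / V z)) \<partial>N)"
      by (intro nn_integral_mono mult_left_mono mult_right_mono) (auto simp: P_def indicator_def)
    also have "\<dots> \<le> ennreal ((D * L / ?v) powr (1 / (p/q)))"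
      using p q L v' by (intro half_cone_upper_bound) auto
    also have "\<dots> = ennreal (((D * L / ?v) powr (1 / p)) powr q)"
      by (simp add: powr_powr)
    finally have "(\<integral>\<^sup>+z. indicator (P ?v) z * h z \<partial>N) \<le> ennreal (B * ?v powr \<alpha> * (D * L / ?v) powr (1 / p))"
      using v' by (intro piece') auto
    also have "B * ?v powr \<alpha> * (D * L / ?v) powr (1 / p) = B * D powr (1/p) * L powr \<alpha> * A powr p * (1/2) ^ j"
    proof -
      have "?v powr \<alpha> * (D * L / ?v) powr (1/p) = D powr (1/p) * L powr (1/p) * (?v powr \<alpha> * ?v powr (- (1/p)))"
        using v' Lpos D_ge_1 by (simp add: powr_divide powr_mult powr_minus divide_simps)
      also have "?v powr \<alpha> * ?v powr (- (1/p)) = 1 / ?v"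
        unfolding powr_add[symmetric] using v' by (simp add: \<alpha>_def powr_minus_divide)
      also have "1 / ?v = A powr p / L * (1/2) ^ j"
        using Lpos A(1) by (simp add: v_def power_divide)
      also have "L powr (1/p) = L powr \<alpha> * L"
        using Lpos by (simp add: \<alpha>_def powr_diff)
      finally show ?thesis using Lpos by (simp add: mult_ac)
    qed
    finally show ?thesis .
  qed
  have "(\<integral>\<^sup>+z. h z \<partial>N) \<le> (\<integral>\<^sup>+z. (\<Sum>j. indicator (P (v / 2 ^ (j+1))) z * h z) + (\<Sum>j. indicator (P (v * 2 ^ j)) z * h z) \<partial>N)"
  proof (rule nn_integral_mono)
    fix z
    show "h z \<le> (\<Sum>j. indicator (P (v / 2 ^ (j+1))) z * h z) + (\<Sum>j. indicator (P (v * 2 ^ j)) z * h z)"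
    proof (cases "0 < snd z")
      case False
      then have "h z = 0" by (simp add: h_def indicator_half_cone)
      then show ?thesis by simp
    next
      case True
      then consider j where "z \<in> P (v / 2 ^ (j+1))" | j where "z \<in> P (v * 2 ^ j)"
        using dyadic_cover[OF Vol_pos[OF True, of x] v] by (auto simp: P_def)
      then show ?thesis
      proof cases
        case 1
        then have "h z = indicator (P (v / 2 ^ (j+1))) z * h z" by simp
        also have "\<dots> \<le> (\<Sum>j. indicator (P (v / 2 ^ (j+1))) z * h z)"
          by (rule le_suminf_ennreal)
        finally show ?thesis by (rule order_trans) simp
      next
        case 2
        then have "h z = indicator (P (v * 2 ^ j)) z * h z" by simp
        also have "\<dots> \<le> (\<Sum>j. indicator (P (v * 2 ^ j)) z * h z)"
          by (rule le_suminf_ennreal)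
        finally show ?thesis by (rule order_trans) simp
      qed
    qed
  qed
  also have "\<dots> = (\<Sum>j. \<integral>\<^sup>+z. indicator (P (v / 2 ^ (j+1))) z * h z \<partial>N) + (\<Sum>j. \<integral>\<^sup>+z. indicator (P (v * 2 ^ j)) z * h z \<partial>N)"
  proof -
    have *: "(\<integral>\<^sup>+z. (\<Sum>j. indicator (P (w j)) z * h z) \<partial>N) = (\<Sum>j. \<integral>\<^sup>+z. indicator (P (w j)) z * h z \<partial>N)"
      for w :: "nat \<Rightarrow> real"
      by (rule nn_integral_suminf) measurable
    show ?thesis
      by (subst (1 2) *[symmetric]) (rule nn_integral_add; measurable)
  qed
  also have "\<dots> \<le> (\<Sum>j. ennreal (B * L powr \<alpha> * A powr p * ((2 powr - \<alpha>) * (2 powr - \<alpha>) ^ j)))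
      + (\<Sum>j. ennreal (B * D powr (1/p) * L powr \<alpha> * A powr p * (1/2) ^ j))"
    by (intro add_mono suminf_le lo up) auto
  also have "\<dots> = ennreal (B * L powr \<alpha> * A powr p * (2 powr - \<alpha> * (1 / (1 - 2 powr - \<alpha>))))
      + ennreal (B * D powr (1/p) * L powr \<alpha> * A powr p * 2)"
  proof -
    have x: "0 < 2 powr - \<alpha>" "2 powr - \<alpha> < 1" using \<alpha> by (auto simp: powr_less_one)
    have "(\<lambda>j. B * L powr \<alpha> * A powr p * ((2 powr - \<alpha>) * (2 powr - \<alpha>) ^ j)) sums (B * L powr \<alpha> * A powr p * (2 powr - \<alpha> * (1 / (1 - 2 powr - \<alpha>))))"
      using x by (intro sums_mult geometric_sums) auto
    moreover have "(\<lambda>j. B * D powr (1/p) * L powr \<alpha> * A powr p * (1/2) ^ j) sums (B * D powr (1/p) * L powr \<alpha> * A powr p * 2)"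
      using geometric_sums[of "1/2::real"] by (intro sums_mult) auto
    ultimately show ?thesis
      using B x by (intro arg_cong2[where f="(+)"] suminf_ennreal_eq) auto
  qed
  also have "\<dots> = ennreal (B * L powr \<alpha> * A powr p * (2 powr - \<alpha> * (1 / (1 - 2 powr - \<alpha>)))
      + B * D powr (1/p) * L powr \<alpha> * A powr p * 2)"
  proof -
    have x: "0 < 2 powr - \<alpha>" "2 powr - \<alpha> < 1" using \<alpha> by (auto simp: powr_less_one)
    show ?thesis using B x by (intro ennreal_plus[symmetric]) auto
  qed
  also have "\<dots> = ennreal (pairing_const p * B * L powr \<alpha> * a powr (p/q))"
    by (simp add: pairing_const_def \<alpha>_def[symmetric] A(3) distrib_left distrib_right mult_ac)
  finally show ?thesis by (simp add: h_def \<alpha>_def)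
qed

text \<open>\<open>dense\<close> lets each value of \<open>F * G\<close> at height t be averaged
  over the good centres \<open>x\<close> in the ball of radius t/2, at the cost of \<kappa>.
  Tonelli's theorem turns this into an integral of the half-cone pairings, and integrating their
  pointwise bound adds one more factor \<open>L\<close>.\<close>

lemma pairing_bound_of_pieces:
  assumes \<kappa>: "0 < \<kappa>"
    and dense: "\<And>y t. 0 < t \<Longrightarrow> ennreal (Vol M y t / \<kappa>) \<le> (\<integral>\<^sup>+x. indicator (ball y (t / 2)) x * indicator Gd (x, t) \<partial>M)"
  shows "(\<integral>\<^sup>+z. ennreal (F z * G z) \<partial>N) \<le> ennreal (\<kappa> * pairing_const p * B * L powr (1/p))"
proof -
  interpret N: sigma_finite_measure N by (rule sigma_finite_N)
  interpret P: pair_sigma_finite M N by (rule pair_sigma_finite_M_N)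
  define \<alpha> where "\<alpha> = 1/p - 1"
  let ?\<theta> = "p / q"
  let ?u = "\<lambda>z. F z powr q"
  let ?h = "\<lambda>x z. indicator (half_cone x) z * (indicator Gd (x, snd z) * ennreal (F z * G z / V z))"
  let ?I = "\<lambda>x. \<integral>\<^sup>+z. ?h x z \<partial>N"
  have \<theta>: "0 < ?\<theta>" using p q by simp
  have meas [measurable]: "(\<lambda>(x, z). ?h x z) \<in> borel_measurable (M \<Otimes>\<^sub>M N)"
    unfolding indicator_half_cone by measurable
  have AE1: "AE x in M. enn_powr (cone_int M ?u x) ?\<theta> \<noteq> \<infinity>"
    using L by (intro nn_integral_PInf_AE) (auto simp: tent_int_def)
  \<comment> \<open>The pointwise bound requires L > 0. If L = 0 the area integral vanishes almost
    everywhere, so points where it is positive can be ignored.\<close>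
  have AE2: "AE x in M. L = 0 \<longrightarrow> enn_powr (cone_int M ?u x) ?\<theta> = 0"
  proof (cases "L = 0")
    case True
    then have "(\<integral>\<^sup>+x. enn_powr (cone_int M ?u x) ?\<theta> \<partial>M) = 0" using L by (simp add: tent_int_def)
    then show ?thesis by (subst (asm) nn_integral_0_iff_AE) auto
  qed simp
  have "AE x in M. ?I x \<le> ennreal (pairing_const p * B * L powr \<alpha>) * enn_powr (cone_int M ?u x) ?\<theta>"
    using AE1 AE2
  proof eventually_elim
    case (elim x)
    then obtain a where a: "cone_int M ?u x = ennreal a" "0 \<le> a"
      by (cases "cone_int M ?u x") auto
    show ?case
    proof (cases "a = 0")
      case True
      then have "(\<integral>\<^sup>+z. indicator (cone x) z * ennreal (F z powr q / V z) \<partial>N) = 0"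
        using a by (simp add: cone_int_def)
      then have "AE z in N. indicator (cone x) z * ennreal (F z powr q / V z) = 0"
        by (subst (asm) nn_integral_0_iff_AE) (auto simp: indicator_cone)
      then have "AE z in N. ?h x z = 0"
        using AE_N_pos
      proof eventually_elim
        case (elim z)
        show ?case
        proof (cases "z \<in> half_cone x")
          case in_hc: True
          then have "dist x (fst z) < snd z" using elim by (auto simp: half_cone_def)
          then have "F z powr q / V z \<le> 0" using elim by (auto simp: indicator_cone ennreal_eq_0_iff)
          then have "F z = 0" using Vol_pos[OF elim(2), of "fst z"] F_nn[of z]
            by (simp add: divide_le_0_iff)
          then show ?thesis by simp
        qed simp
      qed
      then have "?I x = 0" by (subst nn_integral_0_iff_AE) (auto simp: indicator_half_cone)
      then show ?thesis by simp
    next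
      case False
      then have a_pos: "0 < a" using a by simp
      then have "L \<noteq> 0" using elim a by (auto simp: enn_powr_ennreal)
      then have "?I x \<le> ennreal (pairing_const p * B * L powr \<alpha> * a powr ?\<theta>)"
        unfolding \<alpha>_def using L by (intro half_cone_pairing_pointwise a a_pos) auto
      also have "\<dots> = ennreal (pairing_const p * B * L powr \<alpha>) * enn_powr (cone_int M ?u x) ?\<theta>"
        using a by (simp add: enn_powr_ennreal ennreal_mult'')
      finally show ?thesis .
    qed
  qed
  then have I: "(\<integral>\<^sup>+x. ?I x \<partial>M) \<le> (\<integral>\<^sup>+x. ennreal (pairing_const p * B * L powr \<alpha>) * enn_powr (cone_int M ?u x) ?\<theta> \<partial>M)"
    by (rule nn_integral_mono_AE)
  have "(\<integral>\<^sup>+z. ennreal (F z * G z) \<partial>N)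
    \<le> (\<integral>\<^sup>+z. ennreal \<kappa> * (\<integral>\<^sup>+x. ?h x z \<partial>M) \<partial>N)"
  proof (rule nn_integral_mono_AE)
    show "AE z in N. ennreal (F z * G z) \<le> ennreal \<kappa> * (\<integral>\<^sup>+x. ?h x z \<partial>M)"
      using AE_N_pos
    proof eventually_elim
      case (elim z)
      have V: "0 < V z" using Vol_pos[OF elim] .
      have FG: "0 \<le> F z * G z" using F_nn G_nn by simp
      have [measurable]: "ball (fst z) (snd z / 2) \<in> sets M" by (simp add: sets_M)
      have [measurable]: "(\<lambda>x. indicator Gd (x, snd z) :: ennreal) \<in> borel_measurable M" by measurable
      have "ennreal (F z * G z) = ennreal \<kappa> * (ennreal (F z * G z / V z) * ennreal (V z / \<kappa>))"
        using V \<kappa> FG by (simp add: ennreal_mult''[symmetric])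
      also have "\<dots> \<le> ennreal \<kappa> * (ennreal (F z * G z / V z) * (\<integral>\<^sup>+x. indicator (ball (fst z) (snd z / 2)) x * indicator Gd (x, snd z) \<partial>M))"
        by (intro mult_left_mono dense[OF elim]) auto
      also have "\<dots> = ennreal \<kappa> * (\<integral>\<^sup>+x. ennreal (F z * G z / V z) * (indicator (ball (fst z) (snd z / 2)) x * indicator Gd (x, snd z)) \<partial>M)"
        by (subst nn_integral_cmult) auto
      also have "\<dots> = ennreal \<kappa> * (\<integral>\<^sup>+x. ?h x z \<partial>M)"
        using elim by (intro arg_cong[where f="\<lambda>w. ennreal \<kappa> * w"] nn_integral_cong)
          (auto simp: mem_half_cone indicator_def dist_commute)
      finally show ?case .
    qed
  qed
  also have "\<dots> = ennreal \<kappa> * (\<integral>\<^sup>+z. (\<integral>\<^sup>+x. ?h x z \<partial>M) \<partial>N)"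
    by (rule nn_integral_cmult) measurable
  also have "(\<integral>\<^sup>+z. (\<integral>\<^sup>+x. ?h x z \<partial>M) \<partial>N) = (\<integral>\<^sup>+x. ?I x \<partial>M)"
    by (rule P.Fubini') (rule meas)
  also have "ennreal \<kappa> * \<dots> \<le> ennreal \<kappa> * (ennreal (pairing_const p * B * L powr \<alpha>) * ennreal L)"
    using I L(1) by (intro mult_left_mono) (auto simp: nn_integral_cmult tent_int_def)
  also have "\<dots> = ennreal (\<kappa> * (pairing_const p * B * (L powr \<alpha> * L)))"
    using \<kappa> L(2) B pairing_const_pos[OF p] by (simp add: ennreal_mult''[symmetric] mult_ac)
  also have "L powr \<alpha> * L = L powr (1/p)"
    using L(2) by (cases "L = 0") (auto simp: \<alpha>_def powr_diff)
  finally show ?thesis by (simp add: mult_ac)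
qed

end

lemma Vol_ball_compare:
  assumes "0 < t" "dist y x < t"
  shows "Vol M y (2 * t) \<le> D * D * Vol M x t"
proof -
  have "ball y (2 * t) \<subseteq> ball x (2 * (2 * t))"
  proof
    fix w assume "w \<in> ball y (2 * t)"
    then show "w \<in> ball x (2 * (2 * t))"
      using assms dist_triangle[of x w y] by (simp add: dist_commute)
  qed
  then have "Vol M y (2 * t) \<le> Vol M x (2 * (2 * t))" by (rule Vol_mono)
  also have "\<dots> \<le> D * (D * Vol M x t)"
    using assms Vol_double[of "2 * t" x] Vol_double[of t x] D_ge_1
    by (meson mult_left_mono order_trans mult_pos_pos zero_less_numeral zero_le_one)
  finally show ?thesis by (simp add: mult_ac)
qed

section \<open>Good heights for q > 1 and for q = 1\<close>

text \<open>\<open>\<Phi> x t\<close> is the \<open>r\<close>-th power of the half-cone area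
  function of \<open>G\<close> truncated at height t, and \<open>Gd\<close> is where it does not
  exceed its expected size. The Carleson condition on the ball of radius 2t bounds its integral over
  the ball of radius t/2, and Chebyshev's inequality discards at most half of that ball.\<close>

lemma pairing_bound_exponent_gt_1:
  assumes F [measurable]: "F \<in> borel_measurable N" and G [measurable]: "G \<in> borel_measurable N"
    and F_nn: "\<And>z. 0 \<le> F z" and G_nn: "\<And>z. 0 \<le> G z"
    and p: "0 < p" "p < 1" and q: "1 < q" "1/q + 1/r = 1" and K: "0 < K"
    and L: "tent_int M (p/q) (\<lambda>z. F z powr q) = ennreal L" "0 \<le> L"
    and carleson: "\<And>y \<rho>. 0 < \<rho> \<Longrightarrow> (\<integral>\<^sup>+z. indicator (tent (ball y \<rho>)) z * ennreal (G z powr r) \<partial>N)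
       \<le> ennreal ((K * Vol M y \<rho> powr (1/p - 1 + 1/r)) powr r)"
  shows "(\<integral>\<^sup>+z. ennreal (F z * G z) \<partial>N)
    \<le> ennreal (2 * D * pairing_const p * (K * ((2 * (D * D)) powr (1/r) * (D * D) powr (1/p - 1) * 2 powr (1/p - 1))) * L powr (1/p))"
proof -
  interpret N: sigma_finite_measure N by (rule sigma_finite_N)
  interpret P: pair_sigma_finite M N by (rule pair_sigma_finite_M_N)
  define \<alpha> where "\<alpha> = 1/p - 1"
  have \<alpha>: "0 < \<alpha>" using p by (simp add: \<alpha>_def)
  have r: "1 < r"
  proof -
    have "0 < 1/q" "1/q < 1" using q by auto
    then have "0 < 1/r" "1/r < 1" using q by linarith+
    then show ?thesis by (simp add: field_simps split: if_splits)
  qed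
  have D: "0 < D" using D_ge_1 by simp
  define \<Phi> where "\<Phi> x t = (\<integral>\<^sup>+z. indicator {z. snd z \<le> t} z * (indicator (half_cone x) z * ennreal (G z powr r / V z)) \<partial>N)" for x t
  \<comment> \<open>The factor 2 * (D * D) makes Chebyshev's inequality leave a bad set of at most
    half the ball of radius t/2. The factor \<open>(D * D) powr (\<alpha> * r)\<close> replaces the
    volume of the ball of radius 2t about y by that of the ball of radius t about x.\<close>
  define c where "c = 2 * (D * D) * K powr r * (D * D) powr (\<alpha> * r)"
  have c: "0 < c" using D K by (simp add: c_def)
  \<comment> \<open>The \<open>r\<close>-th root of \<open>c\<close>, enlarged by
    \<open>2 powr \<alpha>\<close> because volumes in a slice reach 2v.\<close>
  define B where "B = K * ((2 * (D * D)) powr (1/r) * (D * D) powr \<alpha> * 2 powr \<alpha>)"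
  have B: "0 < B" using D K by (simp add: B_def)
  have Bc: "B powr r = c * 2 powr (\<alpha> * r)"
    using D K r by (simp add: B_def c_def powr_mult powr_powr mult_ac)
  define Gd where "Gd = {w. \<Phi> (fst w) (snd w) \<le> ennreal (c * Vol M (fst w) (snd w) powr (\<alpha> * r))}"
  have [measurable]: "(\<lambda>w. \<Phi> (fst w) (snd w)) \<in> borel_measurable (M \<Otimes>\<^sub>M borel)"
    unfolding \<Phi>_def indicator_half_cone unfolding indicator_def by measurable
  have [measurable]: "(\<lambda>x. \<Phi> x t) \<in> borel_measurable M" for t
    unfolding \<Phi>_def indicator_half_cone unfolding indicator_def by measurable
  have Gd_meas: "Gd \<in> sets (M \<Otimes>\<^sub>M borel)"
  proof -
    have "{w \<in> space (M \<Otimes>\<^sub>M borel). \<Phi> (fst w) (snd w) \<le> ennreal (c * Vol M (fst w) (snd w) powr (\<alpha> * r))} \<in> sets (M \<Otimes>\<^sub>M borel)"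
      by measurable
    then show ?thesis by (simp add: Gd_def space_pair_measure)
  qed
  have "(\<integral>\<^sup>+z. ennreal (F z * G z) \<partial>N) \<le> ennreal ((2 * D) * pairing_const p * B * L powr (1/p))"
  proof (rule pairing_bound_of_pieces[where Gd = Gd and q = q])
    fix x v A
    assume v: "0 < v" and A: "0 \<le> (A::real)"
      and FA: "(\<integral>\<^sup>+z. indicator (half_cone x) z * (indicator {z. v < Vol M x (snd z) \<and> Vol M x (snd z) \<le> 2 * v} z
            * ennreal (F z powr q / V z)) \<partial>N) \<le> ennreal (A powr q)"
    let ?P = "{z::'a \<times> real. v < Vol M x (snd z) \<and> Vol M x (snd z) \<le> 2 * v}"
    let ?S = "{t. (x, t) \<in> Gd \<and> v < Vol M x t \<and> Vol M x t \<le> 2 * v}"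
    let ?w = "\<lambda>z. indicator (half_cone x) z * (indicator ?P z * indicator Gd (x, snd z)) / V z :: real"
    have [measurable]: "?P \<in> sets N"
    proof -
      have "{z\<in>space N. v < Vol M x (snd z) \<and> Vol M x (snd z) \<le> 2 * v} \<in> sets N" by measurable
      then show ?thesis by simp
    qed
    have [measurable]: "half_cone x \<in> sets N"
    proof -
      have "{z\<in>space N. 0 < snd z \<and> dist x (fst z) < snd z / 2} \<in> sets N" by measurable
      then show ?thesis by (simp add: half_cone_def)
    qed
    note Gd_meas[measurable]
    have "(\<integral>\<^sup>+z. ennreal (?w z * (F z * G z)) \<partial>N) \<le> ennreal (A * (B * v powr \<alpha>))"
    proof (rule nn_integral_Holder_le[where q = q and r = r])
      have "(\<integral>\<^sup>+z. ennreal (?w z * F z powr q) \<partial>N)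
        \<le> (\<integral>\<^sup>+z. indicator (half_cone x) z * (indicator ?P z * ennreal (F z powr q / V z)) \<partial>N)"
        by (intro nn_integral_mono) (auto simp: indicator_def)
      then show "(\<integral>\<^sup>+z. ennreal (?w z * F z powr q) \<partial>N) \<le> ennreal (A powr q)"
        using FA by (rule order_trans)
      show "(\<integral>\<^sup>+z. ennreal (?w z * G z powr r) \<partial>N) \<le> ennreal ((B * v powr \<alpha>) powr r)"
      \<comment> \<open>Each good height t in the slice bounds the part below t by
        \<open>\<Phi> x t\<close>, with a bound that depends on v only. As the set of good heights
        need not contain its supremum, these parts are exhausted by truncations.\<close>
      proof (rule nn_integral_truncation_le[where \<tau> = snd and S = ?S])
        show "snd z \<in> ?S" if "ennreal (?w z * G z powr r) \<noteq> 0" for z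
          using that by (auto simp: indicator_def split: if_splits)
        fix t assume t: "t \<in> ?S"
        have "(\<integral>\<^sup>+z. indicator {z. snd z \<le> t} z * ennreal (?w z * G z powr r) \<partial>N) \<le> \<Phi> x t"
          unfolding \<Phi>_def by (intro nn_integral_mono) (auto simp: indicator_def)
        also have "\<dots> \<le> ennreal (c * Vol M x t powr (\<alpha> * r))" using t by (simp add: Gd_def)
        also have "\<dots> \<le> ennreal (c * (2 * v) powr (\<alpha> * r))"
          using t c \<alpha> r by (intro ennreal_leI mult_left_mono powr_mono2) auto
        also have "c * (2 * v) powr (\<alpha> * r) = (B * v powr \<alpha>) powr r"
          using v B by (simp add: powr_mult Bc powr_powr)
        finally show "(\<integral>\<^sup>+z. indicator {z. snd z \<le> t} z * ennreal (?w z * G z powr r) \<partial>N) \<le> ennreal ((B * v powr \<alpha>) powr r)" .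
      qed measurable
    qed (use q F_nn G_nn A B in auto)
    then show "(\<integral>\<^sup>+z. indicator (half_cone x) z * (indicator ?P z
            * (indicator Gd (x, snd z) * ennreal (F z * G z / V z))) \<partial>N) \<le> ennreal (B * v powr (1/p - 1) * A)"
    proof (rule order_trans[rotated, THEN order_trans])
      show "(\<integral>\<^sup>+z. indicator (half_cone x) z * (indicator ?P z
            * (indicator Gd (x, snd z) * ennreal (F z * G z / V z))) \<partial>N) \<le> (\<integral>\<^sup>+z. ennreal (?w z * (F z * G z)) \<partial>N)"
        by (intro nn_integral_mono) (auto simp: indicator_def)
    qed (simp add: \<alpha>_def mult_ac)
  next
    fix y :: 'a and t :: real assume t: "0 < t"
    let ?b = "ball y (t / 2)"
    let ?W = "Vol M y (2 * t)"
    have W: "0 < ?W" using t by (intro Vol_pos) simp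
    have [measurable]: "?b \<in> sets M" by (simp add: sets_M)
    note Gd_meas[measurable]
    have [measurable]: "(\<lambda>x. indicator Gd (x, t) :: ennreal) \<in> borel_measurable M" by measurable
    \<comment> \<open>A threshold independent of \<open>x\<close>, as Chebyshev's inequality
      requires. On the bad set it lies below the defining threshold of \<open>Gd\<close>, by the
      comparison of balls.\<close>
    define lam where "lam = 2 * (D * D) * K powr r * ?W powr (\<alpha> * r)"
    have lam: "0 < lam" using D K W by (simp add: lam_def)
    have bad: "ennreal lam * (\<integral>\<^sup>+x. indicator ?b x * indicator (- Gd) (x, t) \<partial>M) \<le> ennreal (K powr r * ?W powr (\<alpha> * r) * ?W)"
    proof -
      have "ennreal lam * (\<integral>\<^sup>+x. indicator ?b x * indicator (- Gd) (x, t) \<partial>M)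
        = (\<integral>\<^sup>+x. ennreal lam * (indicator ?b x * indicator (- Gd) (x, t)) \<partial>M)"
        by (subst nn_integral_cmult) auto
      also have "\<dots> \<le> (\<integral>\<^sup>+x. indicator ?b x * \<Phi> x t \<partial>M)"
      proof (rule nn_integral_mono)
        fix x
        show "ennreal lam * (indicator ?b x * indicator (- Gd) (x, t)) \<le> indicator ?b x * \<Phi> x t"
        proof (cases "x \<in> ?b \<and> (x, t) \<notin> Gd")
          case True
          then have "?W \<le> D * D * Vol M x t" using t by (intro Vol_ball_compare) auto
          then have "?W powr (\<alpha> * r) \<le> (D * D * Vol M x t) powr (\<alpha> * r)"
            using W \<alpha> r by (intro powr_mono2) auto
          then have "lam \<le> 2 * (D * D) * K powr r * (D * D * Vol M x t) powr (\<alpha> * r)"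
            unfolding lam_def using D K by (intro mult_left_mono) auto
          also have "\<dots> = c * Vol M x t powr (\<alpha> * r)"
            using D by (simp add: c_def powr_mult)
          finally have "ennreal lam \<le> ennreal (c * Vol M x t powr (\<alpha> * r))" by (rule ennreal_leI)
          also have "\<dots> \<le> \<Phi> x t" using True by (simp add: Gd_def not_le less_imp_le)
          finally show ?thesis using True by simp
        qed (auto simp: indicator_def)
      qed
      also have "\<dots> = (\<integral>\<^sup>+x. (\<integral>\<^sup>+z. indicator ?b x * (indicator {z. snd z \<le> t} z * (indicator (half_cone x) z * ennreal (G z powr r / V z))) \<partial>N) \<partial>M)"
        unfolding \<Phi>_def indicator_half_cone unfolding indicator_def by (subst nn_integral_cmult) auto
      also have "\<dots> = (\<integral>\<^sup>+z. (\<integral>\<^sup>+x. indicator ?b x * (indicator {z. snd z \<le> t} z * (indicator (half_cone x) z * ennreal (G z powr r / V z))) \<partial>M) \<partial>N)"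
        unfolding indicator_half_cone unfolding indicator_def by (rule P.Fubini'[symmetric]) measurable
      also have "\<dots> \<le> (\<integral>\<^sup>+z. indicator (tent (ball y (2 * t))) z * ennreal (G z powr r) \<partial>N)"
      proof (rule nn_integral_mono_AE)
        show "AE z in N. (\<integral>\<^sup>+x. indicator ?b x * (indicator {z. snd z \<le> t} z * (indicator (half_cone x) z * ennreal (G z powr r / V z))) \<partial>M)
          \<le> indicator (tent (ball y (2 * t))) z * ennreal (G z powr r)"
          using AE_N_pos
        proof eventually_elim
          case (elim z)
          have [measurable]: "ball (fst z) (snd z) \<in> sets M" by (simp add: sets_M)
          have "(\<integral>\<^sup>+x. indicator ?b x * (indicator {z. snd z \<le> t} z * (indicator (half_cone x) z * ennreal (G z powr r / V z))) \<partial>M)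
            \<le> (\<integral>\<^sup>+x. indicator (tent (ball y (2 * t))) z * ennreal (G z powr r / V z) * indicator (ball (fst z) (snd z)) x \<partial>M)"
          proof (rule nn_integral_mono)
            fix x
            \<comment> \<open>The radii add up to at most t/2 + t/2 + t = 2t: the distance from y to
              x, half the height of \<open>z\<close>, and the height of \<open>z\<close>.\<close>
            have "z \<in> tent (ball y (2 * t)) \<and> x \<in> ball (fst z) (snd z)"
              if "x \<in> ?b" "snd z \<le> t" "z \<in> half_cone x"
            proof -
              have "dist y x < t / 2" "dist x (fst z) < snd z / 2" using that by (auto simp: half_cone_def)
              moreover have "dist y w \<le> dist y x + dist x (fst z) + dist (fst z) w" for w
                using dist_triangle[of y w x] dist_triangle[of x w "fst z"] by linarith
              ultimately have "ball (fst z) (snd z) \<subseteq> ball y (2 * t)"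
                using that(2) by (intro subsetI) (smt (verit) mem_ball field_sum_of_halves)
              then show ?thesis using elim \<open>dist x (fst z) < snd z / 2\<close>
                by (auto simp: tent_def dist_commute case_prod_beta)
            qed
            then show "indicator ?b x * (indicator {z. snd z \<le> t} z * (indicator (half_cone x) z * ennreal (G z powr r / V z)))
              \<le> indicator (tent (ball y (2 * t))) z * ennreal (G z powr r / V z) * indicator (ball (fst z) (snd z)) x"
              by (auto simp: indicator_def)
          qed
          also have "\<dots> = indicator (tent (ball y (2 * t))) z * (ennreal (G z powr r / V z) * ennreal (V z))"
            by (subst nn_integral_cmult) (auto simp: emeasure_ball mult.assoc)
          also have "ennreal (G z powr r / V z) * ennreal (V z) = ennreal (G z powr r)"
            using Vol_pos[OF elim, of "fst z"] by (simp add: ennreal_mult''[symmetric])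
          finally show ?case .
        qed
      qed
      also have "\<dots> \<le> ennreal ((K * ?W powr (1/p - 1 + 1/r)) powr r)"
        using t by (intro carleson) simp
      also have "(K * ?W powr (1/p - 1 + 1/r)) powr r = K powr r * ?W powr ((\<alpha> + 1/r) * r)"
        using K W by (simp add: powr_mult powr_powr \<alpha>_def)
      also have "(\<alpha> + 1/r) * r = \<alpha> * r + 1" using r by (simp add: field_simps)
      also have "K powr r * ?W powr (\<alpha> * r + 1) = K powr r * ?W powr (\<alpha> * r) * ?W"
        using W by (simp add: powr_add)
      finally show ?thesis .
    qed
    have halves: "?W \<le> D * D * Vol M y (t / 2)"
    proof -
      have "?W \<le> D * Vol M y t" using Vol_double[OF t, of y] .
      also have "\<dots> \<le> D * (D * Vol M y (t / 2))" using Vol_half[OF t, of y] D by (intro mult_left_mono) auto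
      finally show ?thesis by (simp add: mult_ac)
    qed
    have "ennreal (1 / lam) * (ennreal lam * (\<integral>\<^sup>+x. indicator ?b x * indicator (- Gd) (x, t) \<partial>M))
      \<le> ennreal (1 / lam) * ennreal (K powr r * ?W powr (\<alpha> * r) * ?W)"
      by (rule mult_left_mono[OF bad]) simp
    also have "\<dots> = ennreal (?W / (2 * (D * D)))"
      using W K D by (simp add: ennreal_mult''[symmetric] lam_def)
    also have "\<dots> \<le> ennreal (Vol M y (t / 2) / 2)"
      using halves D by (intro ennreal_leI) (simp add: field_simps)
    finally have bad': "(\<integral>\<^sup>+x. indicator ?b x * indicator (- Gd) (x, t) \<partial>M) \<le> ennreal (Vol M y (t / 2) / 2)"
      using lam by (simp add: mult.assoc[symmetric] ennreal_mult''[symmetric])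
    have "ennreal (Vol M y (t / 2)) = (\<integral>\<^sup>+x. indicator ?b x * indicator Gd (x, t) + indicator ?b x * indicator (- Gd) (x, t) \<partial>M)"
    proof -
      have "ennreal (Vol M y (t / 2)) = (\<integral>\<^sup>+x. indicator ?b x \<partial>M)" by (simp add: emeasure_ball)
      also have "\<dots> = (\<integral>\<^sup>+x. indicator ?b x * indicator Gd (x, t) + indicator ?b x * indicator (- Gd) (x, t) \<partial>M)"
        by (intro nn_integral_cong) (auto simp: indicator_def)
      finally show ?thesis .
    qed
    also have "\<dots> = (\<integral>\<^sup>+x. indicator ?b x * indicator Gd (x, t) \<partial>M) + (\<integral>\<^sup>+x. indicator ?b x * indicator (- Gd) (x, t) \<partial>M)"
      by (rule nn_integral_add) measurable
    also have "\<dots> \<le> (\<integral>\<^sup>+x. indicator ?b x * indicator Gd (x, t) \<partial>M) + ennreal (Vol M y (t / 2) / 2)"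
      by (intro add_left_mono bad')
    finally have good: "ennreal (Vol M y (t / 2)) \<le> (\<integral>\<^sup>+x. indicator ?b x * indicator Gd (x, t) \<partial>M) + ennreal (Vol M y (t / 2) / 2)" .
    have "ennreal (Vol M y (t / 2) / 2) \<le> (\<integral>\<^sup>+x. indicator ?b x * indicator Gd (x, t) \<partial>M)"
    proof (cases "\<integral>\<^sup>+x. indicator ?b x * indicator Gd (x, t) \<partial>M")
      case (real g)
      then show ?thesis using good by (simp add: ennreal_plus[symmetric] ennreal_le_iff del: ennreal_plus)
    qed simp
    moreover have "Vol M y t / (2 * D) \<le> Vol M y (t / 2) / 2"
      using Vol_half[OF t, of y] D by (simp add: field_simps)
    ultimately show "ennreal (Vol M y t / (2 * D)) \<le> (\<integral>\<^sup>+x. indicator ?b x * indicator Gd (x, t) \<partial>M)"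
      using ennreal_leI order_trans by blast
  qed (use F_nn G_nn p q B L D Gd_meas in auto)
  then show ?thesis by (simp add: B_def \<alpha>_def)
qed

text \<open>The Carleson condition bounds \<open>G\<close> almost everywhere on tents, hence on each
  slice of the half cone, so it can be pulled out of the integral. Every pair is good, and the
  density constant is only the factor \<open>D\<close> between radii t and t/2.\<close>

lemma pairing_bound_exponent_1:
  assumes F [measurable]: "F \<in> borel_measurable N" and G [measurable]: "G \<in> borel_measurable N"
    and F_nn: "\<And>z. 0 \<le> F z" and G_nn: "\<And>z. 0 \<le> G z"
    and p: "0 < p" "p < 1" and K: "0 \<le> K"
    and L: "tent_int M p F = ennreal L" "0 \<le> L"
    and carleson: "\<And>y \<rho>. 0 < \<rho> \<Longrightarrow> AE z in N. z \<in> tent (ball y \<rho>) \<longrightarrow> G z \<le> K * Vol M y \<rho> powr (1/p - 1)"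
  shows "(\<integral>\<^sup>+z. ennreal (F z * G z) \<partial>N) \<le> ennreal (D * pairing_const p * (K * (2 * D) powr (1/p - 1)) * L powr (1/p))"
proof (rule pairing_bound_of_pieces[where Gd = UNIV and q = 1])
  have D: "0 < D" using D_ge_1 by simp
  fix x v A
  assume v: "0 < v" and A: "0 \<le> (A::real)"
    and FA: "(\<integral>\<^sup>+z. indicator (half_cone x) z * (indicator {z. v < Vol M x (snd z) \<and> Vol M x (snd z) \<le> 2 * v} z
            * ennreal (F z powr 1 / V z)) \<partial>N) \<le> ennreal (A powr 1)"
  let ?P = "{z::'a \<times> real. v < Vol M x (snd z) \<and> Vol M x (snd z) \<le> 2 * v}"
  let ?S = "{t. v < Vol M x t \<and> Vol M x t \<le> 2 * v}"
  let ?c = "K * (2 * D) powr (1/p - 1) * v powr (1/p - 1)"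
  have [measurable]: "?P \<in> sets N"
  proof -
    have "{z\<in>space N. v < Vol M x (snd z) \<and> Vol M x (snd z) \<le> 2 * v} \<in> sets N" by measurable
    then show ?thesis by simp
  qed
  \<comment> \<open>Each tent has its own exceptional null set, while the slice involves uncountably
    many heights. A cofinal sequence of heights needs only countably many tents, and doubling bounds
    their volumes by 2Dv.\<close>
  have AE: "AE z in N. z \<in> half_cone x \<longrightarrow> z \<in> ?P \<longrightarrow> G z \<le> ?c"
  proof (cases "?S = {}")
    case True
    then have "z \<notin> ?P" for z by blast
    then show ?thesis by (intro AE_I2) blast
  next
    case False
    obtain u where u: "incseq u" "\<And>n. u n \<in> ?S" "\<And>t. t \<in> ?S \<Longrightarrow> \<exists>n. t \<le> u n"
      using incseq_cofinal[OF False] by blast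
    have u_pos: "0 < u n" for n using u(2)[of n] v by (auto intro: Vol_pos_imp[of x] less_trans)
    have "AE z in N. \<forall>n. z \<in> tent (ball x (2 * u n)) \<longrightarrow> G z \<le> K * Vol M x (2 * u n) powr (1/p - 1)"
      unfolding AE_all_countable using u_pos by (intro allI carleson) simp
    then show ?thesis
    proof eventually_elim
      case (elim z)
      show ?case
      proof (intro impI)
        assume z: "z \<in> half_cone x" "z \<in> ?P"
        then obtain n where n: "snd z \<le> u n" using u(3)[of "snd z"] by auto
        have "ball (fst z) (snd z) \<subseteq> ball x (2 * u n)"
        proof
          fix w assume "w \<in> ball (fst z) (snd z)"
          then show "w \<in> ball x (2 * u n)"
            using z(1) n dist_triangle[of x w "fst z"] by (auto simp: half_cone_def)
        qed
        then have "G z \<le> K * Vol M x (2 * u n) powr (1/p - 1)"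
          using elim z(1) by (auto simp: tent_def half_cone_def case_prod_beta)
        also have "\<dots> \<le> K * (2 * D * v) powr (1/p - 1)"
        proof (intro mult_left_mono powr_mono2 K)
          have "Vol M x (2 * u n) \<le> D * Vol M x (u n)" by (rule Vol_double[OF u_pos])
          also have "\<dots> \<le> D * (2 * v)" using u(2)[of n] D by (intro mult_left_mono) auto
          finally show "Vol M x (2 * u n) \<le> 2 * D * v" by simp
        qed (use p in auto)
        also have "\<dots> = ?c" using D v by (simp add: powr_mult)
        finally show "G z \<le> ?c" .
      qed
    qed
  qed
  have c: "0 \<le> ?c" using K by simp
  have "(\<integral>\<^sup>+z. indicator (half_cone x) z * (indicator ?P z
            * (indicator UNIV (x, snd z) * ennreal (F z * G z / V z))) \<partial>N)
    \<le> (\<integral>\<^sup>+z. ennreal ?c * (indicator (half_cone x) z * (indicator ?P z * ennreal (F z powr 1 / V z))) \<partial>N)"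
  proof (rule nn_integral_mono_AE)
    show "AE z in N. indicator (half_cone x) z * (indicator ?P z
            * (indicator UNIV (x, snd z) * ennreal (F z * G z / V z)))
      \<le> ennreal ?c * (indicator (half_cone x) z * (indicator ?P z * ennreal (F z powr 1 / V z)))"
      using AE
    proof eventually_elim
      case (elim z)
      show ?case
      proof (cases "z \<in> half_cone x \<and> z \<in> ?P")
        case True
        then have "F z * G z \<le> F z * ?c" using elim F_nn[of z] by (intro mult_left_mono) auto
        then have "F z * G z / V z \<le> F z * ?c / V z" by (intro divide_right_mono) auto
        then have "ennreal (F z * G z / V z) \<le> ennreal (?c * (F z / V z))"
          by (intro ennreal_leI) (simp add: mult_ac)
        also have "\<dots> = ennreal ?c * ennreal (F z / V z)" using c by (rule ennreal_mult')
        finally show ?thesis using True F_nn[of z] by simp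
      next
        case False
        then show ?thesis by (auto simp: indicator_def)
      qed
    qed
  qed
  also have "\<dots> = ennreal ?c * (\<integral>\<^sup>+z. indicator (half_cone x) z * (indicator ?P z * ennreal (F z powr 1 / V z)) \<partial>N)"
    unfolding indicator_half_cone by (rule nn_integral_cmult) measurable
  also have "\<dots> \<le> ennreal ?c * ennreal A" using FA A by (intro mult_left_mono) auto
  also have "\<dots> = ennreal (?c * A)" using c by (rule ennreal_mult'[symmetric])
  finally show "(\<integral>\<^sup>+z. indicator (half_cone x) z * (indicator ?P z
            * (indicator UNIV (x, snd z) * ennreal (F z * G z / V z))) \<partial>N) \<le> ennreal (?c * A)" .
next
  fix y :: 'a and t :: real assume t: "0 < t"
  have "(\<integral>\<^sup>+x. indicator (ball y (t / 2)) x * indicator UNIV (x, t) \<partial>M) = ennreal (Vol M y (t / 2))"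
    by (simp add: sets_M emeasure_ball)
  moreover have "Vol M y t / D \<le> Vol M y (t / 2)"
    using Vol_half[OF t, of y] D_ge_1 by (simp add: field_simps)
  ultimately show "ennreal (Vol M y t / D) \<le> (\<integral>\<^sup>+x. indicator (ball y (t / 2)) x * indicator UNIV (x, t) \<partial>M)"
    by (simp add: ennreal_leI)
next
  show "UNIV \<in> sets (M \<Otimes>\<^sub>M (borel :: real measure))"
    using sets.top[of "M \<Otimes>\<^sub>M (borel :: real measure)"] by (simp add: space_pair_measure)
qed (use F_nn G_nn p K L D_ge_1 in auto)

end

text \<open>It permits a constant \<open>K\<close> strictly above the Carleson norm, hence positive
  even when that norm is 0.\<close>

lemma ennreal_le_of_all_greater:
  fixes X :: ennreal
  assumes "0 \<le> c" "0 \<le> n" "\<And>K. n < K \<Longrightarrow> X \<le> ennreal (c * K)"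
  shows "X \<le> ennreal (c * n)"
proof (rule LIMSEQ_le_const)
  have "(\<lambda>k. c * (n + inverse (real (Suc k)))) \<longlonglongrightarrow> c * (n + 0)"
    by (intro tendsto_intros LIMSEQ_inverse_real_of_nat)
  then show "(\<lambda>k. ennreal (c * (n + inverse (real (Suc k))))) \<longlonglongrightarrow> ennreal (c * n)"
    by (intro tendsto_ennrealI) simp
  show "\<exists>k0. \<forall>k\<ge>k0. X \<le> ennreal (c * (n + inverse (real (Suc k))))"
    by (intro exI allI impI assms(3)) simp
qed

section \<open>The weighted norms as explicit inequalities\<close>

lemma Vmul_eq: "Vmul M s f z = complex_of_real (Vol M (fst z) (snd z) powr s) * f z"
  by (simp add: Vmul_def case_prod_beta)

context doubling_space
begin

lemma Vmul_measurable [measurable]: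
  assumes [measurable]: "f \<in> borel_measurable N"
  shows "Vmul M s f \<in> borel_measurable N"
  unfolding Vmul_eq by measurable

lemma Vmul_Vmul: "0 < snd z \<Longrightarrow> Vmul M (-s) (Vmul M s f) z = f z"
  using Vol_pos[of "snd z" "fst z"]
  by (simp add: Vmul_eq powr_minus mult.assoc[symmetric] flip: of_real_mult)

lemma cmod_Vmul: "cmod (Vmul M s f z) = V z powr s * cmod (f z)"
  by (simp add: Vmul_eq norm_mult)

lemma tent_inf_norm_le_iff:
  assumes K: "0 \<le> K"
  shows "tent_inf_norm M r \<sigma> \<alpha> g \<le> ennreal K \<longleftrightarrow>
    (\<forall>x \<rho>. 0 < \<rho> \<longrightarrow> Lr_tent M r (ball x \<rho>) (Vmul M (-\<sigma>) g)
      \<le> ennreal (K * Vol M x \<rho> powr (\<alpha> + (if r = \<infinity> then 0 else 1 / enn2real r))))"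
proof -
  have *: "ennreal (v powr - e) * X \<le> ennreal K \<longleftrightarrow> X \<le> ennreal (K * v powr e)"
    if "0 < v" for v e and X :: ennreal
  proof
    have one: "ennreal (v powr e) * ennreal (v powr - e) = 1"
      using that by (simp add: ennreal_mult''[symmetric] powr_minus)
    assume "ennreal (v powr - e) * X \<le> ennreal K"
    then have "ennreal (v powr e) * (ennreal (v powr - e) * X) \<le> ennreal (v powr e) * ennreal K"
      by (rule mult_left_mono) simp
    then show "X \<le> ennreal (K * v powr e)"
      using K unfolding mult.assoc[symmetric] one by (simp add: ennreal_mult mult.commute)
  next
    assume "X \<le> ennreal (K * v powr e)"
    then have "ennreal (v powr - e) * X \<le> ennreal (v powr - e) * ennreal (K * v powr e)"
      by (rule mult_left_mono) simp
    also have "\<dots> = ennreal (v powr - e * (K * v powr e))"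
      using K by (simp add: ennreal_mult''[symmetric])
    also have "v powr - e * (K * v powr e) = K" using that by (simp add: powr_minus)
    finally show "ennreal (v powr - e) * X \<le> ennreal K" .
  qed
  have "- \<alpha> - e = - (\<alpha> + e)" for e :: real by simp
  then show ?thesis
    unfolding tent_inf_norm_def SUP_le_iff
    by (auto simp only: Vol_def[symmetric] case_prod_conv Ball_def mem_Times_iff UNIV_I simp_thms fst_conv snd_conv split_paired_All greaterThan_iff * Vol_pos cong: imp_cong)
qed

lemma Lr_tent_le_iff:
  assumes "1 < r" "0 \<le> K" and [measurable]: "h \<in> borel_measurable N"
  shows "Lr_tent M (ennreal r) B h \<le> ennreal K \<longleftrightarrow>
    (\<integral>\<^sup>+z. indicator (tent B) z * ennreal (cmod (h z) powr r) \<partial>N) \<le> ennreal (K powr r)"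
proof -
  have *: "enn_powr X (1/r) \<le> ennreal K \<longleftrightarrow> X \<le> ennreal (K powr r)" for X
  proof
    assume "enn_powr X (1/r) \<le> ennreal K"
    then have "enn_powr (enn_powr X (1/r)) r \<le> enn_powr (ennreal K) r"
      using assms by (intro enn_powr_mono) auto
    then show "X \<le> ennreal (K powr r)" using assms by (simp add: enn_powr_enn_powr enn_powr_ennreal)
  next
    assume "X \<le> ennreal (K powr r)"
    then have "enn_powr X (1/r) \<le> enn_powr (ennreal (K powr r)) (1/r)"
      using assms by (intro enn_powr_mono) auto
    then show "enn_powr X (1/r) \<le> ennreal K" using assms by (simp add: enn_powr_ennreal powr_powr)
  qed
  then show ?thesis using assms by (simp add: Lr_tent_def)
qed

lemma Lr_tent_infinity_le_iff:
  assumes "0 \<le> K" and h [measurable]: "h \<in> borel_measurable N"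
  shows "Lr_tent M top B h \<le> ennreal K \<longleftrightarrow> (AE z in N. z \<in> tent B \<longrightarrow> cmod (h z) \<le> K)"
proof -
  let ?f = "\<lambda>z. ereal (indicator (tent B) z * cmod (h z))"
  have [measurable]: "?f \<in> borel_measurable N" by measurable
  have "e2ennreal (esssup N ?f) \<le> ennreal K \<longleftrightarrow> esssup N ?f \<le> ereal K"
  proof -
    have "e2ennreal e \<le> ennreal K \<longleftrightarrow> e \<le> ereal K" for e
      using assms(1)
      by (cases e) (auto simp: e2ennreal_ereal ennreal_le_iff e2ennreal_infty e2ennreal_neg top_unique)
    then show ?thesis .
  qed
  also have "\<dots> \<longleftrightarrow> (AE z in N. ?f z \<le> ereal K)"
  proof
    assume le: "esssup N ?f \<le> ereal K"
    show "AE z in N. ?f z \<le> ereal K"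
      by (rule eventually_mono[OF esssup_AE[of ?f N]]) (rule order_trans[OF _ le])
  qed (intro esssup_I; measurable)
  also have "\<dots> \<longleftrightarrow> (AE z in N. z \<in> tent B \<longrightarrow> cmod (h z) \<le> K)"
    using assms(1) by (intro AE_cong) (auto simp: indicator_def)
  finally show ?thesis by (simp add: Lr_tent_def)
qed

lemma tent_inf_norm_hconj_gt_1:
  assumes q: "1 < q" "1/q + 1/r = 1" and K: "0 \<le> K" and [measurable]: "g \<in> borel_measurable N"
  shows "tent_inf_norm M (hconj q) (-s) (delta 1 p) g \<le> ennreal K \<longleftrightarrow>
    (\<forall>y \<rho>. 0 < \<rho> \<longrightarrow> (\<integral>\<^sup>+z. indicator (tent (ball y \<rho>)) z * ennreal (cmod (Vmul M s g z) powr r) \<partial>N)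
       \<le> ennreal ((K * Vol M y \<rho> powr (1/p - 1 + 1/r)) powr r))"
proof -
  have r: "r = q / (q - 1)" "1 < r"
  proof -
    have "1/r = (q - 1)/q" using q by (simp add: field_simps)
    then have "1 / (1/r) = 1 / ((q - 1)/q)" by simp
    then show "r = q / (q - 1)" by simp
    then show "1 < r" using q by simp
  qed
  then have h: "hconj q = ennreal r" using q by (simp add: hconj_def)
  show ?thesis
    unfolding tent_inf_norm_le_iff[OF K] h
    using r K by (simp add: Lr_tent_le_iff delta_def)
qed

lemma tent_inf_norm_hconj_1:
  assumes K: "0 \<le> K" and [measurable]: "g \<in> borel_measurable N"
  shows "tent_inf_norm M (hconj 1) (-s) (delta 1 p) g \<le> ennreal K \<longleftrightarrow>
    (\<forall>y \<rho>. 0 < \<rho> \<longrightarrow> (AE z in N. z \<in> tent (ball y \<rho>) \<longrightarrow> cmod (Vmul M s g z) \<le> K * Vol M y \<rho> powr (1/p - 1)))"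
  unfolding tent_inf_norm_le_iff[OF K] hconj_def
  using K by (simp add: Lr_tent_infinity_le_iff delta_def)

text \<open>The weights carried by \<open>f\<close> and \<open>g\<close> are inverse to each other
  at positive heights, so the product is unchanged and one constant serves all
  \<open>s\<close>.\<close>

lemma pairing_bounded:
  assumes p: "0 < p" "p < 1" and q: "1 \<le> q"
  shows "\<exists>C>0. \<forall>s f g. f \<in> tent_space M p q s \<longrightarrow> g \<in> tent_inf_space M (hconj q) (-s) (delta 1 p) \<longrightarrow>
    (\<integral>\<^sup>+z. ennreal (cmod (f z * cnj (g z))) \<partial>N)
      \<le> ennreal C * tent_norm M p q s f * tent_inf_norm M (hconj q) (-s) (delta 1 p) g"
proof -
  define C where "C = (if q = 1 then D * pairing_const p * (2 * D) powr (1/p - 1)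
    else 2 * D * pairing_const p * ((2 * (D * D)) powr (1 / (q / (q - 1))) * (D * D) powr (1/p - 1) * 2 powr (1/p - 1)))"
  have C: "0 < C" using pairing_const_pos[OF p] D_ge_1 by (simp add: C_def)
  have "(\<integral>\<^sup>+z. ennreal (cmod (f z * cnj (g z))) \<partial>N)
      \<le> ennreal C * tent_norm M p q s f * tent_inf_norm M (hconj q) (-s) (delta 1 p) g"
    if f: "f \<in> tent_space M p q s" and g: "g \<in> tent_inf_space M (hconj q) (-s) (delta 1 p)" for s f g
  proof -
    have [measurable]: "f \<in> borel_measurable N" "g \<in> borel_measurable N"
      using f g by (auto simp: tent_space_def tent_inf_space_def)
    define F where "F z = cmod (Vmul M (-s) f z)" for z
    define G where "G z = cmod (Vmul M s g z)" for z
    have FG_meas: "F \<in> borel_measurable N" "G \<in> borel_measurable N" unfolding F_def G_def by measurable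
    have FG_nn: "0 \<le> F z" "0 \<le> G z" for z by (simp_all add: F_def G_def)
    have "tent_int M (p/q) (\<lambda>z. F z powr q) < \<infinity>"
      using f by (simp add: tent_space_def tent_norm_eq_tent_int F_def)
    then obtain L where L: "tent_int M (p/q) (\<lambda>z. F z powr q) = ennreal L" "0 \<le> L"
      by (cases "tent_int M (p/q) (\<lambda>z. F z powr q)") auto
    have fn: "tent_norm M p q s f = ennreal (L powr (1/p))"
      using L by (simp add: tent_norm_eq_tent_int F_def enn_powr_ennreal)
    obtain n where n: "tent_inf_norm M (hconj q) (-s) (delta 1 p) g = ennreal n" "0 \<le> n"
      using g by (cases "tent_inf_norm M (hconj q) (-s) (delta 1 p) g") (auto simp: tent_inf_space_def)
    have "(\<integral>\<^sup>+z. ennreal (cmod (f z * cnj (g z))) \<partial>N) = (\<integral>\<^sup>+z. ennreal (F z * G z) \<partial>N)"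
    proof (rule nn_integral_cong_AE)
      show "AE z in N. ennreal (cmod (f z * cnj (g z))) = ennreal (F z * G z)"
        using AE_N_pos
      proof eventually_elim
        case (elim z)
        then show ?case using Vol_pos[OF elim, of "fst z"]
          by (simp add: F_def G_def cmod_Vmul norm_mult powr_minus)
      qed
    qed
    also have "\<dots> \<le> ennreal ((C * L powr (1/p)) * n)"
    proof (rule ennreal_le_of_all_greater)
      fix K assume K: "n < K"
      then have K0: "0 < K" and gK: "tent_inf_norm M (hconj q) (-s) (delta 1 p) g \<le> ennreal K"
        using n by (auto simp: ennreal_leI)
      show "(\<integral>\<^sup>+z. ennreal (F z * G z) \<partial>N) \<le> ennreal ((C * L powr (1/p)) * K)"
      proof (cases "q = 1")
        case True
        have "(\<integral>\<^sup>+z. ennreal (F z * G z) \<partial>N)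
          \<le> ennreal (D * pairing_const p * (K * (2 * D) powr (1/p - 1)) * L powr (1/p))"
        proof (rule pairing_bound_exponent_1[OF FG_meas FG_nn p])
          show "0 \<le> K" using K0 by simp
          show "tent_int M p F = ennreal L" using L(1) FG_nn True by simp
          show "AE z in N. z \<in> tent (ball y \<rho>) \<longrightarrow> G z \<le> K * Vol M y \<rho> powr (1/p - 1)" if "0 < \<rho>" for y \<rho>
            using gK[unfolded True] that K0 unfolding G_def by (subst (asm) tent_inf_norm_hconj_1) auto
        qed (rule L(2))
        also have "D * pairing_const p * (K * (2 * D) powr (1/p - 1)) * L powr (1/p) = (C * L powr (1/p)) * K"
          using True by (simp add: C_def mult_ac)
        finally show ?thesis .
      next
        case False
        then have q1: "1 < q" using q by simp
        define r where "r = q / (q - 1)"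
        have qr: "1/q + 1/r = 1" using q1 by (simp add: r_def field_simps)
        have "(\<integral>\<^sup>+z. ennreal (F z * G z) \<partial>N)
          \<le> ennreal (2 * D * pairing_const p * (K * ((2 * (D * D)) powr (1/r) * (D * D) powr (1/p - 1) * 2 powr (1/p - 1))) * L powr (1/p))"
        proof (rule pairing_bound_exponent_gt_1[OF FG_meas FG_nn p q1 qr K0 L])
          show "(\<integral>\<^sup>+z. indicator (tent (ball y \<rho>)) z * ennreal (G z powr r) \<partial>N)
             \<le> ennreal ((K * Vol M y \<rho> powr (1/p - 1 + 1/r)) powr r)" if "0 < \<rho>" for y \<rho>
            using gK that K0 unfolding G_def by (subst (asm) tent_inf_norm_hconj_gt_1[OF q1 qr]) auto
        qed
        also have "2 * D * pairing_const p * (K * ((2 * (D * D)) powr (1/r) * (D * D) powr (1/p - 1) * 2 powr (1/p - 1))) * L powr (1/p)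
          = (C * L powr (1/p)) * K"
          using False by (simp add: C_def r_def mult_ac)
        finally show ?thesis .
      qed
    qed (use C n in auto)
    also have "\<dots> = ennreal C * tent_norm M p q s f * tent_inf_norm M (hconj q) (-s) (delta 1 p) g"
      unfolding fn n(1) using C n by (simp add: ennreal_mult)
    finally show ?thesis .
  qed
  then show ?thesis using C by blast
qed

end

section \<open>Representation of functionals\<close>

lemma measurable_cnj [measurable (raw)]:
  assumes "f \<in> borel_measurable N"
  shows "(\<lambda>x. cnj (f x)) \<in> borel_measurable N"
  by (rule borel_measurable_continuous_on[OF _ assms]) (intro continuous_intros)

lemma cnj_sgn_mult: "cnj (sgn z) * z = complex_of_real (cmod z)"
  by (simp add: sgn_div_norm scaleR_conv_of_real mult.assoc complex_norm_square[symmetric]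
      power2_eq_square mult.commute[of "cnj z"] field_simps)

text \<open>Dividing by \<open>J powr (1/q)\<close> leaves \<open>J powr (1/r)\<close>. The division
  needs a finite \<open>J\<close>, which is why the test functions below are truncated.\<close>

lemma ennreal_le_powr_self_bound:
  fixes J K q r :: real
  assumes "1 < q" "1/q + 1/r = 1" "0 \<le> J" "0 \<le> K" "J \<le> K * J powr (1/q)"
  shows "J \<le> K powr r"
proof (cases "J = 0")
  case False
  have "0 < 1/q" "1/q < 1" using assms by auto
  then have "0 < 1/r" using assms by linarith
  then have r: "0 < r" by simp
  have J: "0 < J" using assms False by simp
  have "J powr (1/r) * J powr (1/q) = J"
    unfolding powr_add[symmetric] using assms J by (simp add: add.commute)
  then have "J powr (1/r) * J powr (1/q) \<le> K * J powr (1/q)" using assms by simp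
  then have "J powr (1/r) \<le> K" using J by simp
  then have "(J powr (1/r)) powr r \<le> K powr r" using r by (intro powr_mono2) auto
  then show ?thesis using r J by (simp add: powr_powr)
qed simp

context doubling_space
begin

definition tent_fun :: "real \<Rightarrow> real \<Rightarrow> ('a \<times> real \<Rightarrow> complex) \<Rightarrow> bool" where
  "tent_fun p q F \<longleftrightarrow> F \<in> borel_measurable N \<and> tent_int M (p/q) (\<lambda>z. cmod (F z) powr q) < \<infinity>"

text \<open>\<open>Gc\<close> plays the role of the conjugate of \<open>Vmul M s g\<close>.
  Restricting to functions below a multiple of \<open>k\<close> makes convergence of the integral
  part of the assertion, before any norm bound on \<open>Gc\<close> is known.\<close>

definition represents_below ::
    "(('a \<times> real \<Rightarrow> complex) \<Rightarrow> complex) \<Rightarrow> ('a \<times> real \<Rightarrow> real) \<Rightarrow> ('a \<times> real \<Rightarrow> complex) \<Rightarrow> bool" where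
  "represents_below \<psi> k Gc \<longleftrightarrow>
    (\<forall>F c. F \<in> borel_measurable N \<longrightarrow> (\<forall>z. cmod (F z) \<le> c * k z) \<longrightarrow>
       integrable N (\<lambda>z. F z * Gc z) \<and> \<psi> F = (\<integral>z. F z * Gc z \<partial>N))"

lemma represents_belowD:
  assumes "represents_below \<psi> k Gc" "F \<in> borel_measurable N" "\<And>z. cmod (F z) \<le> c * k z"
  shows "integrable N (\<lambda>z. F z * Gc z)" "\<psi> F = (\<integral>z. F z * Gc z \<partial>N)"
  using assms unfolding represents_below_def by blast+

lemma tent_fun_dominated:
  assumes "0 < p" "1 \<le> q" and H: "tent_fun p q H" and F: "F \<in> borel_measurable N"
    and le: "\<And>z. cmod (F z) \<le> c * cmod (H z)" and c: "0 \<le> c"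
  shows "tent_fun p q F"
proof -
  have [measurable]: "H \<in> borel_measurable N" using H by (simp add: tent_fun_def)
  have "tent_int M (p/q) (\<lambda>z. cmod (F z) powr q) \<le> tent_int M (p/q) (\<lambda>z. c powr q * cmod (H z) powr q)"
  proof (rule tent_int_mono)
    show "cmod (F z) powr q \<le> c powr q * cmod (H z) powr q" for z
      using powr_mono2[OF _ norm_ge_zero le[of z], of q] assms by (simp add: powr_mult)
  qed (use assms in auto)
  also have "\<dots> = ennreal ((c powr q) powr (p/q)) * tent_int M (p/q) (\<lambda>z. cmod (H z) powr q)"
    by (rule tent_int_cmult) auto
  also have "\<dots> < \<infinity>" using H by (simp add: tent_fun_def ennreal_mult_less_top)
  finally show ?thesis using F by (simp add: tent_fun_def)
qed

end

text \<open>\<psi> is the given functional transported to weight s = 0 by multiplication with V^s,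
  and \<open>K\<close> bounds its norm.\<close>

locale tent_functional = doubling_space M D
  for M :: "('a::{metric_space, second_countable_topology}) measure" and D :: real +
  fixes p q K :: real and \<psi> :: "('a \<times> real \<Rightarrow> complex) \<Rightarrow> complex"
  assumes p: "0 < p" "p < 1" and q: "1 \<le> q" and K: "0 \<le> K"
    and add: "\<And>F H. tent_fun p q F \<Longrightarrow> tent_fun p q H \<Longrightarrow> \<psi> (\<lambda>z. F z + H z) = \<psi> F + \<psi> H"
    and scale: "\<And>F c. tent_fun p q F \<Longrightarrow> \<psi> (\<lambda>z. c * F z) = c * \<psi> F"
    and bound: "\<And>F. tent_fun p q F \<Longrightarrow>
      ennreal (cmod (\<psi> F)) \<le> ennreal K * enn_powr (tent_int M (p/q) (\<lambda>z. cmod (F z) powr q)) (1/p)"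
begin

lemmas dominated = tent_fun_dominated[OF p(1) q]

section \<open>From a functional to a density\<close>

text \<open>Dominated pointwise convergence implies convergence in the quasi-norm, and the
  functional is continuous for it. This yields countable additivity, the passage from simple to
  bounded functions, and the final extension.\<close>

lemma functional_dominated_convergence:
  fixes F :: "nat \<Rightarrow> 'a \<times> real \<Rightarrow> complex"
  assumes H: "tent_fun p q H" and F [measurable]: "\<And>n. F n \<in> borel_measurable N" "F' \<in> borel_measurable N"
    and le: "\<And>n z. cmod (F n z) \<le> cmod (H z)" "\<And>z. cmod (F' z) \<le> cmod (H z)"
    and lim: "\<And>z. (\<lambda>n. F n z) \<longlonglongrightarrow> F' z"
  shows "(\<lambda>n. \<psi> (F n)) \<longlonglongrightarrow> \<psi> F'"
proof -
  have [measurable]: "H \<in> borel_measurable N" using H by (simp add: tent_fun_def)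
  have \<theta>: "0 < p/q" using p q by simp
  have TF: "tent_fun p q (F n)" "tent_fun p q F'" for n
    using dominated[OF H F(1), of n 1] dominated[OF H F(2), of 1] le by simp_all
  have Td: "tent_fun p q (\<lambda>z. F n z - F' z)" for n
  proof (rule dominated[OF H, where c=2])
    show "cmod (F n z - F' z) \<le> 2 * cmod (H z)" for z
      using norm_triangle_ineq4[of "F n z" "F' z"] le(1)[of n z] le(2)[of z] by linarith
  qed (use F in auto)
  have T2: "tent_fun p q (\<lambda>z. 2 * H z)"
  proof (rule dominated[OF H, where c=2])
    show "(\<lambda>z. 2 * H z) \<in> borel_measurable N" by measurable
  qed (simp_all add: norm_mult)
  have "(\<lambda>n. tent_int M (p/q) (\<lambda>z. cmod (F n z - F' z) powr q)) \<longlonglongrightarrow> 0"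
  proof (rule tent_int_tendsto_0[where w="\<lambda>z. cmod (2 * H z) powr q"])
    show "cmod (F n z - F' z) powr q \<le> cmod (2 * H z) powr q" for n z
      using norm_triangle_ineq4[of "F n z" "F' z"] le(1)[of n z] le(2)[of z] q
      by (intro powr_mono2) (auto simp: norm_mult)
    show "tent_int M (p/q) (\<lambda>z. cmod (2 * H z) powr q) < \<infinity>" using T2 by (simp add: tent_fun_def)
    fix z
    have "(\<lambda>n. cmod (F n z - F' z)) \<longlonglongrightarrow> 0"
      using lim[of z] by (simp add: LIM_zero tendsto_norm_zero)
    then have "(\<lambda>n. cmod (F n z - F' z) powr q) \<longlonglongrightarrow> 0 powr q"
      using q by (intro tendsto_powr2) auto
    then show "(\<lambda>n. cmod (F n z - F' z) powr q) \<longlonglongrightarrow> 0" using q by simp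
  next
    show "(\<lambda>z. cmod (F n z - F' z) powr q) \<in> borel_measurable N" for n by measurable
    show "(\<lambda>z. cmod (2 * H z) powr q) \<in> borel_measurable N" by measurable
    show "0 < p/q" by (rule \<theta>)
  qed
  then have lim0: "(\<lambda>n. ennreal K * enn_powr (tent_int M (p/q) (\<lambda>z. cmod (F n z - F' z) powr q)) (1/p)) \<longlonglongrightarrow> ennreal K * 0"
    using p by (intro tendsto_mult_ennreal tendsto_const enn_powr_tendsto_0) auto
  have "(\<lambda>n. ennreal (cmod (\<psi> (\<lambda>z. F n z - F' z)))) \<longlonglongrightarrow> 0"
  proof (rule tendsto_sandwich[OF _ _ tendsto_const])
    show "\<forall>\<^sub>F n in sequentially. ennreal (cmod (\<psi> (\<lambda>z. F n z - F' z)))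
      \<le> ennreal K * enn_powr (tent_int M (p/q) (\<lambda>z. cmod (F n z - F' z) powr q)) (1/p)"
      by (intro always_eventually allI bound Td)
    show "(\<lambda>n. ennreal K * enn_powr (tent_int M (p/q) (\<lambda>z. cmod (F n z - F' z) powr q)) (1/p)) \<longlonglongrightarrow> 0"
      using lim0 by simp
  qed simp
  then have "(\<lambda>n. \<psi> (\<lambda>z. F n z - F' z)) \<longlonglongrightarrow> 0"
    by (simp add: ennreal_tendsto_0_iff tendsto_norm_zero_iff)
  then have "(\<lambda>n. \<psi> (\<lambda>z. F n z - F' z) + \<psi> F') \<longlonglongrightarrow> 0 + \<psi> F'"
    by (intro tendsto_add tendsto_const)
  moreover have "\<psi> (\<lambda>z. F n z - F' z) + \<psi> F' = \<psi> (F n)" for n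
    using add[OF Td TF(2), of n] by simp
  ultimately show ?thesis by simp
qed

text \<open>The hypothesis on all partial sums keeps each of them in the space by solidity, so
  closure under addition of a quasi-normed space need not be invoked.\<close>

lemma functional_sum:
  assumes "finite Y" "\<And>y. y \<in> Y \<Longrightarrow> tent_fun p q (f y)" "tent_fun p q H"
    "\<And>z Z. Z \<subseteq> Y \<Longrightarrow> cmod (\<Sum>y\<in>Z. f y z) \<le> c * cmod (H z)" "0 \<le> c"
  shows "\<psi> (\<lambda>z. \<Sum>y\<in>Y. f y z) = (\<Sum>y\<in>Y. \<psi> (f y))"
  using assms(1,2,4)
proof (induction Y rule: finite_induct)
  case empty
  have "\<psi> (\<lambda>z. 0 * H z) = 0 * \<psi> H" by (rule scale[OF assms(3)])
  then show ?case by simp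
next
  case (insert y Y)
  have m: "(\<lambda>z. \<Sum>y\<in>Y. f y z) \<in> borel_measurable N"
    using insert.prems(1) by (intro borel_measurable_sum) (auto simp: tent_fun_def)
  have "tent_fun p q (\<lambda>z. \<Sum>y\<in>Y. f y z)"
    by (rule dominated[OF assms(3) m insert.prems(2) assms(5)]) auto
  then have "\<psi> (\<lambda>z. f y z + (\<Sum>y\<in>Y. f y z)) = \<psi> (f y) + \<psi> (\<lambda>z. \<Sum>y\<in>Y. f y z)"
    by (intro add insert.prems(1)) auto
  also have "\<psi> (\<lambda>z. \<Sum>y\<in>Y. f y z) = (\<Sum>y\<in>Y. \<psi> (f y))"
    using insert.prems by (intro insert.IH) (auto simp: subset_insertI2)
  finally show ?case using insert.hyps by simp
qed

text \<open>Testing the functional on \<open>k\<close> times indicators, for one fixed positive \<open>k\<close>, already yields a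
  complex measure on all of the upper half space, so no exhaustion and gluing is needed.\<close>

lemma functional_representation:
  obtains k :: "'a \<times> real \<Rightarrow> real" and Gc :: "'a \<times> real \<Rightarrow> complex"
  where "k \<in> borel_measurable N" "\<And>z. 0 < k z" "Gc \<in> borel_measurable N"
    "represents_below \<psi> k Gc"
proof -
  have \<theta>: "0 < p/q" "p/q < 1" using p q by auto
  obtain w :: "'a \<times> real \<Rightarrow> real" where w [measurable]: "w \<in> borel_measurable N"
    and w_pos: "\<And>z. 0 < w z" and w_fin: "tent_int M (p/q) w < \<infinity>"
    using positive_tent_function[OF \<theta>] by blast
  \<comment> \<open>The root is chosen so that the \<open>q\<close>-th power of \<open>k\<close> is
    \<open>w\<close>, which is the function entering \<open>tent_int\<close>.\<close>
  define k where "k z = w z powr (1/q)" for z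
  have k [measurable]: "k \<in> borel_measurable N" unfolding k_def by measurable
  have k_pos: "0 < k z" for z using w_pos[of z] by (simp add: k_def)
  have kq: "k z powr q = w z" for z using w_pos[of z] q by (simp add: k_def powr_powr)
  let ?k = "\<lambda>z. complex_of_real (k z)"
  have ck_meas: "?k \<in> borel_measurable N" by measurable
  have ck: "cmod (?k z) = k z" for z using k_pos[of z] by simp
  have Tk: "tent_fun p q ?k" using w_fin by (simp add: tent_fun_def ck kq del: norm_of_real)
  have Tind: "tent_fun p q (\<lambda>z. indicator E z * ?k z)" if [measurable]: "E \<in> sets N" for E
    by (rule dominated[OF Tk, where c=1]) (auto simp: indicator_def)
  define \<nu> where "\<nu> E = \<psi> (\<lambda>z. indicator E z * ?k z)" for E
  have ca: "(\<lambda>i. \<nu> (A i)) sums \<nu> (\<Union>i. A i)" if A: "range A \<subseteq> sets N" "disjoint_family A" for A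
  proof -
    have [measurable]: "A i \<in> sets N" for i using A by auto
    have "(\<lambda>n. \<psi> (\<lambda>z. indicator (\<Union>i<n. A i) z * ?k z)) \<longlonglongrightarrow> \<psi> (\<lambda>z. indicator (\<Union>i. A i) z * ?k z)"
    proof (rule functional_dominated_convergence[OF Tk])
      fix z
      show "(\<lambda>n. indicator (\<Union>i<n. A i) z * ?k z) \<longlonglongrightarrow> indicator (\<Union>i. A i) z * ?k z"
        by (intro tendsto_mult tendsto_const LIMSEQ_indicator_UN)
    qed (auto simp: indicator_def)
    moreover have "\<psi> (\<lambda>z. indicator (\<Union>i<n. A i) z * ?k z) = (\<Sum>i<n. \<nu> (A i))" for n
    proof (induction n)
      case 0
      have "\<psi> (\<lambda>z. 0 * ?k z) = 0 * \<psi> ?k" by (rule scale[OF Tk])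
      then show ?case by simp
    next
      case (Suc n)
      have "(\<lambda>z. indicator (\<Union>i<Suc n. A i) z * ?k z) = (\<lambda>z. indicator (\<Union>i<n. A i) z * ?k z + indicator (A n) z * ?k z)"
      proof
        fix z
        have "\<not> (z \<in> (\<Union>i<n. A i) \<and> z \<in> A n)"
          using A(2) by (auto simp: disjoint_family_on_def) (metis IntI empty_iff less_irrefl)
        then show "indicator (\<Union>i<Suc n. A i) z * ?k z = indicator (\<Union>i<n. A i) z * ?k z + indicator (A n) z * ?k z"
          by (auto simp: indicator_def less_Suc_eq)
      qed
      then show ?case using add[OF Tind Tind, of "\<Union>i<n. A i" "A n"] Suc by (simp add: \<nu>_def)
    qed
    ultimately show ?thesis unfolding sums_def by (simp add: \<nu>_def[of "\<Union>i. A i"])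
  qed
  have ac: "\<nu> E = 0" if E: "E \<in> null_sets N" for E
  proof -
    have [measurable]: "E \<in> sets N" using E by auto
    have "cone_int M (\<lambda>z. cmod (indicator E z * ?k z) powr q) x = 0" for x
    proof -
      have "AE z in N. z \<notin> E" using E by (rule AE_not_in)
      then show ?thesis unfolding cone_int_def
        by (subst nn_integral_0_iff_AE) (auto simp: indicator_cone elim!: eventually_mono)
    qed
    then have "tent_int M (p/q) (\<lambda>z. cmod (indicator E z * ?k z) powr q) = 0"
      unfolding tent_int_def by simp
    then have "ennreal (cmod (\<nu> E)) \<le> 0"
      using bound[OF Tind, of E] unfolding \<nu>_def by simp
    then show ?thesis by simp
  qed
  have bd: "\<exists>K'. \<forall>E\<in>sets N. cmod (\<nu> E) \<le> K'"
  proof -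
    define T where "T = ennreal K * enn_powr (tent_int M (p/q) w) (1/p)"
    have T: "T < \<infinity>" using w_fin by (simp add: T_def ennreal_mult_less_top)
    have "cmod (\<nu> E) \<le> enn2real T" if [measurable]: "E \<in> sets N" for E
    proof -
      have "ennreal (cmod (\<nu> E)) \<le> ennreal K * enn_powr (tent_int M (p/q) (\<lambda>z. cmod (indicator E z * ?k z) powr q)) (1/p)"
        using bound[OF Tind, of E] by (simp add: \<nu>_def)
      also have "\<dots> \<le> T" unfolding T_def
      proof (intro mult_left_mono enn_powr_mono tent_int_mono)
        show "cmod (indicator E z * ?k z) powr q \<le> w z" for z
          using kq[of z] k_pos[of z] w_pos[of z] by (auto simp: indicator_def)
      qed (use p q in auto)
      finally show ?thesis using T by (cases T) (auto simp: ennreal_le_iff)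
    qed
    then show ?thesis by blast
  qed
  then obtain K' where K': "\<And>E. E \<in> sets N \<Longrightarrow> cmod (\<nu> E) \<le> K'" by blast
  obtain hr where hr: "integrable N hr" "\<And>E. E \<in> sets N \<Longrightarrow> Re (\<nu> E) = (\<integral>z. indicator E z * hr z \<partial>N)"
  proof (rule signed_Radon_Nikodym[OF sigma_finite_N, of "\<lambda>E. Re (\<nu> E)" K'])
    show "\<bar>Re (\<nu> E)\<bar> \<le> K'" if "E \<in> sets N" for E using K'[OF that] abs_Re_le_cmod[of "\<nu> E"] by linarith
  qed (use ca sums_Re ac in auto)
  obtain hi where hi: "integrable N hi" "\<And>E. E \<in> sets N \<Longrightarrow> Im (\<nu> E) = (\<integral>z. indicator E z * hi z \<partial>N)"
  proof (rule signed_Radon_Nikodym[OF sigma_finite_N, of "\<lambda>E. Im (\<nu> E)" K'])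
    show "\<bar>Im (\<nu> E)\<bar> \<le> K'" if "E \<in> sets N" for E using K'[OF that] abs_Im_le_cmod[of "\<nu> E"] by linarith
  qed (use ca sums_Im ac in auto)
  define h where "h z = complex_of_real (hr z) + \<i> * complex_of_real (hi z)" for z
  have h: "integrable N h" unfolding h_def using hr(1) hi(1) by simp
  have [measurable]: "h \<in> borel_measurable N" using h by simp
  have h_mult: "integrable N (\<lambda>z. \<sigma> z * h z)"
    if [measurable]: "\<sigma> \<in> borel_measurable N" and "\<And>z. cmod (\<sigma> z) \<le> c" for \<sigma> c
  proof (rule Bochner_Integration.integrable_bound)
    show "integrable N (\<lambda>z. complex_of_real c * h z)" using h by simp
    show "AE z in N. norm (\<sigma> z * h z) \<le> norm (complex_of_real c * h z)"
      using that(2) by (intro AE_I2) (auto simp: norm_mult intro!: mult_right_mono abs_ge_self[THEN order_trans[rotated]])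
  qed measurable
  have \<nu>_eq: "\<nu> E = (\<integral>z. indicator E z * h z \<partial>N)" if [measurable]: "E \<in> sets N" for E
  proof -
    have i: "integrable N (\<lambda>z. indicator E z * h z)"
      by (rule h_mult[where c=1]) (auto simp: indicator_def)
    show ?thesis
    proof (rule complex_eqI)
      have "Re (\<integral>z. indicator E z * h z \<partial>N) = (\<integral>z. Re (indicator E z * h z) \<partial>N)" by (rule integral_Re[OF i, symmetric])
      also have "\<dots> = (\<integral>z. indicator E z * hr z \<partial>N)"
        by (intro Bochner_Integration.integral_cong) (auto simp: h_def indicator_def)
      finally show "Re (\<nu> E) = Re (\<integral>z. indicator E z * h z \<partial>N)" using hr(2)[OF that] by simp
      have "Im (\<integral>z. indicator E z * h z \<partial>N) = (\<integral>z. Im (indicator E z * h z) \<partial>N)" by (rule integral_Im[OF i, symmetric])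
      also have "\<dots> = (\<integral>z. indicator E z * hi z \<partial>N)"
        by (intro Bochner_Integration.integral_cong) (auto simp: h_def indicator_def)
      finally show "Im (\<nu> E) = Im (\<integral>z. indicator E z * h z \<partial>N)" using hi(2)[OF that] by simp
    qed
  qed
  have simple: "\<psi> (\<lambda>z. \<sigma> z * ?k z) = (\<integral>z. \<sigma> z * h z \<partial>N)"
    if \<sigma>: "simple_function N \<sigma>" and \<sigma>_le: "\<And>z. cmod (\<sigma> z) \<le> c" for \<sigma> c
  proof -
    let ?Y = "range \<sigma>" and ?E = "\<lambda>y. \<sigma> -` {y}"
    have fin: "finite ?Y" using simple_functionD(1)[OF \<sigma>] by simp
    have E [measurable]: "?E y \<in> sets N" for y using simple_functionD(2)[OF \<sigma>, of "{y}"] by simp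
    have part: "(\<Sum>y\<in>Z. y * indicator (?E y) z) = (if \<sigma> z \<in> Z then \<sigma> z else 0)" if "finite Z" for Z z
    proof -
      have "(\<Sum>y\<in>Z. y * indicator (?E y) z) = (\<Sum>y\<in>Z. if y = \<sigma> z then \<sigma> z else 0)"
        by (intro sum.cong) (auto simp: indicator_def)
      then show ?thesis using that by simp
    qed
    have dec: "\<sigma> z * v = (\<Sum>y\<in>?Y. y * (indicator (?E y) z * v))" for z v
      using part[OF fin, of z] by (simp add: sum_distrib_right[symmetric] mult.assoc[symmetric])
    have "\<psi> (\<lambda>z. \<sigma> z * ?k z) = \<psi> (\<lambda>z. \<Sum>y\<in>?Y. y * (indicator (?E y) z * ?k z))"
      using dec by simp
    also have "\<dots> = (\<Sum>y\<in>?Y. \<psi> (\<lambda>z. y * (indicator (?E y) z * ?k z)))"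
    proof (rule functional_sum[OF fin _ Tk, where c = c])
      show "tent_fun p q (\<lambda>z. y * (indicator (?E y) z * ?k z))" for y
      proof (rule dominated[OF Tk, where c="cmod y"])
        show "(\<lambda>z. y * (indicator (?E y) z * ?k z)) \<in> borel_measurable N"
          by (intro borel_measurable_times borel_measurable_const borel_measurable_indicator E ck_meas)
      qed (auto simp: norm_mult indicator_def)
      show c: "0 \<le> c" using \<sigma>_le[of undefined] norm_ge_zero order_trans by blast
      fix z Z assume "Z \<subseteq> ?Y"
      then have "finite Z" using fin by (rule finite_subset)
      then have "(\<Sum>y\<in>Z. y * (indicator (?E y) z * ?k z)) = (if \<sigma> z \<in> Z then \<sigma> z else 0) * ?k z"
        using part by (simp add: sum_distrib_right[symmetric] mult.assoc[symmetric])
      then show "cmod (\<Sum>y\<in>Z. y * (indicator (?E y) z * ?k z)) \<le> c * cmod (?k z)"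
        using \<sigma>_le[of z] c by (auto simp: norm_mult intro!: mult_right_mono)
    qed
    also have "\<dots> = (\<Sum>y\<in>?Y. y * \<nu> (?E y))"
      by (intro sum.cong refl) (simp add: scale[OF Tind] \<nu>_def)
    also have "\<dots> = (\<Sum>y\<in>?Y. (\<integral>z. y * (indicator (?E y) z * h z) \<partial>N))"
      by (simp add: \<nu>_eq)
    also have "\<dots> = (\<integral>z. (\<Sum>y\<in>?Y. y * (indicator (?E y) z * h z)) \<partial>N)"
    proof (rule Bochner_Integration.integral_sum[symmetric])
      show "integrable N (\<lambda>z. y * (indicator (?E y) z * h z))" for y
      proof -
        have "integrable N (\<lambda>z. y * indicator (?E y) z * h z)"
        proof (rule h_mult)
          show "(\<lambda>z. y * indicator (?E y) z) \<in> borel_measurable N"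
            by (intro borel_measurable_times borel_measurable_const borel_measurable_indicator E)
          show "cmod (y * indicator (?E y) z) \<le> cmod y" for z by (simp add: norm_mult indicator_def)
        qed
        then show ?thesis by (simp only: mult.assoc)
      qed
    qed
    also have "\<dots> = (\<integral>z. \<sigma> z * h z \<partial>N)" using dec by simp
    finally show ?thesis .
  qed
  have bounded: "\<psi> (\<lambda>z. \<sigma> z * ?k z) = (\<integral>z. \<sigma> z * h z \<partial>N)"
    if \<sigma> [measurable]: "\<sigma> \<in> borel_measurable N" and \<sigma>_le: "\<And>z. cmod (\<sigma> z) \<le> c" for \<sigma> c
  proof -
    have c: "0 \<le> c" using \<sigma>_le[of undefined] norm_ge_zero order_trans by blast
    \<comment> \<open>The approximants are bounded by twice the modulus of the limit, hence the
      majorant 2c in both dominated convergences.\<close>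
    obtain s where s: "\<And>i. simple_function N (s i)" "\<And>z. (\<lambda>i. s i z) \<longlonglongrightarrow> \<sigma> z"
      "\<And>i z. cmod (s i z) \<le> 2 * cmod (\<sigma> z)"
      using borel_measurable_implies_sequence_metric[OF \<sigma>, of 0] by (auto simp: dist_norm)
    have [measurable]: "s i \<in> borel_measurable N" for i using s(1) by (rule borel_measurable_simple_function)
    have s_le: "cmod (s i z) \<le> 2 * c" for i z using s(3)[of i z] \<sigma>_le[of z] by linarith
    have "(\<lambda>i. \<psi> (\<lambda>z. s i z * ?k z)) \<longlonglongrightarrow> \<psi> (\<lambda>z. \<sigma> z * ?k z)"
    proof (rule functional_dominated_convergence)
      show "tent_fun p q (\<lambda>z. 2 * complex_of_real c * ?k z)"
        by (rule dominated[OF Tk, where c="2 * c"]) (use c in \<open>auto simp: norm_mult\<close>)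
      show "cmod (s n z * ?k z) \<le> cmod (2 * complex_of_real c * ?k z)" for n z
        using s_le[of n z] c by (auto simp: norm_mult intro!: mult_right_mono)
      show "cmod (\<sigma> z * ?k z) \<le> cmod (2 * complex_of_real c * ?k z)" for z
        using \<sigma>_le[of z] c by (auto simp: norm_mult intro!: mult_right_mono)
    qed (auto intro!: tendsto_intros s)
    moreover have "(\<lambda>i. \<integral>z. s i z * h z \<partial>N) \<longlonglongrightarrow> (\<integral>z. \<sigma> z * h z \<partial>N)"
    proof (rule integral_dominated_convergence[where w="\<lambda>z. 2 * c * cmod (h z)"])
      show "integrable N (\<lambda>z. 2 * c * cmod (h z))" using h by simp
      show "AE z in N. (\<lambda>i. s i z * h z) \<longlonglongrightarrow> \<sigma> z * h z" by (intro AE_I2 tendsto_intros s)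
      show "AE z in N. cmod (s i z * h z) \<le> 2 * c * cmod (h z)" for i
        using s_le by (intro AE_I2) (auto simp: norm_mult intro!: mult_right_mono)
    qed measurable
    moreover have "\<psi> (\<lambda>z. s i z * ?k z) = (\<integral>z. s i z * h z \<partial>N)" for i
      using simple[OF s(1) s_le] .
    ultimately show ?thesis by (simp add: LIMSEQ_unique)
  qed
  show ?thesis
  \<comment> \<open>\<open>h\<close> is the density of the measure that already contains the factor
    \<open>k\<close>; dividing removes it again.\<close>
  proof (rule that[of k "\<lambda>z. h z / ?k z"])
    show "represents_below \<psi> k (\<lambda>z. h z / ?k z)"
      unfolding represents_below_def
    proof (intro allI impI)
      fix F :: "'a \<times> real \<Rightarrow> complex" and c
      assume [measurable]: "F \<in> borel_measurable N" and F: "\<forall>z. cmod (F z) \<le> c * k z"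
      have le: "cmod (F z / ?k z) \<le> c" for z
        using F[rule_format, of z] k_pos[of z] by (simp add: norm_divide divide_le_eq)
      have eq: "F z / ?k z * h z = F z * (h z / ?k z)" "F z / ?k z * ?k z = F z" for z
        using k_pos[of z] by auto
      have m: "(\<lambda>z. F z / ?k z) \<in> borel_measurable N" by measurable
      show "integrable N (\<lambda>z. F z * (h z / ?k z)) \<and> \<psi> F = (\<integral>z. F z * (h z / ?k z) \<partial>N)"
        using h_mult[OF m le] bounded[OF m le] unfolding eq by simp
    qed
  qed (auto simp: k_pos)
qed

lemma tent_localized_norm:
  assumes [measurable]: "F \<in> borel_measurable N" and F: "\<And>z. z \<notin> tent (ball y \<rho>) \<Longrightarrow> F z = 0"
    and J: "(\<integral>\<^sup>+z. ennreal (cmod (F z) powr q) \<partial>N) = ennreal J" "0 \<le> J"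
  shows "tent_fun p q F" "cmod (\<psi> F) \<le> K * (Vol M y \<rho> powr (1/p - 1/q) * J powr (1/q))"
proof -
  have le: "tent_int M (p/q) (\<lambda>z. cmod (F z) powr q) \<le> ennreal (Vol M y \<rho> powr (1 - p/q) * J powr (p/q))"
    using p q F J by (intro tent_int_localized) auto
  then have "tent_int M (p/q) (\<lambda>z. cmod (F z) powr q) < \<infinity>"
    by (rule order_le_less_trans) simp
  then show T: "tent_fun p q F" by (simp add: tent_fun_def)
  have "ennreal (cmod (\<psi> F)) \<le> ennreal K * enn_powr (ennreal (Vol M y \<rho> powr (1 - p/q) * J powr (p/q))) (1/p)"
    using bound[OF T] mult_left_mono[OF enn_powr_mono[OF _ le, of "1/p"], of "ennreal K"] p
    by (auto intro: order_trans)
  also have "\<dots> = ennreal (K * (Vol M y \<rho> powr (1 - p/q) * J powr (p/q)) powr (1/p))"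
    using K by (subst enn_powr_ennreal) (auto simp only: ennreal_mult' intro!: mult_nonneg_nonneg powr_ge_zero)
  also have "(Vol M y \<rho> powr (1 - p/q) * J powr (p/q)) powr (1/p) = Vol M y \<rho> powr (1/p - 1/q) * J powr (1/q)"
  proof -
    have "(1 - p/q) / p = 1/p - 1/q" using p by (simp add: field_simps)
    then show ?thesis using p J by (simp add: powr_mult powr_powr)
  qed
  finally show "cmod (\<psi> F) \<le> K * (Vol M y \<rho> powr (1/p - 1/q) * J powr (1/q))"
    using K by (simp add: ennreal_le_iff)
qed

section \<open>Carleson bounds for the representing function\<close>

text \<open>The extremal function for L^q duality on the tent is tested. As (r - 1) q = r, its L^q
  mass \<open>J\<close> is also the value of the functional, and the localized bound gives J at most
  a constant times J^(1/q). Truncation to \<open>E n\<close> keeps the test function below n k,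
  which both permits the representation and makes \<open>J\<close> finite; monotone convergence
  removes it.\<close>

lemma representer_bound_gt_1:
  assumes q1: "1 < q" "1/q + 1/r = 1"
    and k [measurable]: "k \<in> borel_measurable N" and k_pos: "\<And>z. 0 < k z" and Gc [measurable]: "Gc \<in> borel_measurable N"
    and rep: "represents_below \<psi> k Gc"
  shows "(\<integral>\<^sup>+z. indicator (tent (ball y \<rho>)) z * ennreal (cmod (Gc z) powr r) \<partial>N)
    \<le> ennreal ((K * Vol M y \<rho> powr (1/p - 1 + 1/r)) powr r)"
proof -
  let ?T = "tent (ball y \<rho>)"
  have r: "1 < r" "r = (r - 1) * q"
  proof -
    have "0 < 1/q" "1/q < 1" using q1 by auto
    then have "0 < 1/r" "1/r < 1" using q1 by linarith+
    then show r: "1 < r" by (simp add: field_simps split: if_splits)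
    have "(1/q + 1/r) * (q * r) = q * r" using q1 by simp
    then have "r + q = q * r" using q1 r by (simp add: field_simps)
    then show "r = (r - 1) * q" by (simp add: algebra_simps)
  qed
  define E where "E n = {z. cmod (Gc z) powr (r - 1) \<le> real n * k z}" for n
  have [measurable]: "E n \<in> sets N" for n
  proof -
    have "{z\<in>space N. cmod (Gc z) powr (r - 1) \<le> real n * k z} \<in> sets N" by measurable
    then show ?thesis by (simp add: E_def)
  qed
  let ?b = "K * Vol M y \<rho> powr (1/p - 1/q)"
  have step: "(\<integral>\<^sup>+z. indicator (?T \<inter> E n) z * ennreal (cmod (Gc z) powr r) \<partial>N) \<le> ennreal (?b powr r)" for n
  proof -
    define F where "F z = indicator (?T \<inter> E n) z * (cnj (sgn (Gc z)) * complex_of_real (cmod (Gc z) powr (r - 1)))" for z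
    have [measurable]: "F \<in> borel_measurable N" unfolding F_def sgn_div_norm by measurable
    have cF: "cmod (F z) = indicator (?T \<inter> E n) z * cmod (Gc z) powr (r - 1)" for z
      by (cases "Gc z = 0") (auto simp: F_def norm_mult norm_sgn indicator_def)
    have FG: "F z * Gc z = complex_of_real (indicator (?T \<inter> E n) z * cmod (Gc z) powr r)" for z
    proof (cases "Gc z = 0")
      case False
      have pow: "cmod (Gc z) * cmod (Gc z) powr (r - 1) = cmod (Gc z) powr r"
        using False by (simp add: powr_mult_base)
      have "F z * Gc z = indicator (?T \<inter> E n) z * ((cnj (sgn (Gc z)) * Gc z) * complex_of_real (cmod (Gc z) powr (r - 1)))"
        by (simp add: F_def mult_ac)
      also have "\<dots> = indicator (?T \<inter> E n) z * complex_of_real (cmod (Gc z) powr r)"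
        unfolding cnj_sgn_mult of_real_mult[symmetric] pow ..
      finally show ?thesis by (simp add: indicator_def)
    qed (simp add: F_def)
    have Fk: "cmod (F z) \<le> real n * k z" for z
      using k_pos[of z] by (auto simp: cF E_def indicator_def)
    have R: "integrable N (\<lambda>z. F z * Gc z)" "\<psi> F = (\<integral>z. F z * Gc z \<partial>N)"
      using represents_belowD[OF rep _ Fk] by auto
    define J where "J = (\<integral>z. indicator (?T \<inter> E n) z * cmod (Gc z) powr r \<partial>N)"
    have int: "integrable N (\<lambda>z. indicator (?T \<inter> E n) z * cmod (Gc z) powr r)"
      using R(1) unfolding FG by (simp only: complex_of_real_integrable_eq)
    have J: "0 \<le> J" unfolding J_def by (intro Bochner_Integration.integral_nonneg) auto
    have nJ: "(\<integral>\<^sup>+z. ennreal (indicator (?T \<inter> E n) z * cmod (Gc z) powr r) \<partial>N) = ennreal J"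
      unfolding J_def by (rule nn_integral_eq_integral[OF int]) auto
    have "\<psi> F = complex_of_real J" unfolding R(2) FG J_def by (rule integral_complex_of_real)
    then have \<psi>J: "cmod (\<psi> F) = J" using J by simp
    have "(\<integral>\<^sup>+z. ennreal (cmod (F z) powr q) \<partial>N) = ennreal J"
      unfolding nJ[symmetric]
    proof (rule nn_integral_cong)
      fix z
      have "(cmod (Gc z) powr (r - 1)) powr q = cmod (Gc z) powr r"
        using r(2) by (simp add: powr_powr)
      then show "ennreal (cmod (F z) powr q) = ennreal (indicator (?T \<inter> E n) z * cmod (Gc z) powr r)"
        using q1 by (auto simp: cF indicator_def)
    qed
    then have "cmod (\<psi> F) \<le> K * (Vol M y \<rho> powr (1/p - 1/q) * J powr (1/q))"
      using J by (intro tent_localized_norm) (auto simp: F_def)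
    then have "J \<le> ?b powr r"
      unfolding \<psi>J using K J q1 by (intro ennreal_le_powr_self_bound[of q r]) (auto simp: mult_ac)
    then have "ennreal J \<le> ennreal (?b powr r)" by (rule ennreal_leI)
    moreover have "(\<integral>\<^sup>+z. indicator (?T \<inter> E n) z * ennreal (cmod (Gc z) powr r) \<partial>N) = ennreal J"
      unfolding nJ[symmetric] by (intro nn_integral_cong) (auto simp: indicator_def)
    ultimately show ?thesis by simp
  qed
  have mono: "incseq (\<lambda>n z. indicator (?T \<inter> E n) z * ennreal (cmod (Gc z) powr r))"
  proof (intro incseq_SucI le_funI)
    fix n z
    have "E n \<subseteq> E (Suc n)"
    proof
      fix z assume "z \<in> E n"
      moreover have "real n * k z \<le> real (Suc n) * k z" using k_pos[of z] by (intro mult_right_mono) auto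
      ultimately show "z \<in> E (Suc n)" by (simp add: E_def)
    qed
    then show "indicator (?T \<inter> E n) z * ennreal (cmod (Gc z) powr r) \<le> indicator (?T \<inter> E (Suc n)) z * ennreal (cmod (Gc z) powr r)"
      by (auto simp: indicator_def)
  qed
  have "(\<integral>\<^sup>+z. indicator ?T z * ennreal (cmod (Gc z) powr r) \<partial>N)
    = (\<integral>\<^sup>+z. (SUP n. indicator (?T \<inter> E n) z * ennreal (cmod (Gc z) powr r)) \<partial>N)"
  proof (rule nn_integral_cong)
    fix z
    obtain n where "cmod (Gc z) powr (r - 1) / k z \<le> real n" using real_arch_simple by blast
    then have "z \<in> E n" using k_pos[of z] by (simp add: E_def divide_le_eq)
    then have "indicator ?T z * ennreal (cmod (Gc z) powr r) \<le> (SUP n. indicator (?T \<inter> E n) z * ennreal (cmod (Gc z) powr r))"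
      by (intro SUP_upper2[of n]) (auto simp: indicator_def)
    moreover have "(SUP n. indicator (?T \<inter> E n) z * ennreal (cmod (Gc z) powr r)) \<le> indicator ?T z * ennreal (cmod (Gc z) powr r)"
      by (intro SUP_least) (auto simp: indicator_def)
    ultimately show "indicator ?T z * ennreal (cmod (Gc z) powr r) = (SUP n. indicator (?T \<inter> E n) z * ennreal (cmod (Gc z) powr r))"
      by simp
  qed
  also have "\<dots> = (SUP n. \<integral>\<^sup>+z. indicator (?T \<inter> E n) z * ennreal (cmod (Gc z) powr r) \<partial>N)"
    by (rule nn_integral_monotone_convergence_SUP[OF mono]) measurable
  also have "\<dots> \<le> ennreal (?b powr r)" by (intro SUP_least step)
  also have "1/p - 1/q = 1/p - 1 + 1/r" using q1 by simp
  finally show ?thesis .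
qed

text \<open>The test function is the conjugate phase of \<open>Gc\<close> on the part of the tent
  where |Gc| exceeds the claimed bound b by a margin 1/(n + 1). If m is the measure of that part,
  the functional takes a value at least (b + 1/(n+1)) m and at most b m, so m = 0. The condition 1
  \<le> n k keeps the test function below n k.\<close>

lemma representer_bound_1:
  assumes q1: "q = 1"
    and k [measurable]: "k \<in> borel_measurable N" and k_pos: "\<And>z. 0 < k z" and Gc [measurable]: "Gc \<in> borel_measurable N"
    and rep: "represents_below \<psi> k Gc"
  shows "AE z in N. z \<in> tent (ball y \<rho>) \<longrightarrow> cmod (Gc z) \<le> K * Vol M y \<rho> powr (1/p - 1)"
proof -
  let ?T = "tent (ball y \<rho>)"
  let ?b = "K * Vol M y \<rho> powr (1/p - 1)"
  define E where "E n = {z. ?b + inverse (real (Suc n)) \<le> cmod (Gc z) \<and> 1 \<le> real n * k z}" for n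
  have [measurable]: "E n \<in> sets N" for n
  proof -
    have "{z\<in>space N. ?b + inverse (real (Suc n)) \<le> cmod (Gc z) \<and> 1 \<le> real n * k z} \<in> sets N" by measurable
    then show ?thesis by (simp add: E_def)
  qed
  have b: "0 \<le> ?b" using K by simp
  have null: "AE z in N. z \<notin> ?T \<inter> E n" for n
  proof -
    define F where "F z = indicator (?T \<inter> E n) z * cnj (sgn (Gc z))" for z
    have [measurable]: "F \<in> borel_measurable N" unfolding F_def sgn_div_norm by measurable
    have pos: "0 < cmod (Gc z)" if "z \<in> E n" for z
    proof -
      have "0 < ?b + inverse (real (Suc n))" using b by (intro add_nonneg_pos) auto
      also have "\<dots> \<le> cmod (Gc z)" using that by (simp add: E_def)
      finally show ?thesis .
    qed
    have cF: "cmod (F z) = indicator (?T \<inter> E n) z" for z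
      using pos[of z] by (auto simp: F_def norm_mult norm_sgn indicator_def)
    have FG: "F z * Gc z = complex_of_real (indicator (?T \<inter> E n) z * cmod (Gc z))" for z
      by (simp add: F_def cnj_sgn_mult mult.assoc indicator_def)
    have Fk: "cmod (F z) \<le> real n * k z" for z
      using k_pos[of z] by (auto simp: cF E_def indicator_def)
    have R: "integrable N (\<lambda>z. F z * Gc z)" "\<psi> F = (\<integral>z. F z * Gc z \<partial>N)"
      using represents_belowD[OF rep _ Fk] by auto
    define J where "J = (\<integral>z. indicator (?T \<inter> E n) z * cmod (Gc z) \<partial>N)"
    have int: "integrable N (\<lambda>z. indicator (?T \<inter> E n) z * cmod (Gc z))"
      using R(1) unfolding FG by (simp only: complex_of_real_integrable_eq)
    have J: "0 \<le> J" unfolding J_def by (intro Bochner_Integration.integral_nonneg) auto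
    have nJ: "(\<integral>\<^sup>+z. ennreal (indicator (?T \<inter> E n) z * cmod (Gc z)) \<partial>N) = ennreal J"
      unfolding J_def by (rule nn_integral_eq_integral[OF int]) auto
    have "\<psi> F = complex_of_real J" unfolding R(2) FG J_def by (rule integral_complex_of_real)
    then have \<psi>J: "cmod (\<psi> F) = J" using J by simp
    let ?c = "?b + inverse (real (Suc n))"
    have "ennreal ?c * emeasure N (?T \<inter> E n) = (\<integral>\<^sup>+z. ennreal ?c * indicator (?T \<inter> E n) z \<partial>N)"
      by (simp add: nn_integral_cmult)
    also have "\<dots> \<le> (\<integral>\<^sup>+z. ennreal (indicator (?T \<inter> E n) z * cmod (Gc z)) \<partial>N)"
      by (intro nn_integral_mono) (auto simp: indicator_def E_def intro!: ennreal_leI)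
    finally have m1: "ennreal ?c * emeasure N (?T \<inter> E n) \<le> ennreal J" unfolding nJ .
    have c: "0 < ?c" using b by (intro add_nonneg_pos) auto
    \<comment> \<open>The two estimates can be subtracted only for finite measure, which Chebyshev's
      inequality with the positive level \<open>?c\<close> provides.\<close>
    have "emeasure N (?T \<inter> E n) < \<infinity>"
    proof (rule ccontr)
      assume "\<not> emeasure N (?T \<inter> E n) < \<infinity>"
      then have "emeasure N (?T \<inter> E n) = top" by (simp add: less_top[symmetric])
      then show False using m1 c by (simp add: ennreal_mult_top top_unique)
    qed
    then obtain m where m: "emeasure N (?T \<inter> E n) = ennreal m" "0 \<le> m"
      by (cases "emeasure N (?T \<inter> E n)") auto
    have "(\<integral>\<^sup>+z. ennreal (cmod (F z) powr q) \<partial>N) = (\<integral>\<^sup>+z. indicator (?T \<inter> E n) z \<partial>N)"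
      using q1 by (intro nn_integral_cong) (auto simp: cF indicator_def)
    also have "\<dots> = ennreal m" using m by simp
    finally have "cmod (\<psi> F) \<le> K * (Vol M y \<rho> powr (1/p - 1/q) * m powr (1/q))"
      using m by (intro tent_localized_norm) (auto simp: F_def)
    then have "J \<le> ?b * m" unfolding \<psi>J using q1 m by (simp add: mult_ac)
    moreover have "?c * m \<le> J"
      using m1 c m J by (simp add: ennreal_mult[symmetric] ennreal_le_iff del: of_nat_Suc)
    ultimately have "inverse (real (Suc n)) * m \<le> 0" by (simp add: distrib_right del: of_nat_Suc)
    then have "m = 0" using m(2) by (simp add: mult_le_0_iff)
    then have "?T \<inter> E n \<in> null_sets N" using m by (intro null_setsI) auto
    then show ?thesis by (rule AE_not_in)
  qed
  have "AE z in N. \<forall>n. z \<notin> ?T \<inter> E n" unfolding AE_all_countable using null by blast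
  then show ?thesis
  proof eventually_elim
    case (elim z)
    show ?case
    proof (rule impI, rule ccontr)
      assume z: "z \<in> ?T" "\<not> cmod (Gc z) \<le> ?b"
      then obtain n1 where n1: "inverse (real (Suc n1)) < cmod (Gc z) - ?b"
        using reals_Archimedean[of "cmod (Gc z) - ?b"] by auto
      obtain n2 where n2: "1 / k z \<le> real n2" using real_arch_simple by blast
      define n where "n = max n1 n2"
      have "inverse (real (Suc n)) \<le> inverse (real (Suc n1))"
        unfolding n_def by (intro le_imp_inverse_le) auto
      then have "?b + inverse (real (Suc n)) \<le> cmod (Gc z)" using n1 by linarith
      moreover have "1 \<le> real n * k z"
      proof -
        have "1 / k z \<le> real n" using n2 unfolding n_def by linarith
        then show ?thesis using k_pos[of z] by (simp add: divide_le_eq)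
      qed
      ultimately have "z \<in> E n" by (simp add: E_def)
      then show False using elim z by blast
    qed
  qed
qed

text \<open>\<open>F\<close> is cut to the sets where |F| is at most n k, which exhaust everything
  because k > 0. Both sides pass to the limit by dominated convergence, with majorants
  \<open>F\<close> on the left and |F Gc| on the right.\<close>

lemma functional_representation_extends:
  assumes k [measurable]: "k \<in> borel_measurable N" and k_pos: "\<And>z. 0 < k z" and Gc [measurable]: "Gc \<in> borel_measurable N"
    and rep: "represents_below \<psi> k Gc"
    and F: "tent_fun p q F" and int: "integrable N (\<lambda>z. F z * Gc z)"
  shows "\<psi> F = (\<integral>z. F z * Gc z \<partial>N)"
proof -
  have [measurable]: "F \<in> borel_measurable N" using F by (simp add: tent_fun_def)
  define E where "E n = {z. cmod (F z) \<le> real n * k z}" for n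
  have [measurable]: "E n \<in> sets N" for n
  proof -
    have "{z\<in>space N. cmod (F z) \<le> real n * k z} \<in> sets N" by measurable
    then show ?thesis by (simp add: E_def)
  qed
  have lim: "(\<lambda>n. indicator (E n) z * F z) \<longlonglongrightarrow> F z" for z
  proof (rule tendsto_eventually)
    obtain n where n: "cmod (F z) / k z \<le> real n" using real_arch_simple by blast
    have "z \<in> E m" if "n \<le> m" for m
    proof -
      have "cmod (F z) / k z \<le> real m" using n that by linarith
      then show ?thesis using k_pos[of z] by (simp add: E_def divide_le_eq)
    qed
    then show "\<forall>\<^sub>F n in sequentially. indicator (E n) z * F z = F z"
      unfolding eventually_sequentially by (intro exI[of _ n]) auto
  qed
  have "(\<lambda>n. \<psi> (\<lambda>z. indicator (E n) z * F z)) \<longlonglongrightarrow> \<psi> F"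
  proof (rule functional_dominated_convergence[OF F])
    show "(\<lambda>n. indicator (E n) z * F z) \<longlonglongrightarrow> F z" for z by (rule lim)
  qed (auto simp: indicator_def)
  moreover have "(\<lambda>n. \<integral>z. indicator (E n) z * F z * Gc z \<partial>N) \<longlonglongrightarrow> (\<integral>z. F z * Gc z \<partial>N)"
  proof (rule integral_dominated_convergence[where w="\<lambda>z. cmod (F z * Gc z)"])
    show "AE z in N. (\<lambda>n. indicator (E n) z * F z * Gc z) \<longlonglongrightarrow> F z * Gc z"
      by (intro AE_I2 tendsto_mult lim tendsto_const)
    show "AE z in N. cmod (indicator (E n) z * F z * Gc z) \<le> cmod (F z * Gc z)" for n
      by (intro AE_I2) (auto simp: indicator_def)
    show "(\<lambda>z. indicator (E n) z * F z * Gc z) \<in> borel_measurable N" for n by measurable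
    show "integrable N (\<lambda>z. cmod (F z * Gc z))" using int by (rule integrable_norm)
  qed measurable
  moreover have "\<psi> (\<lambda>z. indicator (E n) z * F z) = (\<integral>z. indicator (E n) z * F z * Gc z \<partial>N)" for n
  proof -
    have "cmod (indicator (E n) z * F z) \<le> real n * k z" for z
      using k_pos[of z] by (auto simp: E_def indicator_def)
    then show ?thesis by (intro represents_belowD(2)[OF rep]) auto
  qed
  ultimately show ?thesis by (simp add: LIMSEQ_unique)
qed

end

section \<open>The duality theorem\<close>

text \<open>The infimum defining the operator norm is itself admissible: for fixed \<open>f\<close>
  of positive norm, dividing by that norm gives a lower bound for all admissible constants. If the
  norm is 0, any single constant decides.\<close>

lemma bounded_on_fun_norm:
  assumes "bounded_on T n \<phi>" "f \<in> T" "n f < \<infinity>"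
  shows "ennreal (cmod (\<phi> f)) \<le> ennreal (fun_norm T n \<phi>) * n f" and "0 \<le> fun_norm T n \<phi>"
proof -
  let ?S = "{K. K \<ge> 0 \<and> (\<forall>f\<in>T. ennreal (cmod (\<phi> f)) \<le> ennreal K * n f)}"
  have ne: "?S \<noteq> {}" using assms(1) by (auto simp: bounded_on_def)
  show nn: "0 \<le> fun_norm T n \<phi>"
    unfolding fun_norm_def by (rule cInf_greatest[OF ne]) auto
  obtain m where m: "n f = ennreal m" "0 \<le> m" using assms(3) by (cases "n f") auto
  have le: "cmod (\<phi> f) \<le> K * m" if "K \<in> ?S" for K
  proof -
    have "ennreal (cmod (\<phi> f)) \<le> ennreal K * n f" using that assms(2) by blast
    also have "\<dots> = ennreal (K * m)" using that m by (simp add: ennreal_mult)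
    finally show ?thesis using that m by (simp add: ennreal_le_iff)
  qed
  have "cmod (\<phi> f) \<le> fun_norm T n \<phi> * m"
  proof (cases "m = 0")
    case True
    obtain K where "K \<in> ?S" using ne by blast
    then show ?thesis using le[of K] True by simp
  next
    case False
    then have m_pos: "0 < m" using m by simp
    have "cmod (\<phi> f) / m \<le> fun_norm T n \<phi>"
      unfolding fun_norm_def
    proof (rule cInf_greatest[OF ne])
      fix K assume "K \<in> ?S"
      from le[OF this] show "cmod (\<phi> f) / m \<le> K" using m_pos by (simp add: divide_le_eq)
    qed
    then show ?thesis using m_pos by (simp add: divide_le_eq)
  qed
  then have "ennreal (cmod (\<phi> f)) \<le> ennreal (fun_norm T n \<phi> * m)" by (rule ennreal_leI)
  then show "ennreal (cmod (\<phi> f)) \<le> ennreal (fun_norm T n \<phi>) * n f"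
    using nn m by (simp add: ennreal_mult)
qed

context doubling_space
begin

lemma Vmul_in_tent_space_iff:
  assumes "f \<in> borel_measurable N"
  shows "f \<in> tent_space M p q s \<longleftrightarrow> tent_fun p q (Vmul M (-s) f)"
  using assms by (simp add: tent_space_def tent_fun_def tent_norm_eq_tent_int)

lemma tent_norm_Vmul:
  "tent_norm M p q s (Vmul M s F) = enn_powr (tent_int M (p/q) (\<lambda>z. cmod (F z) powr q)) (1/p)"
proof -
  have "tent_int M (p/q) (\<lambda>z. cmod (Vmul M (-s) (Vmul M s F) z) powr q) = tent_int M (p/q) (\<lambda>z. cmod (F z) powr q)"
    by (rule tent_int_cong) (simp add: Vmul_Vmul)
  then show ?thesis by (simp add: tent_norm_eq_tent_int)
qed

lemma Vmul_in_tent_space: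
  "tent_fun p q F \<Longrightarrow> Vmul M s F \<in> tent_space M p q s"
  unfolding tent_space_def mem_Collect_eq tent_norm_Vmul
  by (simp add: tent_fun_def Vmul_measurable)

lemma integrable_pairing:
  assumes p: "0 < p" "p < 1" and q: "1 \<le> q"
    and f: "f \<in> tent_space M p q s" and g: "g \<in> tent_inf_space M (hconj q) (-s) (delta 1 p)"
  shows "integrable N (\<lambda>z. f z * cnj (g z))"
proof -
  obtain C where C: "(\<integral>\<^sup>+z. ennreal (cmod (f z * cnj (g z))) \<partial>N)
      \<le> ennreal C * tent_norm M p q s f * tent_inf_norm M (hconj q) (-s) (delta 1 p) g"
    using pairing_bounded[OF p q] f g by blast
  also have "\<dots> < \<infinity>" using f g by (simp add: tent_space_def tent_inf_space_def ennreal_mult_less_top)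
  finally have fin: "(\<integral>\<^sup>+z. ennreal (norm (f z * cnj (g z))) \<partial>N) < \<infinity>" .
  have [measurable]: "f \<in> borel_measurable N" "g \<in> borel_measurable N"
    using f g by (auto simp: tent_space_def tent_inf_space_def)
  have "(\<lambda>z. f z * cnj (g z)) \<in> borel_measurable N" by measurable
  then show ?thesis using fin by (rule integrableI_bounded)
qed

lemma functional_is_pairing:
  assumes p: "0 < p" "p < 1" and q: "1 \<le> q"
    and lin: "linear_on (tent_space M p q s) \<phi>"
    and bdd: "bounded_on (tent_space M p q s) (tent_norm M p q s) \<phi>"
  defines "K \<equiv> fun_norm (tent_space M p q s) (tent_norm M p q s) \<phi>"
  shows "\<exists>g. g \<in> borel_measurable N \<and> tent_inf_norm M (hconj q) (-s) (delta 1 p) g \<le> ennreal K \<and>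
    (\<forall>f\<in>tent_space M p q s. \<phi> f = pairing M f g)"
proof -
  let ?T = "tent_space M p q s"
  have \<phi>_bound: "ennreal (cmod (\<phi> f)) \<le> ennreal K * tent_norm M p q s f" if "f \<in> ?T" for f
    unfolding K_def using bounded_on_fun_norm(1)[OF bdd that] that by (simp add: tent_space_def)
  have zero: "(\<lambda>z. 0) \<in> ?T"
    by (simp add: tent_space_def tent_norm_eq_tent_int cmod_Vmul tent_int_def cone_int_def)
  have K: "0 \<le> K"
    unfolding K_def using bounded_on_fun_norm(2)[OF bdd zero] zero by (simp add: tent_space_def)
  have \<phi>_add: "\<phi> (\<lambda>z. f z + h z) = \<phi> f + \<phi> h" if "f \<in> ?T" "h \<in> ?T" for f h
    using lin that by (simp add: linear_on_def)
  have \<phi>_scale: "\<phi> (\<lambda>z. c * f z) = c * \<phi> f" if "f \<in> ?T" for f c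
    using lin that by (simp add: linear_on_def)
  define \<psi> where "\<psi> F = \<phi> (Vmul M s F)" for F
  have \<psi>_add: "\<psi> (\<lambda>z. F z + H z) = \<psi> F + \<psi> H" if "tent_fun p q F" "tent_fun p q H" for F H
  proof -
    have "Vmul M s (\<lambda>z. F z + H z) = (\<lambda>z. Vmul M s F z + Vmul M s H z)"
      by (rule ext) (simp add: Vmul_eq distrib_left)
    then show ?thesis using that by (simp add: \<psi>_def \<phi>_add Vmul_in_tent_space)
  qed
  have \<psi>_scale: "\<psi> (\<lambda>z. c * F z) = c * \<psi> F" if "tent_fun p q F" for F c
  proof -
    have "Vmul M s (\<lambda>z. c * F z) = (\<lambda>z. c * Vmul M s F z)"
      by (rule ext) (simp add: Vmul_eq mult_ac)
    then show ?thesis using that by (simp add: \<psi>_def \<phi>_scale Vmul_in_tent_space)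
  qed
  have \<psi>_bound: "ennreal (cmod (\<psi> F)) \<le> ennreal K * enn_powr (tent_int M (p/q) (\<lambda>z. cmod (F z) powr q)) (1/p)"
    if "tent_fun p q F" for F
    using \<phi>_bound[OF Vmul_in_tent_space[OF that]] by (simp add: \<psi>_def tent_norm_Vmul)
  interpret tent_functional M D p q K \<psi>
    by unfold_locales (fact p q K \<psi>_add \<psi>_scale \<psi>_bound)+
  obtain k Gc where k: "k \<in> borel_measurable N" "\<And>z. 0 < k z" and Gc [measurable]: "Gc \<in> borel_measurable N"
    and rep: "represents_below \<psi> k Gc"
    using functional_representation by blast
  \<comment> \<open>The conjugate matches the conjugation in the pairing, and the weight undoes the
    transport of the functional to s = 0.\<close>
  define g where "g = Vmul M (-s) (\<lambda>z. cnj (Gc z))"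
  have g [measurable]: "g \<in> borel_measurable N" unfolding g_def by measurable
  have Vg: "Vmul M s g z = cnj (Gc z)" if "0 < snd z" for z
    using Vmul_Vmul[OF that, of "-s" "\<lambda>z. cnj (Gc z)"] by (simp add: g_def)
  have g_norm: "tent_inf_norm M (hconj q) (-s) (delta 1 p) g \<le> ennreal K"
  proof (cases "q = 1")
    case True
    have "AE z in N. z \<in> tent (ball y \<rho>) \<longrightarrow> cmod (Vmul M s g z) \<le> K * Vol M y \<rho> powr (1/p - 1)" for y \<rho>
      using representer_bound_1[OF True k Gc rep, where y = y and \<rho> = \<rho>] AE_N_pos
      by eventually_elim (simp add: Vg)
    then show ?thesis unfolding True tent_inf_norm_hconj_1[OF K g] by blast
  next
    case False
    define r where "r = q / (q - 1)"
    have qr: "1 < q" "1/q + 1/r = 1" using q False by (auto simp: r_def field_simps)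
    have "(\<integral>\<^sup>+z. indicator (tent (ball y \<rho>)) z * ennreal (cmod (Vmul M s g z) powr r) \<partial>N)
       = (\<integral>\<^sup>+z. indicator (tent (ball y \<rho>)) z * ennreal (cmod (Gc z) powr r) \<partial>N)" for y \<rho>
      by (rule nn_integral_cong_AE) (use AE_N_pos in \<open>eventually_elim, simp add: Vg\<close>)
    then show ?thesis
      unfolding tent_inf_norm_hconj_gt_1[OF qr K g]
      using representer_bound_gt_1[OF qr k Gc rep] by simp
  qed
  then have g_space: "g \<in> tent_inf_space M (hconj q) (-s) (delta 1 p)"
    using g by (auto simp: tent_inf_space_def intro: order_le_less_trans)
  have "\<phi> f = pairing M f g" if f: "f \<in> ?T" for f
  proof -
    have fm [measurable]: "f \<in> borel_measurable N" using f by (simp add: tent_space_def)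
    let ?F = "Vmul M (-s) f"
    have F: "tent_fun p q ?F" using f Vmul_in_tent_space_iff[OF fm] by blast
    let ?f' = "Vmul M s ?F"
    have f': "?f' \<in> ?T" by (rule Vmul_in_tent_space[OF F])
    \<comment> \<open>At heights t \<le> 0 balls are empty and the weight is 0, so removing and
      restoring it may change \<open>f\<close> there. The functional acts on functions and not on
      classes; the difference \<open>d\<close> has norm 0 and is annihilated by boundedness.\<close>
    define d where "d z = f z - ?f' z" for z
    have d0: "d z = 0" if "0 < snd z" for z
      using Vmul_Vmul[OF that, of "-s" f] by (simp add: d_def)
    have [measurable]: "d \<in> borel_measurable N" unfolding d_def by measurable
    have "tent_int M (p/q) (\<lambda>z. cmod (Vmul M (-s) d z) powr q) = tent_int M (p/q) (\<lambda>z. 0)"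
      using q by (intro tent_int_cong) (simp add: d0 cmod_Vmul)
    then have nd: "tent_norm M p q s d = 0"
      by (simp add: tent_norm_eq_tent_int tent_int_def cone_int_def)
    then have d: "d \<in> ?T" by (simp add: tent_space_def)
    have "\<phi> d = 0" using \<phi>_bound[OF d] nd by simp
    then have "\<phi> f = \<psi> ?F" using \<phi>_add[OF f' d] by (simp add: d_def \<psi>_def)
    have eq: "f z * cnj (g z) = ?F z * Gc z" for z
      by (simp add: g_def Vmul_eq mult_ac)
    have "integrable N (\<lambda>z. ?F z * Gc z)"
      using integrable_pairing[OF p q f g_space] unfolding eq .
    then have "\<psi> ?F = (\<integral>z. ?F z * Gc z \<partial>N)"
      by (rule functional_representation_extends[OF k Gc rep F])
    then show ?thesis using \<open>\<phi> f = \<psi> ?F\<close> by (simp add: pairing_def eq)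
  qed
  then show ?thesis using g g_norm by blast
qed

end

theorem mainTheorem6:
  fixes M :: "('a::{metric_space, second_countable_topology}) measure"
    and p q s :: real
  assumes "nondeg_doubling M"
    and "0 < p" "p < 1" "1 \<le> q"
  shows "\<exists>C>0.
    (\<forall>g \<in> tent_inf_space M (hconj q) (-s) (delta 1 p).
       \<forall>f \<in> tent_space M p q s.
         integrable (Xplus M) (\<lambda>z. f z * cnj (g z)) \<and>
         ennreal (cmod (pairing M f g))
           \<le> ennreal C * tent_norm M p q s f * tent_inf_norm M (hconj q) (-s) (delta 1 p) g) \<and>
    (\<forall>\<phi>. linear_on (tent_space M p q s) \<phi> \<and> bounded_on (tent_space M p q s) (tent_norm M p q s) \<phi> \<longrightarrow>
       (\<exists>g \<in> tent_inf_space M (hconj q) (-s) (delta 1 p).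
          (\<forall>f \<in> tent_space M p q s. \<phi> f = pairing M f g) \<and>
          tent_inf_norm M (hconj q) (-s) (delta 1 p) g
            \<le> ennreal (C * fun_norm (tent_space M p q s) (tent_norm M p q s) \<phi>)))"
proof -
  obtain D\<^sub>0 where D\<^sub>0: "\<And>x r. r > 0 \<Longrightarrow> measure M (ball x (2*r)) \<le> D\<^sub>0 * measure M (ball x r)"
    using assms(1) unfolding nondeg_doubling_def by blast
  interpret doubling_space M "max 1 D\<^sub>0"
  proof
    fix x :: 'a and r :: real assume r: "0 < r"
    have "D\<^sub>0 * measure M (ball x r) \<le> max 1 D\<^sub>0 * measure M (ball x r)"
      by (intro mult_right_mono) auto
    then show "measure M (ball x (2 * r)) \<le> max 1 D\<^sub>0 * measure M (ball x r)"
      using D\<^sub>0[OF r, of x] by linarith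
  qed (use assms(1) in \<open>auto simp: nondeg_doubling_def\<close>)
  note p = assms(2,3) and q = assms(4)
  obtain C where C: "0 < C" and le: "\<And>s f g. f \<in> tent_space M p q s \<Longrightarrow>
      g \<in> tent_inf_space M (hconj q) (-s) (delta 1 p) \<Longrightarrow>
      (\<integral>\<^sup>+z. ennreal (cmod (f z * cnj (g z))) \<partial>N)
        \<le> ennreal C * tent_norm M p q s f * tent_inf_norm M (hconj q) (-s) (delta 1 p) g"
    using pairing_bounded[OF p q] by blast
  show ?thesis
  \<comment> \<open>One constant must serve both halves: the pairing bound holds with
    \<open>C\<close>, the representation with 1.\<close>
  proof (intro exI[of _ "C + 1"] conjI ballI allI impI)
    show "0 < C + 1" using C by simp
  next
    fix f g assume g: "g \<in> tent_inf_space M (hconj q) (-s) (delta 1 p)" and f: "f \<in> tent_space M p q s"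
    show int: "integrable N (\<lambda>z. f z * cnj (g z))"
      by (rule integrable_pairing[OF p q f g])
    have "ennreal (cmod (pairing M f g)) \<le> (\<integral>\<^sup>+z. ennreal (cmod (f z * cnj (g z))) \<partial>N)"
      unfolding pairing_def by (rule integral_norm_bound_ennreal[OF int])
    also have "\<dots> \<le> ennreal C * tent_norm M p q s f * tent_inf_norm M (hconj q) (-s) (delta 1 p) g"
      by (rule le[OF f g])
    also have "\<dots> \<le> ennreal (C + 1) * tent_norm M p q s f * tent_inf_norm M (hconj q) (-s) (delta 1 p) g"
      by (intro mult_right_mono ennreal_leI) auto
    finally show "ennreal (cmod (pairing M f g)) \<le> \<dots>" .
  next
    fix \<phi> assume \<phi>: "linear_on (tent_space M p q s) \<phi> \<and> bounded_on (tent_space M p q s) (tent_norm M p q s) \<phi>"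
    let ?K = "fun_norm (tent_space M p q s) (tent_norm M p q s) \<phi>"
    obtain g where g: "g \<in> borel_measurable N" "tent_inf_norm M (hconj q) (-s) (delta 1 p) g \<le> ennreal ?K"
      "\<forall>f\<in>tent_space M p q s. \<phi> f = pairing M f g"
      using functional_is_pairing[OF p q] \<phi> by blast
    have "ennreal ?K \<le> ennreal ((C + 1) * ?K)"
    proof (cases "0 \<le> ?K")
      case True
      then have "1 * ?K \<le> (C + 1) * ?K" using C by (intro mult_right_mono) auto
      then show ?thesis by (intro ennreal_leI) simp
    qed (simp add: ennreal_neg)
    then have "tent_inf_norm M (hconj q) (-s) (delta 1 p) g \<le> ennreal ((C + 1) * ?K)"
      using g(2) by (rule order_trans[rotated])
    moreover have "g \<in> tent_inf_space M (hconj q) (-s) (delta 1 p)"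
      using g(1,2) by (auto simp: tent_inf_space_def intro: order_le_less_trans)
    ultimately show "\<exists>g\<in>tent_inf_space M (hconj q) (-s) (delta 1 p).
        (\<forall>f\<in>tent_space M p q s. \<phi> f = pairing M f g) \<and>
        tent_inf_norm M (hconj q) (-s) (delta 1 p) g \<le> ennreal ((C + 1) * ?K)"
      using g(3) by blast
  qed
qed

end
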